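(* Let $\lambda>0$, $s\in[k-1,k)$ with $k\in\mathbb N$, and $f\in L^2(\mathbb R^+)$. Let $u$ be the solution of $${}_0D_x^{s,\lambda}u(x)=f(x),\quad x\in\mathbb R^+;\qquad u^{(j)}(0)=0,\quad j=0,1,\dots,k-1,$$ and let $u_N\in\mathcal F_N^{s,\lambda}(\mathbb R^+)$ be the solution of the Petrov–Galerkin scheme $$({}_0D_x^{s,\lambda}u_N,v_N)=(f,v_N)\qquad\text{for all } v_N\in\mathcal F_N^{0,\lambda}(\mathbb R^+).$$ Then for ${}_0D_x^{m,\lambda}f\in L^2_{\omega^m}(\mathbb R^+)$ with $m\in\mathbb N_0$, we have $$\|u-u_N\|_{\omega^{-s}}\le c\,(2\lambda N)^{-\frac{s+m}{2}}\,\big\|{}_0D_x^{s+m,\lambda}u\big\|_{\omega^m}=c\,(2\lambda N)^{-\frac{s+m}{2}}\,\big\|{}_0D_x^{m,\lambda}f\big\|_{\omega^m},$$ where $c\approx1$ for large $N$.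
   Context: $\mathbb N=\{1,2,\dots\}$, $\mathbb N_0=\mathbb N\cup\{0\}$, $\mathbb R^+=(0,\infty)$. For real $a$, $\omega^a(x)=x^a$ on $\mathbb R^+$; $(f,g)_{\omega}=\int_0^\infty f\,\bar g\,\omega\,dx$, $\|f\|_\omega^2=(f,f)_\omega$, $L^2_\omega(\mathbb R^+)$ is the corresponding weighted space; the subscript is omitted when $\omega\equiv1$. For $\mu>0$, ${}_0I_x^{\mu}u(x)=\frac1{\Gamma(\mu)}\int_0^x (x-y)^{\mu-1}u(y)\,dy$; for $\mu\in[j-1,j)$, $j\in\mathbb N$, the Riemann–Liouville derivative is ${}_0D_x^{\mu}u=\frac{d^j}{dx^j}\,{}_0I_x^{j-\mu}u$ (so order $0$ is the identity and integer orders are ordinary derivatives). The left tempered fractional derivative is ${}_0D_x^{\mu,\lambda}u(x)=e^{-\lambda x}\,{}_0D_x^{\mu}\{e^{\lambda x}u(x)\}$. For $s>0$ the solution of the initial value problem is $u(x)=\frac{e^{-\lambda x}}{\Gamma(s)}\int_0^x(x-\tau)^{s-1}e^{\lambda\tau}f(\tau)\,d\tau$. With $\mathcal P_N$ the polynomials of degree at most $N$, $\mathcal F_N^{\nu,\lambda}(\mathbb R^+)=\{x^\nu e^{-\lambda x}p(x):p\in\mathcal P_N\}$ for $\nu\ge0$.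
   Formalization: The estimate is stated for N ≥ 1 and m ≤ N+1; for m > N+1 it fails for every c, e.g. f = e^{-λx}L_{N+1}(2λx) (Laguerre polynomial), where the m-th tempered derivative of f and u_N vanish but u does not. *)

theory Defs
  imports "HOL-Analysis.Analysis" "HOL-Computational_Algebra.Polynomial"
begin

text \<open>
  Functions on the half line \<open>(0,\<infinity>)\<close> are total functions on the reals; only their values at
  positive arguments matter (except for the initial values at \<open>0\<close> below). They are
  complex-valued, in accordance with the conjugate in the inner product; the real-valued case is
  contained in this one.
\<close>

text \<open>The weight with exponent \<open>a\<close> is \<open>x powr a\<close>.\<close>

definition wL2 :: "real \<Rightarrow> (real \<Rightarrow> complex) set" where
  "wL2 a = {f. f \<in> borel_measurable (lebesgue_on {0<..}) \<and>
     integrable (lebesgue_on {0<..}) (\<lambda>x. (cmod (f x))\<^sup>2 * x powr a)}"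

definition wnorm :: "real \<Rightarrow> (real \<Rightarrow> complex) \<Rightarrow> real" where
  "wnorm a f = sqrt (integral\<^sup>L (lebesgue_on {0<..}) (\<lambda>x. (cmod (f x))\<^sup>2 * x powr a))"

definition L2_inner :: "(real \<Rightarrow> complex) \<Rightarrow> (real \<Rightarrow> complex) \<Rightarrow> complex" where
  "L2_inner f g = integral\<^sup>L (lebesgue_on {0<..}) (\<lambda>x. f x * cnj (g x))"

definition rl_integral :: "real \<Rightarrow> (real \<Rightarrow> complex) \<Rightarrow> real \<Rightarrow> complex" where
  "rl_integral \<mu> u x =
     (1 / Gamma \<mu>) *\<^sub>R (LINT y:{0<..<x}|lebesgue. ((x - y) powr (\<mu> - 1)) *\<^sub>R u y)"

text \<open>
  \<open>ac_deriv j h g\<close>: the \<open>j\<close>-th derivative of \<open>h\<close> on \<open>(0,\<infinity>)\<close> is \<open>g\<close>, in the usual Lebesgue sense.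
  For \<open>j \<ge> 1\<close> it says that \<open>h\<close> is \<open>j - 1\<close> times continuously differentiable, that its derivative of
  order \<open>j - 1\<close> is locally absolutely continuous on the open half line, and that the derivative
  of the latter is \<open>g\<close> almost everywhere. (Mere almost-everywhere differentiability would not
  determine solutions of differential equations, because of Cantor-type functions.)
\<close>

primrec ac_deriv :: "nat \<Rightarrow> (real \<Rightarrow> complex) \<Rightarrow> (real \<Rightarrow> complex) \<Rightarrow> bool" where
  "ac_deriv 0 h g \<longleftrightarrow> (AE x in lebesgue_on {0<..}. h x = g x)"
| "ac_deriv (Suc j) h g \<longleftrightarrow>
     (\<exists>h'. (\<forall>a b. 0 < a \<and> a \<le> b \<longrightarrow>
              set_integrable lebesgue {a..b} h' \<and> h b - h a = (LINT x:{a..b}|lebesgue. h' x)) \<and>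
           ac_deriv j h' g)"

text \<open>
  Riemann--Liouville derivative of order \<open>\<mu> \<ge> 0\<close>, with \<open>j = \<lfloor>\<mu>\<rfloor> + 1\<close> being the integer such that
  \<open>\<mu> \<in> [j - 1, j)\<close>. It is a relation since the derivative is only determined almost everywhere.
  Local integrability up to \<open>0\<close> ensures that the fractional integral is meaningful.
\<close>

definition has_rl_deriv :: "real \<Rightarrow> (real \<Rightarrow> complex) \<Rightarrow> (real \<Rightarrow> complex) \<Rightarrow> bool" where
  "has_rl_deriv \<mu> u g \<longleftrightarrow>
     (let j = nat \<lfloor>\<mu>\<rfloor> + 1 in
       (\<forall>x>0. set_integrable lebesgue {0<..<x} u) \<and>
       ac_deriv j (rl_integral (real j - \<mu>) u) g)"

definition has_tempered_deriv ::
    "real \<Rightarrow> real \<Rightarrow> (real \<Rightarrow> complex) \<Rightarrow> (real \<Rightarrow> complex) \<Rightarrow> bool" where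
  "has_tempered_deriv \<mu> lam u g \<longleftrightarrow>
     (\<exists>h. has_rl_deriv \<mu> (\<lambda>x. exp (lam * x) *\<^sub>R u x) h \<and> g = (\<lambda>x. exp (- lam * x) *\<^sub>R h x))"

text \<open>
  \<open>u\<^bsup>(j)\<^esup>(0) = 0\<close> for \<open>j < k\<close>, with one-sided derivatives at \<open>0\<close>; \<open>U j\<close> is the \<open>j\<close>-th derivative.
  The derivative of order \<open>k - 1\<close> is only required to exist at \<open>0\<close>. Continuity at \<open>0\<close>
  matters for \<open>k = 1\<close> only.
\<close>

definition zero_initial_derivs :: "nat \<Rightarrow> (real \<Rightarrow> complex) \<Rightarrow> bool" where
  "zero_initial_derivs k u \<longleftrightarrow>
     continuous (at 0 within {0..}) u \<and>
     (\<exists>U :: nat \<Rightarrow> real \<Rightarrow> complex. U 0 = u \<and> (\<forall>j<k. U j 0 = 0) \<and>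
        (\<forall>j. Suc j < k \<longrightarrow> (U j has_vector_derivative U (Suc j) 0) (at 0 within {0..})) \<and>
        (\<forall>j x. Suc (Suc j) < k \<and> 0 < x \<longrightarrow> (U j has_vector_derivative U (Suc j) x) (at x)))"

definition solves_tempered_ivp ::
    "nat \<Rightarrow> real \<Rightarrow> real \<Rightarrow> (real \<Rightarrow> complex) \<Rightarrow> (real \<Rightarrow> complex) \<Rightarrow> bool" where
  "solves_tempered_ivp k s lam f u \<longleftrightarrow> has_tempered_deriv s lam u f \<and> zero_initial_derivs k u"

text \<open>The tempered fractional integral of order \<open>s \<ge> 0\<close>, order \<open>0\<close> being the identity.\<close>

definition tempered_integral :: "real \<Rightarrow> real \<Rightarrow> (real \<Rightarrow> complex) \<Rightarrow> real \<Rightarrow> complex" where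
  "tempered_integral s lam f x =
     (if s = 0 then f x
      else exp (- lam * x) *\<^sub>R rl_integral s (\<lambda>t. exp (lam * t) *\<^sub>R f t) x)"

text \<open>
  For a general square-integrable \<open>f\<close> the initial value problem is solved by the tempered
  fractional integral of \<open>f\<close>, but \<open>u\<^bsup>(k-1)\<^esup>(0)\<close> need not exist literally. Both readings of
  ``the solution'' are admitted: a function satisfying the equation and the initial conditions
  literally, and the integral formula.
\<close>

definition tempered_ivp_solution ::
    "nat \<Rightarrow> real \<Rightarrow> real \<Rightarrow> (real \<Rightarrow> complex) \<Rightarrow> (real \<Rightarrow> complex) \<Rightarrow> bool" where
  "tempered_ivp_solution k s lam f u \<longleftrightarrow>
     solves_tempered_ivp k s lam f u \<or>
     (AE x in lebesgue_on {0<..}. u x = tempered_integral s lam f x)"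

definition tempered_polys :: "real \<Rightarrow> real \<Rightarrow> nat \<Rightarrow> (real \<Rightarrow> complex) set" where
  "tempered_polys \<nu> lam N = {\<phi>. \<exists>p :: complex poly. degree p \<le> N \<and>
     (\<forall>x>0. \<phi> x = (x powr \<nu> * exp (- lam * x)) *\<^sub>R poly p (complex_of_real x))}"

definition petrov_galerkin_solution ::
    "real \<Rightarrow> real \<Rightarrow> nat \<Rightarrow> (real \<Rightarrow> complex) \<Rightarrow> (real \<Rightarrow> complex) \<Rightarrow> bool" where
  "petrov_galerkin_solution s lam N f uN \<longleftrightarrow>
     uN \<in> tempered_polys s lam N \<and>
     (\<exists>w. has_tempered_deriv s lam uN w \<and>
          (\<forall>v \<in> tempered_polys 0 lam N. L2_inner w v = L2_inner f v))"

end

theory Submission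
  imports Defs
begin

text \<open>
  In terms of Laguerre functions every operator in the statement is diagonal, and the estimate
  becomes a comparison of diagonal entries. Put \<open>b = 2\<lambda>\<close>, and let \<open>\<phi>\<^sub>n\<close> be the
  normalised Laguerre function \<open>\<surd>b e\<^bsup>-\<lambda>x\<^esup> L\<^sub>n(bx)\<close>. The \<open>\<phi>\<^sub>n\<close> with \<open>n \<le> N\<close> span the test space of
  the scheme, so \<open>u\<^sub>N\<close> is the tempered fractional integral \<open>T\<close> of the orthogonal projection of
  \<open>f\<close> onto the first \<open>N + 1\<close> of them (\<open>petrov_galerkin_projection\<close>), and \<open>u - u\<^sub>N = T r\<close>, where the
  remainder \<open>r\<close> has the coefficients \<open>f\<^sub>n\<close> of \<open>f\<close> for \<open>n > N\<close> only.

  On the one hand, \<open>T\<close> maps \<open>\<phi>\<^sub>n\<close> to a multiple of \<open>x\<^sup>s e\<^bsup>-\<lambda>x\<^esup> L\<^sub>n\<^bsup>(s)\<^esup>(bx)\<close>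
  (\<open>tempered_integral_laguerre\<close>). These functions are orthogonal for the weight \<open>x\<^bsup>-s\<^esup>\<close>, so that
  \<open>\<parallel>T r\<parallel>\<^sup>2 = \<Sum>\<^bsub>n>N\<^esub> |f\<^sub>n|\<^sup>2 b\<^bsup>-s\<^esup> n! / \<Gamma>(n+s+1)\<close>. The estimate \<open>\<le>\<close>
  (\<open>tempered_integral_sqnorm_le\<close>) rests on the completeness of the \<open>\<phi>\<^sub>n\<close> (\<open>expandable_laguerre\<close>), on the
  continuity of \<open>T\<close> in a weighted \<open>L\<^sup>1\<close> norm (\<open>tempered_integral_L1\<close>) and on Fatou's lemma.

  On the other hand, the tempered derivative of order \<open>m\<close> maps \<open>\<phi>\<^sub>n\<close> to a multiple of
  \<open>e\<^bsup>-\<lambda>x\<^esup> L\<^bsub>n-m\<^esub>\<^bsup>(m)\<^esup>(bx)\<close>, and these functions are orthogonal for the weight \<open>x\<^sup>m\<close>. Integrating by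
  parts \<open>m\<close> times expresses the coefficients of \<open>g\<close>, the derivative of \<open>f\<close>, through the \<open>f\<^sub>n\<close>
  (\<open>laguerre_coef_tempered_deriv\<close>), and Bessel's inequality gives
  \<open>\<parallel>g\<parallel>\<^sup>2 \<ge> \<Sum>\<^bsub>n\<ge>m\<^esub> |f\<^sub>n|\<^sup>2 b\<^sup>m n! / (n-m)!\<close>. The analytic point is that the boundary
  terms vanish: each intermediate derivative inherits a bound
  from the next higher one (\<open>growth_bound_integrate\<close>).

  The quotient of the two diagonal entries is \<open>b\<^bsup>-(s+m)\<^esup> (n-m)! / \<Gamma>(n+s+1)\<close>, which decreases in \<open>n\<close>; its
  value at \<open>n = N + 1\<close> is the square of the factor in the theorem, and \<open>c \<rightarrow> 1\<close> is the asymptotics of a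
  quotient of Gamma functions (\<open>error_constant_limit\<close>).

  It remains to identify the solution of the initial value problem with \<open>T f\<close>
  (\<open>solves_tempered_ivp_integral_formula\<close>). Throughout, the semigroup law of fractional
  integrals (\<open>rl_integral_rl_integral\<close>) is stated for a total order of at least \<open>1\<close>, where it holds at every
  point and not only almost everywhere.
\<close>

section \<open>Square-integrable functions and orthonormal sequences\<close>

definition square_integrable :: "'a measure \<Rightarrow> ('a \<Rightarrow> complex) \<Rightarrow> bool" where
  "square_integrable M f \<longleftrightarrow> f \<in> borel_measurable M \<and> integrable M (\<lambda>x. (cmod (f x))\<^sup>2)"

lemma square_integrableD:
  assumes "square_integrable M f"
  shows "f \<in> borel_measurable M" "integrable M (\<lambda>x. (cmod (f x))\<^sup>2)"
  using assms by (auto simp: square_integrable_def)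

lemma two_mult_le_sum_squares: "2 * (x * y) \<le> x\<^sup>2 + (y::real)\<^sup>2"
  using sum_squares_bound[of x y] by (simp add: mult.assoc)

lemma integrable_mult_square_integrable:
  assumes "square_integrable M f" "square_integrable M g"
  shows "integrable M (\<lambda>x. f x * g x)"
proof (rule Bochner_Integration.integrable_bound)
  show "integrable M (\<lambda>x. (cmod (f x))\<^sup>2 + (cmod (g x))\<^sup>2)"
    using assms by (auto simp: square_integrable_def)
  show "(\<lambda>x. f x * g x) \<in> borel_measurable M"
    using assms by (auto simp: square_integrable_def)
  show "AE x in M. cmod (f x * g x) \<le> norm ((cmod (f x))\<^sup>2 + (cmod (g x))\<^sup>2)"
  proof (rule AE_I2)
    fix x
    have "2 * (cmod (f x) * cmod (g x)) \<le> (cmod (f x))\<^sup>2 + (cmod (g x))\<^sup>2"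
      by (rule two_mult_le_sum_squares)
    moreover have "0 \<le> cmod (f x) * cmod (g x)" by simp
    ultimately have "cmod (f x) * cmod (g x) \<le> (cmod (f x))\<^sup>2 + (cmod (g x))\<^sup>2" by linarith
    thus "cmod (f x * g x) \<le> norm ((cmod (f x))\<^sup>2 + (cmod (g x))\<^sup>2)"
      by (simp add: norm_mult)
  qed
qed

lemma cmod_add_square_le: "(cmod (x + y))\<^sup>2 \<le> 2 * (cmod x)\<^sup>2 + 2 * (cmod y)\<^sup>2"
proof -
  have "(cmod (x + y))\<^sup>2 \<le> (cmod x + cmod y)\<^sup>2"
    by (intro power_mono norm_triangle_ineq) auto
  also have "\<dots> \<le> 2 * (cmod x)\<^sup>2 + 2 * (cmod y)\<^sup>2"
    using two_mult_le_sum_squares[of "cmod x" "cmod y"] by (simp add: power2_sum)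
  finally show ?thesis .
qed

lemma square_integrable_bound:
  assumes "integrable M h" "f \<in> borel_measurable M" "AE x in M. (cmod (f x))\<^sup>2 \<le> h x"
  shows "square_integrable M f"
  unfolding square_integrable_def
proof
  show "integrable M (\<lambda>x. (cmod (f x))\<^sup>2)"
  proof (rule Bochner_Integration.integrable_bound[OF assms(1)])
    show "(\<lambda>x. (cmod (f x))\<^sup>2) \<in> borel_measurable M" using assms(2) by measurable
    show "AE x in M. norm ((cmod (f x))\<^sup>2) \<le> norm (h x)"
      using assms(3) by eventually_elim simp
  qed
qed fact

lemma square_integrable_add:
  assumes "square_integrable M f" "square_integrable M g"
  shows "square_integrable M (\<lambda>x. f x + g x)"
  using assms
  by (intro square_integrable_bound[where h = "\<lambda>x. 2 * (cmod (f x))\<^sup>2 + 2 * (cmod (g x))\<^sup>2"])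
     (auto simp: square_integrable_def cmod_add_square_le)

lemma square_integrable_mult_left:
  "square_integrable M f \<Longrightarrow> square_integrable M (\<lambda>x. c * f x)"
  by (auto simp: square_integrable_def norm_mult power_mult_distrib)

lemma square_integrable_diff:
  assumes "square_integrable M f" "square_integrable M g"
  shows "square_integrable M (\<lambda>x. f x - g x)"
  using square_integrable_add[OF assms(1) square_integrable_mult_left[OF assms(2), of "-1"]] by simp

lemma square_integrable_zero: "square_integrable M (\<lambda>x. 0)"
  by (simp add: square_integrable_def)

lemma square_integrable_sum:
  "(\<And>i. i \<in> I \<Longrightarrow> square_integrable M (f i)) \<Longrightarrow> square_integrable M (\<lambda>x. \<Sum>i\<in>I. f i x)"
  by (induction I rule: infinite_finite_induct)
     (auto simp: square_integrable_zero intro: square_integrable_add)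

lemma square_integrable_cong_AE:
  assumes "square_integrable M f" "g \<in> borel_measurable M" "AE x in M. f x = g x"
  shows "square_integrable M g"
  by (rule square_integrable_bound[OF square_integrableD(2)[OF assms(1)] assms(2)])
     (use assms(3) in eventually_elim, simp)

definition sqnorm :: "'a measure \<Rightarrow> ('a \<Rightarrow> complex) \<Rightarrow> real" where
  "sqnorm M f = (\<integral>x. (cmod (f x))\<^sup>2 \<partial>M)"

lemma sqnorm_nonneg: "0 \<le> sqnorm M f"
  by (simp add: sqnorm_def)

lemma sqnorm_cong_AE:
  assumes "f \<in> borel_measurable M" "g \<in> borel_measurable M" "AE x in M. f x = g x"
  shows "sqnorm M f = sqnorm M g"
  unfolding sqnorm_def using assms by (intro integral_cong_AE) auto

lemma sqnorm_add_le:
  assumes "square_integrable M f" "square_integrable M g"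
  shows "sqnorm M (\<lambda>x. f x + g x) \<le> 2 * sqnorm M f + 2 * sqnorm M g"
proof -
  have "sqnorm M (\<lambda>x. f x + g x) \<le> (\<integral>x. 2 * (cmod (f x))\<^sup>2 + 2 * (cmod (g x))\<^sup>2 \<partial>M)"
    unfolding sqnorm_def
    using square_integrableD(2)[OF square_integrable_add[OF assms]] assms
    by (intro integral_mono) (auto simp: cmod_add_square_le square_integrable_def)
  also have "\<dots> = 2 * sqnorm M f + 2 * sqnorm M g"
    using assms by (simp add: sqnorm_def square_integrable_def)
  finally show ?thesis .
qed

lemma sqnorm_mult_left: "sqnorm M (\<lambda>x. c * f x) = (cmod c)\<^sup>2 * sqnorm M f"
  by (simp add: sqnorm_def norm_mult power_mult_distrib)

text \<open>The Cauchy--Schwarz inequality, by choosing \<open>t\<close> in \<open>2xy \<le> tx\<^sup>2 + y\<^sup>2/t\<close>.\<close>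

lemma integral_mult_le_sqnorm:
  assumes f: "square_integrable M f" and g: "square_integrable M g"
  shows "(\<integral>x. cmod (f x) * cmod (g x) \<partial>M) \<le> sqrt (sqnorm M f) * sqrt (sqnorm M g)"
proof -
  let ?I = "\<integral>x. cmod (f x) * cmod (g x) \<partial>M"
  have i: "integrable M (\<lambda>x. cmod (f x) * cmod (g x))"
    using integrable_norm[OF integrable_mult_square_integrable[OF f g]] by (simp add: norm_mult)
  have key: "2 * ?I \<le> t * sqnorm M f + sqnorm M g / t" if t: "t > 0" for t
  proof -
    have "2 * ?I = (\<integral>x. 2 * (cmod (f x) * cmod (g x)) \<partial>M)" by simp
    also have "\<dots> \<le> (\<integral>x. t * (cmod (f x))\<^sup>2 + (cmod (g x))\<^sup>2 / t \<partial>M)"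
    proof (rule integral_mono)
      fix x
      have "2 * (cmod (f x) * cmod (g x)) = 2 * ((sqrt t * cmod (f x)) * (cmod (g x) / sqrt t))"
        using t by (simp add: field_simps)
      also have "\<dots> \<le> (sqrt t * cmod (f x))\<^sup>2 + (cmod (g x) / sqrt t)\<^sup>2"
        by (rule two_mult_le_sum_squares)
      also have "\<dots> = t * (cmod (f x))\<^sup>2 + (cmod (g x))\<^sup>2 / t"
        using t by (simp add: power_mult_distrib power_divide)
      finally show "2 * (cmod (f x) * cmod (g x)) \<le> t * (cmod (f x))\<^sup>2 + (cmod (g x))\<^sup>2 / t" .
    qed (use i f g in \<open>auto simp: square_integrable_def\<close>)
    also have "\<dots> = t * sqnorm M f + sqnorm M g / t"
      using f g by (simp add: square_integrable_def sqnorm_def)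
    finally show ?thesis .
  qed
  \<comment> \<open>The choice \<open>t = (\<parallel>g\<parallel> + \<epsilon>) / (\<parallel>f\<parallel> + \<epsilon>)\<close> avoids the degenerate cases of vanishing norms.\<close>
  let ?F = "sqrt (sqnorm M f)" and ?G = "sqrt (sqnorm M g)"
  have "?I \<le> (?F + \<epsilon>) * (?G + \<epsilon>)" if \<epsilon>: "\<epsilon> > 0" for \<epsilon>
  proof -
    have pos: "?F + \<epsilon> > 0" "?G + \<epsilon> > 0"
      using \<epsilon> sqnorm_nonneg[of M f] sqnorm_nonneg[of M g]
      by (auto intro!: add_nonneg_pos)
    define t where "t = (?G + \<epsilon>) / (?F + \<epsilon>)"
    have t: "t > 0" using pos by (simp add: t_def)
    have "sqnorm M f \<le> (?F + \<epsilon>)\<^sup>2" "sqnorm M g \<le> (?G + \<epsilon>)\<^sup>2"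
      using \<epsilon> sqnorm_nonneg[of M f] sqnorm_nonneg[of M g]
      by (auto simp: power2_sum)
    hence "t * sqnorm M f + sqnorm M g / t \<le> t * (?F + \<epsilon>)\<^sup>2 + (?G + \<epsilon>)\<^sup>2 / t"
      using t by (intro add_mono mult_left_mono divide_right_mono) auto
    also have "\<dots> = 2 * ((?F + \<epsilon>) * (?G + \<epsilon>))"
      using pos by (simp add: t_def power2_eq_square)
    finally show ?thesis using key[OF t] by simp
  qed
  hence "\<forall>\<^sub>F \<epsilon> in at_right 0. ?I \<le> (?F + \<epsilon>) * (?G + \<epsilon>)"
    by (intro eventually_at_rightI[of 0 1]) auto
  moreover have "((\<lambda>\<epsilon>. (?F + \<epsilon>) * (?G + \<epsilon>)) \<longlongrightarrow> (?F + 0) * (?G + 0)) (at_right 0)"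
    by (intro tendsto_intros)
  ultimately have "?I \<le> (?F + 0) * (?G + 0)"
    by (intro tendsto_lowerbound) auto
  thus ?thesis by simp
qed

text \<open>The sequence is real-valued, as the Laguerre functions are, while the functions expanded in it are
  complex; so no conjugate occurs in the coefficients below.\<close>

locale orthonormal_sequence =
  fixes M :: "'a measure" and e :: "nat \<Rightarrow> 'a \<Rightarrow> real"
  assumes measurable_e: "e n \<in> borel_measurable M"
    and integrable_square_e: "integrable M (\<lambda>x. (e n x)\<^sup>2)"
    and orthonormal: "(\<integral>x. e n x * e k x \<partial>M) = (if n = k then 1 else 0)"
begin

lemma square_integrable_e: "square_integrable M (\<lambda>x. of_real (e n x))"
  using measurable_e integrable_square_e by (auto simp: square_integrable_def)

definition coef :: "('a \<Rightarrow> complex) \<Rightarrow> nat \<Rightarrow> complex" where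
  "coef f n = (\<integral>x. f x * of_real (e n x) \<partial>M)"

definition partial_sum :: "('a \<Rightarrow> complex) \<Rightarrow> nat \<Rightarrow> 'a \<Rightarrow> complex" where
  "partial_sum f K x = (\<Sum>n<K. coef f n * of_real (e n x))"

lemma integrable_coef: "square_integrable M f \<Longrightarrow> integrable M (\<lambda>x. f x * of_real (e n x))"
  by (intro integrable_mult_square_integrable square_integrable_e)

lemma square_integrable_comb: "square_integrable M (\<lambda>x. \<Sum>n\<in>I. a n * of_real (e n x))"
  by (intro square_integrable_sum square_integrable_mult_left square_integrable_e)

lemma square_integrable_partial_sum: "square_integrable M (partial_sum f K)"
  unfolding partial_sum_def[abs_def] by (rule square_integrable_comb)

lemma coef_add:
  "square_integrable M f \<Longrightarrow> square_integrable M g \<Longrightarrow>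
    coef (\<lambda>x. f x + g x) n = coef f n + coef g n"
  by (simp add: coef_def distrib_right integrable_coef)

lemma coef_mult_left: "coef (\<lambda>x. c * f x) n = c * coef f n"
  by (simp add: coef_def mult.assoc)

lemma coef_diff:
  "square_integrable M f \<Longrightarrow> square_integrable M g \<Longrightarrow>
    coef (\<lambda>x. f x - g x) n = coef f n - coef g n"
  by (simp add: coef_def left_diff_distrib integrable_coef)

lemma coef_cong_AE:
  assumes "f \<in> borel_measurable M" "g \<in> borel_measurable M" "AE x in M. f x = g x"
  shows "coef f n = coef g n"
  unfolding coef_def using assms measurable_e by (intro integral_cong_AE) auto

lemma coef_comb:
  assumes "finite I"
  shows "coef (\<lambda>x. \<Sum>n\<in>I. a n * of_real (e n x)) k = (if k \<in> I then a k else 0)"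
proof -
  have "coef (\<lambda>x. \<Sum>n\<in>I. a n * of_real (e n x)) k =
      (\<integral>x. (\<Sum>n\<in>I. a n * of_real (e n x * e k x)) \<partial>M)"
    by (simp add: coef_def sum_distrib_right mult.assoc)
  also have "\<dots> = (\<Sum>n\<in>I. a n * (\<integral>x. complex_of_real (e n x * e k x) \<partial>M))"
    using integrable_coef[OF square_integrable_e]
    by (subst Bochner_Integration.integral_sum) (auto simp: mult.assoc)
  also have "\<dots> = (\<Sum>n\<in>I. if n = k then a n else 0)"
    by (intro sum.cong refl, subst integral_complex_of_real) (simp add: orthonormal)
  finally show ?thesis using assms by simp
qed

text \<open>Completing the square; Bessel's inequality and the best approximation property of the
  partial sums are read off from this identity.\<close>

lemma sqnorm_diff_comb:
  assumes f: "square_integrable M f"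
  shows "sqnorm M (\<lambda>x. f x - (\<Sum>n<K. a n * of_real (e n x))) =
    sqnorm M f - (\<Sum>n<K. (cmod (coef f n))\<^sup>2) + (\<Sum>n<K. (cmod (a n - coef f n))\<^sup>2)"
proof (induction K)
  case 0
  show ?case by simp
next
  case (Suc K)
  define g where "g x = f x - (\<Sum>n<K. a n * of_real (e n x))" for x
  have g: "square_integrable M g"
    unfolding g_def[abs_def] by (intro square_integrable_diff f square_integrable_comb)
  have cg: "coef g K = coef f K"
    unfolding g_def[abs_def] using f by (simp add: coef_diff square_integrable_comb coef_comb)
  have pt: "(cmod (g x - a K * of_real (e K x)))\<^sup>2 =
      (cmod (g x))\<^sup>2 - 2 * Re (cnj (a K) * (g x * of_real (e K x))) + (cmod (a K))\<^sup>2 * (e K x)\<^sup>2" for x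
    by (simp only: cmod_power2) (simp add: power2_eq_square algebra_simps)
  have iRe: "integrable M (\<lambda>x. Re (cnj (a K) * (g x * of_real (e K x))))"
    using integrable_coef[OF g, of K] by (intro integrable_Re integrable_mult_right) auto
  have "sqnorm M (\<lambda>x. f x - (\<Sum>n<Suc K. a n * of_real (e n x))) =
      sqnorm M (\<lambda>x. g x - a K * of_real (e K x))"
    by (simp add: g_def algebra_simps)
  also have "\<dots> = (\<integral>x. (cmod (g x))\<^sup>2 - 2 * Re (cnj (a K) * (g x * of_real (e K x)))
      + (cmod (a K))\<^sup>2 * (e K x)\<^sup>2 \<partial>M)"
    by (simp add: sqnorm_def pt)
  also have "\<dots> = sqnorm M g - 2 * Re (cnj (a K) * coef g K) + (cmod (a K))\<^sup>2"
  proof -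
    have "(\<integral>x. Re (cnj (a K) * (g x * of_real (e K x))) \<partial>M) = Re (cnj (a K) * coef g K)"
      using integrable_coef[OF g, of K]
      by (subst integral_Re) (auto simp: coef_def simp del: times_complex.sel)
    moreover have "(\<integral>x. (e K x)\<^sup>2 \<partial>M) = 1"
      using orthonormal[of K K] by (simp add: power2_eq_square)
    ultimately show ?thesis
      using square_integrableD(2)[OF g] integrable_square_e[of K] iRe
      by (simp add: sqnorm_def del: times_complex.sel)
  qed
  also have "\<dots> = sqnorm M g - (cmod (coef f K))\<^sup>2 + (cmod (a K - coef f K))\<^sup>2"
    unfolding cg by (simp only: cmod_power2) (simp add: power2_eq_square algebra_simps)
  finally show ?case using Suc by (simp add: g_def[abs_def])
qed

lemma sqnorm_diff_partial_sum:
  assumes "square_integrable M f"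
  shows "sqnorm M (\<lambda>x. f x - partial_sum f K x) = sqnorm M f - (\<Sum>n<K. (cmod (coef f n))\<^sup>2)"
  using sqnorm_diff_comb[OF assms, where a = "coef f" and K = K] by (simp add: partial_sum_def)

lemma bessel_inequality:
  assumes "square_integrable M f"
  shows "(\<Sum>n<K. (cmod (coef f n))\<^sup>2) \<le> sqnorm M f"
  using sqnorm_diff_partial_sum[OF assms, of K] sqnorm_nonneg[of M "\<lambda>x. f x - partial_sum f K x"]
  by simp

lemma sqnorm_comb: "sqnorm M (\<lambda>x. \<Sum>n<K. a n * of_real (e n x)) = (\<Sum>n<K. (cmod (a n))\<^sup>2)"
proof -
  have *: "coef (\<lambda>x. 0) n = 0" for n by (simp add: coef_def)
  have "sqnorm M (\<lambda>x. 0 - (\<Sum>n<K. a n * of_real (e n x))) = (\<Sum>n<K. (cmod (a n))\<^sup>2)"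
    by (subst sqnorm_diff_comb[OF square_integrable_zero]) (simp add: * sqnorm_def)
  thus ?thesis by (simp add: sqnorm_def)
qed

lemma best_approximation:
  assumes "square_integrable M f"
  shows "sqnorm M (\<lambda>x. f x - partial_sum f K x) \<le> sqnorm M (\<lambda>x. f x - partial_sum g K x)"
  using sqnorm_diff_partial_sum[OF assms, of K]
    sqnorm_diff_comb[OF assms, where a = "coef g" and K = K]
  by (simp add: partial_sum_def sum_nonneg)

text \<open>The functions in the closed linear span of the sequence. Since partial sums are best approximations,
  a function is in that span if and only if its own partial sums converge to it.\<close>

definition expandable :: "('a \<Rightarrow> complex) \<Rightarrow> bool" where
  "expandable f \<longleftrightarrow> square_integrable M f \<and>
     (\<lambda>K. sqnorm M (\<lambda>x. f x - partial_sum f K x)) \<longlonglongrightarrow> 0"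

lemma expandable_square_integrable: "expandable f \<Longrightarrow> square_integrable M f"
  by (simp add: expandable_def)

lemma expandable_add:
  assumes f: "expandable f" and g: "expandable g"
  shows "expandable (\<lambda>x. f x + g x)"
proof -
  note sq = expandable_square_integrable[OF f] expandable_square_integrable[OF g]
  have eq: "f x + g x - partial_sum (\<lambda>x. f x + g x) K x =
      (f x - partial_sum f K x) + (g x - partial_sum g K x)" for x K
    using sq by (simp add: partial_sum_def coef_add distrib_right sum.distrib)
  have "(\<lambda>K. sqnorm M (\<lambda>x. f x + g x - partial_sum (\<lambda>x. f x + g x) K x)) \<longlonglongrightarrow> 0"
  proof (rule tendsto_sandwich[OF _ _ tendsto_const])
    show "\<forall>\<^sub>F K in sequentially. sqnorm M (\<lambda>x. f x + g x - partial_sum (\<lambda>x. f x + g x) K x) \<le>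
      2 * sqnorm M (\<lambda>x. f x - partial_sum f K x) + 2 * sqnorm M (\<lambda>x. g x - partial_sum g K x)"
      unfolding eq
      by (intro always_eventually allI sqnorm_add_le square_integrable_diff sq
          square_integrable_partial_sum)
    show "(\<lambda>K. 2 * sqnorm M (\<lambda>x. f x - partial_sum f K x) +
        2 * sqnorm M (\<lambda>x. g x - partial_sum g K x)) \<longlonglongrightarrow> 0"
      using f g by (auto simp: expandable_def intro!: tendsto_eq_intros)
  qed (simp add: sqnorm_nonneg)
  thus ?thesis using square_integrable_add[OF sq] by (simp add: expandable_def)
qed

lemma expandable_mult_left:
  assumes f: "expandable f"
  shows "expandable (\<lambda>x. c * f x)"
proof -
  have eq: "c * f x - partial_sum (\<lambda>x. c * f x) K x = c * (f x - partial_sum f K x)" for x K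
    by (simp add: partial_sum_def coef_mult_left sum_distrib_left right_diff_distrib mult.assoc)
  show ?thesis
    using f square_integrable_mult_left
    by (auto simp: expandable_def eq sqnorm_mult_left intro!: tendsto_eq_intros)
qed

lemma expandable_diff:
  assumes "expandable f" "expandable g"
  shows "expandable (\<lambda>x. f x - g x)"
  using expandable_add[OF assms(1) expandable_mult_left[OF assms(2), of "-1"]] by simp

lemma expandable_zero: "expandable (\<lambda>x. 0)"
  by (simp add: expandable_def square_integrable_zero partial_sum_def coef_def sqnorm_def)

lemma expandable_sum:
  "(\<And>i. i \<in> I \<Longrightarrow> expandable (f i)) \<Longrightarrow> expandable (\<lambda>x. \<Sum>i\<in>I. f i x)"
  by (induction I rule: infinite_finite_induct) (auto simp: expandable_zero intro: expandable_add)

text \<open>If \<open>h\<close> is close to \<open>f\<close>, then the partial sums of \<open>h\<close> are eventually close to \<open>f\<close>, and those of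
  \<open>f\<close> are at least as close.\<close>

lemma expandable_closed:
  assumes f: "square_integrable M f"
    and approx: "\<And>\<epsilon>. \<epsilon> > 0 \<Longrightarrow> \<exists>h. expandable h \<and> sqnorm M (\<lambda>x. f x - h x) < \<epsilon>"
  shows "expandable f"
  unfolding expandable_def
proof
  show "(\<lambda>K. sqnorm M (\<lambda>x. f x - partial_sum f K x)) \<longlonglongrightarrow> 0"
  proof (rule order_tendstoI)
    fix \<epsilon> :: real assume "\<epsilon> > 0"
    then obtain h where h: "expandable h" and near: "sqnorm M (\<lambda>x. f x - h x) < \<epsilon> / 4"
      using approx[of "\<epsilon> / 4"] by auto
    have "\<forall>\<^sub>F K in sequentially. sqnorm M (\<lambda>x. h x - partial_sum h K x) < \<epsilon> / 4"
      using h \<open>\<epsilon> > 0\<close> by (intro order_tendstoD(2)[where y = 0]) (auto simp: expandable_def)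
    thus "\<forall>\<^sub>F K in sequentially. sqnorm M (\<lambda>x. f x - partial_sum f K x) < \<epsilon>"
    proof eventually_elim
      case (elim K)
      have "sqnorm M (\<lambda>x. f x - partial_sum f K x) \<le> sqnorm M (\<lambda>x. f x - partial_sum h K x)"
        by (rule best_approximation[OF f])
      also have "\<dots> = sqnorm M (\<lambda>x. (f x - h x) + (h x - partial_sum h K x))" by simp
      also have "\<dots> \<le> 2 * sqnorm M (\<lambda>x. f x - h x) + 2 * sqnorm M (\<lambda>x. h x - partial_sum h K x)"
        by (intro sqnorm_add_le square_integrable_diff f expandable_square_integrable[OF h]
            square_integrable_partial_sum)
      also have "\<dots> < \<epsilon>" using near elim by simp
      finally show ?case .
    qed
  next
    fix \<epsilon> :: real assume "\<epsilon> < 0"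
    thus "\<forall>\<^sub>F K in sequentially. \<epsilon> < sqnorm M (\<lambda>x. f x - partial_sum f K x)"
      by (intro always_eventually allI less_le_trans[OF _ sqnorm_nonneg])
  qed
qed fact

lemma expandable_limit:
  assumes f: "square_integrable M f" and h: "\<And>i. expandable (h i)"
    and lim: "(\<lambda>i. sqnorm M (\<lambda>x. f x - h i x)) \<longlonglongrightarrow> 0"
  shows "expandable f"
proof (rule expandable_closed[OF f])
  fix \<epsilon> :: real assume "\<epsilon> > 0"
  hence "\<forall>\<^sub>F i in sequentially. sqnorm M (\<lambda>x. f x - h i x) < \<epsilon>"
    by (rule order_tendstoD(2)[OF lim])
  then obtain i where "sqnorm M (\<lambda>x. f x - h i x) < \<epsilon>"
    unfolding eventually_sequentially by blast
  thus "\<exists>h. expandable h \<and> sqnorm M (\<lambda>x. f x - h x) < \<epsilon>" using h by blast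
qed

text \<open>Dominated convergence in the form needed to climb from simple functions to all of
  \<open>L\<^sup>2\<close>.\<close>

lemma expandable_dominated_limit:
  assumes h: "\<And>i. expandable (h i)" and f: "f \<in> borel_measurable M"
    and g: "integrable M g" and dom: "\<And>i. AE x in M. (cmod (h i x))\<^sup>2 \<le> g x"
    and lim: "AE x in M. (\<lambda>i. h i x) \<longlonglongrightarrow> f x"
  shows "expandable f"
proof -
  have dom_all: "AE x in M. \<forall>i. (cmod (h i x))\<^sup>2 \<le> g x"
    by (rule AE_all_countable[THEN iffD2]) (rule allI, rule dom)
  have domf: "AE x in M. (cmod (f x))\<^sup>2 \<le> g x"
    using lim dom_all
  proof eventually_elim
    case (elim x)
    have "(\<lambda>i. (cmod (h i x))\<^sup>2) \<longlonglongrightarrow> (cmod (f x))\<^sup>2"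
      using elim(1) by (intro tendsto_intros)
    thus ?case using elim(2) by (intro LIMSEQ_le_const2) auto
  qed
  have sqf: "square_integrable M f" by (rule square_integrable_bound[OF g f domf])
  have meas: "h i \<in> borel_measurable M" for i
    using expandable_square_integrable[OF h] by (auto simp: square_integrable_def)
  have "(\<lambda>i. \<integral>x. (cmod (f x - h i x))\<^sup>2 \<partial>M) \<longlonglongrightarrow> (\<integral>x. 0 \<partial>M)"
  proof (rule integral_dominated_convergence)
    show "integrable M (\<lambda>x. 4 * g x)" using g by simp
    show "AE x in M. (\<lambda>i. (cmod (f x - h i x))\<^sup>2) \<longlonglongrightarrow> 0"
      using lim
    proof eventually_elim
      case (elim x)
      show ?case using elim by (auto intro!: tendsto_eq_intros)
    qed
    show "AE x in M. norm ((cmod (f x - h i x))\<^sup>2) \<le> 4 * g x" for i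
      using domf dom_all
    proof eventually_elim
      case (elim x)
      have "(cmod (f x + - h i x))\<^sup>2 \<le> 2 * (cmod (f x))\<^sup>2 + 2 * (cmod (- h i x))\<^sup>2"
        by (rule cmod_add_square_le)
      moreover have "(cmod (h i x))\<^sup>2 \<le> g x" using elim(2) by blast
      ultimately have "(cmod (f x - h i x))\<^sup>2 \<le> 4 * g x" using elim(1) by simp
      thus ?case by simp
    qed
  qed (use f meas in auto)
  hence "(\<lambda>i. sqnorm M (\<lambda>x. f x - h i x)) \<longlonglongrightarrow> 0" by (simp add: sqnorm_def)
  thus ?thesis by (rule expandable_limit[where h = h, OF sqf h])
qed

lemma expandable_cong_AE:
  assumes f: "expandable f" and g: "g \<in> borel_measurable M" and eq: "AE x in M. f x = g x"
  shows "expandable g"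
proof (rule expandable_dominated_limit[where h = "\<lambda>_. f" and g = "\<lambda>x. (cmod (f x))\<^sup>2"])
  show "expandable f" by (rule f)
  show "integrable M (\<lambda>x. (cmod (f x))\<^sup>2)"
    by (rule square_integrableD(2)[OF expandable_square_integrable[OF f]])
  show "AE x in M. (\<lambda>i. f x) \<longlonglongrightarrow> g x"
    using eq by eventually_elim simp
qed (use g in \<open>simp_all\<close>)

lemma expandableI_parseval:
  assumes f: "square_integrable M f" and sums: "(\<lambda>n. (cmod (coef f n))\<^sup>2) sums sqnorm M f"
  shows "expandable f"
proof -
  have "(\<lambda>K. sqnorm M f - (\<Sum>n<K. (cmod (coef f n))\<^sup>2)) \<longlonglongrightarrow> sqnorm M f - sqnorm M f"
    using sums unfolding sums_def by (intro tendsto_intros)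
  thus ?thesis using f by (simp add: expandable_def sqnorm_diff_partial_sum)
qed

end

section \<open>Integration on the half line\<close>

abbreviation half_line :: "real measure" where
  "half_line \<equiv> lebesgue_on {0<..}"

lemma borel_measurable_lebesgue_onI:
  "f \<in> borel_measurable borel \<Longrightarrow> f \<in> borel_measurable (lebesgue_on S)"
  by (intro measurable_restrict_space1 measurable_completion) simp

lemma integrable_half_line_iff:
  fixes f :: "real \<Rightarrow> 'a::{banach, second_countable_topology}"
  assumes [measurable]: "f \<in> borel_measurable borel"
  shows "integrable half_line f \<longleftrightarrow> integrable lborel (\<lambda>x. indicator {0<..} x *\<^sub>R f x)"
proof -
  have "(\<lambda>x. indicator {0<..} x *\<^sub>R f x) \<in> borel_measurable lborel" by measurable
  thus ?thesis by (subst integrable_restrict_space) (simp_all add: integrable_completion)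
qed

lemma integral_half_line_eq:
  fixes f :: "real \<Rightarrow> 'a::{banach, second_countable_topology}"
  assumes [measurable]: "f \<in> borel_measurable borel"
  shows "integral\<^sup>L half_line f = (\<integral>x. indicator {0<..} x *\<^sub>R f x \<partial>lborel)"
proof -
  have "(\<lambda>x. indicator {0<..} x *\<^sub>R f x) \<in> borel_measurable lborel" by measurable
  thus ?thesis by (subst integral_restrict_space) (simp_all add: integral_completion)
qed

lemma nn_integral_half_line_eq:
  assumes [measurable]: "f \<in> borel_measurable borel"
  shows "(\<integral>\<^sup>+x. f x \<partial>half_line) = (\<integral>\<^sup>+x. f x * indicator {0<..} x \<partial>lborel)"
proof -
  have "(\<lambda>x. f x * indicator {0<..} x) \<in> borel_measurable lborel" by measurable
  thus ?thesis by (subst nn_integral_restrict_space) (simp_all add: nn_integral_completion)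
qed

lemma AE_half_line_iff: "(AE x in half_line. P x) \<longleftrightarrow> (AE x in lborel. 0 < x \<longrightarrow> P x)"
  by (simp add: AE_restrict_space_iff AE_completion_iff)

lemma AE_half_lineI: "(\<And>x. 0 < x \<Longrightarrow> P x) \<Longrightarrow> AE x in half_line. P x"
  by (intro AE_I2) simp

lemma AE_half_line_pos: "AE x in half_line. 0 < x"
  by (rule AE_half_lineI)

lemma half_line_borel_representative:
  fixes f :: "real \<Rightarrow> complex"
  assumes f: "f \<in> borel_measurable half_line"
  obtains f0 where "f0 \<in> borel_measurable borel" "AE x in half_line. f x = f0 x"
proof -
  have rep: "\<exists>g0\<in>borel_measurable borel. AE x in half_line. g x = g0 x"
    if g: "g \<in> borel_measurable half_line" for g :: "real \<Rightarrow> real"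
  proof -
    have "(\<lambda>x. indicator {0<..} x *\<^sub>R g x) \<in> borel_measurable lebesgue"
      using g by (subst (asm) borel_measurable_restrict_space_iff) auto
    then obtain g0 where g0: "g0 \<in> borel_measurable lborel"
        and eq: "AE x in lborel. indicator {0<..} x *\<^sub>R g x = g0 x"
      using completion_ex_borel_measurable_real[of "\<lambda>x. indicator {0<..} x *\<^sub>R g x" lborel] by blast
    from eq have "AE x in half_line. g x = g0 x"
      unfolding AE_half_line_iff by eventually_elim auto
    thus ?thesis using g0 by auto
  qed
  have "(\<lambda>x. Re (f x)) \<in> borel_measurable half_line" "(\<lambda>x. Im (f x)) \<in> borel_measurable half_line"
    using f by measurable
  then obtain r i where ri: "r \<in> borel_measurable borel" "i \<in> borel_measurable borel"
    "AE x in half_line. Re (f x) = r x" "AE x in half_line. Im (f x) = i x"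
    using rep by metis
  show ?thesis
  proof (rule that)
    show "(\<lambda>x. complex_of_real (r x) + \<i> * of_real (i x)) \<in> borel_measurable borel"
      using ri by measurable
    show "AE x in half_line. f x = complex_of_real (r x) + \<i> * of_real (i x)"
      using ri(3,4) by eventually_elim (simp add: complex_eq_iff)
  qed
qed

lemma integrable_indicator_half_line:
  "integrable half_line (\<lambda>x. indicator {..R} x :: real)"
proof -
  have "integrable lborel (\<lambda>x. indicator {0<..} x *\<^sub>R (indicator {..R} x :: real))"
  proof (rule Bochner_Integration.integrable_bound)
    show "integrable lborel (indicator {0..R} :: real \<Rightarrow> real)"
      by (cases "0 \<le> R") (auto intro!: integrable_real_indicator)
    show "AE x in lborel. norm (indicator {0<..} x *\<^sub>R (indicator {..R} x :: real)) \<le>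
        norm (indicator {0..R} x :: real)"
      by (intro AE_I2) (auto simp: indicator_def)
  qed measurable
  thus ?thesis by (simp add: integrable_half_line_iff)
qed

lemma half_line_measurable_AE:
  fixes f g :: "real \<Rightarrow> complex"
  assumes "f \<in> borel_measurable half_line" "AE x in half_line. f x = g x"
  shows "g \<in> borel_measurable half_line"
proof -
  have "(\<lambda>x. indicator {0<..} x *\<^sub>R f x) \<in> borel_measurable lebesgue"
    using assms(1) by (subst (asm) borel_measurable_restrict_space_iff) auto
  moreover have "AE x in lebesgue. indicator {0<..} x *\<^sub>R f x = indicator {0<..} x *\<^sub>R g x"
    using assms(2) unfolding AE_half_line_iff AE_completion_iff by eventually_elim auto
  ultimately have "(\<lambda>x. indicator {0<..} x *\<^sub>R g x) \<in> borel_measurable lebesgue"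
    by (rule borel_measurable_AE)
  thus ?thesis by (subst borel_measurable_restrict_space_iff) auto
qed

text \<open>Euler's integral after the substitution of \<open>bx\<close> for the variable.\<close>

lemma has_bochner_integral_gamma:
  fixes z b :: real
  assumes z: "z > 0" and b: "b > 0"
  shows "has_bochner_integral half_line (\<lambda>x. x powr (z - 1) * exp (- b * x)) (Gamma z / b powr z)"
proof -
  have "has_bochner_integral lborel (\<lambda>x. indicator {0..} x * x powr (z - 1) / exp x) (Gamma z)"
    using Gamma_real_pos[OF z] z
    by (intro has_bochner_integral_nn_integral)
       (auto simp: Gamma_conv_nn_integral_real[OF z] intro: less_imp_le)
  from lborel_has_bochner_integral_real_affine_iff[of b _ _ 0, THEN iffD1, OF _ this] b
  have "has_bochner_integral lborel
      (\<lambda>x. indicator {0..} (b * x) * (b * x) powr (z - 1) / exp (b * x)) (Gamma z / b)"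
    by (simp add: field_simps)
  hence "has_bochner_integral lborel
      (\<lambda>x. (indicator {0..} (b * x) * (b * x) powr (z - 1) / exp (b * x)) * b powr (1 - z))
      (Gamma z / b * b powr (1 - z))"
    by (rule has_bochner_integral_mult_left[rotated])
  also have "(\<lambda>x. (indicator {0..} (b * x) * (b * x) powr (z - 1) / exp (b * x)) * b powr (1 - z)) =
      (\<lambda>x. indicator {0<..} x *\<^sub>R (x powr (z - 1) * exp (- b * x)))"
  proof
    fix x
    show "(indicator {0..} (b * x) * (b * x) powr (z - 1) / exp (b * x)) * b powr (1 - z) =
      indicator {0<..} x *\<^sub>R (x powr (z - 1) * exp (- b * x))"
    proof (cases "x > 0")
      case True
      hence "(b * x) powr (z - 1) * b powr (1 - z) = x powr (z - 1) * (b powr (z - 1) * b powr (1 - z))"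
        using b by (simp add: powr_mult)
      also have "b powr (z - 1) * b powr (1 - z) = 1"
        using b by (simp flip: powr_add)
      finally show ?thesis using True b by (simp add: exp_minus field_simps)
    next
      case False
      hence "indicator {0..} (b * x) * (b * x) powr (z - 1) = (0::real)"
        using b by (cases "x = 0") (auto simp: zero_le_mult_iff)
      thus ?thesis using False by simp
    qed
  qed
  also have "Gamma z / b * b powr (1 - z) = Gamma z / b powr z"
    using b by (simp add: powr_diff)
  finally show ?thesis
    by (auto simp: has_bochner_integral_iff integrable_half_line_iff integral_half_line_eq)
qed

lemma has_bochner_integral_gamma_power:
  fixes a b :: real
  assumes "a > -1" "b > 0"
  shows "has_bochner_integral half_line (\<lambda>x. x powr a * exp (- b * x) * x ^ k)
    (Gamma (a + real k + 1) / b powr (a + real k + 1))"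
proof -
  have "has_bochner_integral half_line (\<lambda>x. x powr (a + real k + 1 - 1) * exp (- b * x))
    (Gamma (a + real k + 1) / b powr (a + real k + 1))"
    using assms by (intro has_bochner_integral_gamma) auto
  also have "?this \<longleftrightarrow> ?thesis"
    by (intro has_bochner_integral_cong refl) (auto simp: powr_add powr_realpow)
  finally show ?thesis .
qed

section \<open>Laguerre polynomials\<close>

text \<open>The generalised Laguerre polynomial \<open>L\<^sub>n\<^bsup>(a)\<^esup>\<close>. In this form it is \<open>(1 - x)\<^sup>n\<close> with the \<open>k\<close>-th coefficient
  divided by \<open>\<Gamma>(a+k+1)\<close>, up to a constant factor; a change of the parameter \<open>a\<close> multiplies
  coefficients by quotients of Gamma values, which is just what fractional integration does to powers.\<close>

definition laguerre :: "real \<Rightarrow> nat \<Rightarrow> real poly" where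
  "laguerre a n = (\<Sum>k\<le>n. monom ((-1) ^ k * real (n choose k) *
     (Gamma (a + real n + 1) / (fact n * Gamma (a + real k + 1)))) k)"

lemma coeff_laguerre:
  "coeff (laguerre a n) k =
    (-1) ^ k * real (n choose k) * (Gamma (a + real n + 1) / (fact n * Gamma (a + real k + 1)))"
  by (auto simp: laguerre_def coeff_sum coeff_monom)

lemma degree_laguerre: "degree (laguerre a n) \<le> n"
  by (intro degree_le) (simp add: coeff_laguerre)

lemma poly_laguerre:
  "poly (laguerre a n) x = (\<Sum>k\<le>n. coeff (laguerre a n) k * x ^ k)"
  unfolding poly_altdef
  by (rule sum.mono_neutral_left) (use degree_laguerre[of a n] in \<open>auto simp: coeff_eq_0\<close>)

text \<open>The \<open>n\<close>-th finite difference of a monic polynomial of degree \<open>j \<le> n\<close>, the polynomial being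
  the rising factorial.\<close>

lemma alternating_sum_pochhammer:
  fixes z :: real
  assumes "j \<le> n"
  shows "(\<Sum>k\<le>n. (-1) ^ k * real (n choose k) * pochhammer (z + real k) j) =
    (if j = n then (-1) ^ n * fact n else 0)"
  using assms
proof (induction n arbitrary: j z)
  case 0
  thus ?case by simp
next
  case (Suc n)
  let ?S = "\<lambda>n j z. \<Sum>k\<le>n. (-1) ^ k * real (n choose k) * pochhammer (z + real k) j"
  have "?S (Suc n) j z = pochhammer z j +
      (\<Sum>k\<le>n. (-1) ^ Suc k * real (Suc n choose Suc k) * pochhammer (z + real (Suc k)) j)"
    by (subst sum.atMost_Suc_shift) simp
  also have "\<dots> = (pochhammer z j +
      (\<Sum>k\<le>n. (-1) ^ Suc k * real (n choose Suc k) * pochhammer (z + real (Suc k)) j)) -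
      (\<Sum>k\<le>n. (-1) ^ k * real (n choose k) * pochhammer (z + real (Suc k)) j)"
    unfolding add_diff_eq[symmetric] sum_subtractf[symmetric]
    by (intro arg_cong2[of _ _ _ _ "(+)"] sum.cong refl) (simp add: algebra_simps)
  also have "pochhammer z j +
      (\<Sum>k\<le>n. (-1) ^ Suc k * real (n choose Suc k) * pochhammer (z + real (Suc k)) j) =
      (\<Sum>k\<le>Suc n. (-1) ^ k * real (n choose k) * pochhammer (z + real k) j)"
    by (subst sum.atMost_Suc_shift) simp
  also have "\<dots> = ?S n j z" by simp
  finally have split: "?S (Suc n) j z = (\<Sum>k\<le>n. (-1) ^ k * real (n choose k) *
      (pochhammer (z + real k) j - pochhammer (z + real (Suc k)) j))"
    by (simp add: sum_subtractf algebra_simps)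
  show ?case
  proof (cases j)
    case 0
    thus ?thesis using split by simp
  next
    case (Suc i)
    have diff: "pochhammer (z + real k) j - pochhammer (z + real (Suc k)) j =
        - real j * pochhammer (z + 1 + real k) i" for k
    proof -
      have "pochhammer (z + real k) (Suc i) = (z + real k) * pochhammer (z + 1 + real k) i"
        by (simp add: pochhammer_rec add_ac)
      moreover have "pochhammer (z + 1 + real k) (Suc i) =
          (z + 1 + real k + real i) * pochhammer (z + 1 + real k) i"
        by (rule pochhammer_rec')
      moreover have "z + real (Suc k) = z + 1 + real k" by simp
      ultimately show ?thesis unfolding Suc by (simp add: algebra_simps)
    qed
    have "?S (Suc n) j z = - real j * ?S n i (z + 1)"
      unfolding split sum_distrib_left diff by (intro sum.cong refl) (simp only: mult_ac)
    also have "?S n i (z + 1) = (if i = n then (-1) ^ n * fact n else 0)"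
      using Suc Suc.prems by (intro Suc.IH) simp
    also have "- real j * (if i = n then (-1) ^ n * fact n else 0) =
        (if j = Suc n then (-1) ^ Suc n * fact (Suc n) else (0::real))"
      using Suc by (simp add: algebra_simps)
    finally show ?thesis .
  qed
qed

text \<open>Orthogonality: since \<open>\<Gamma>(a+k+j+1) / \<Gamma>(a+k+1)\<close> is a rising factorial of degree \<open>j\<close> in \<open>k\<close>, termwise
  integration yields an \<open>n\<close>-th finite difference of a polynomial of degree \<open>j\<close>.\<close>

lemma has_bochner_integral_laguerre_monomial:
  fixes a b :: real
  assumes a: "a > -1" and b: "b > 0" and j: "j \<le> n"
  shows "has_bochner_integral half_line
    (\<lambda>x. x powr a * exp (- b * x) * poly (laguerre a n) (b * x) * x ^ j)
    (if j = n then (-1) ^ n * Gamma (a + real n + 1) / b powr (a + real n + 1) else 0)"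
proof -
  have "has_bochner_integral half_line
    (\<lambda>x. \<Sum>k\<le>n. (coeff (laguerre a n) k * b ^ k) * (x powr a * exp (- b * x) * x ^ (k + j)))
    (\<Sum>k\<le>n. (coeff (laguerre a n) k * b ^ k) *
      (Gamma (a + real (k + j) + 1) / b powr (a + real (k + j) + 1)))"
    using a b by (intro has_bochner_integral_sum has_bochner_integral_mult_right
        has_bochner_integral_gamma_power)
  also have "(\<lambda>x. \<Sum>k\<le>n. (coeff (laguerre a n) k * b ^ k) * (x powr a * exp (- b * x) * x ^ (k + j))) =
    (\<lambda>x. x powr a * exp (- b * x) * poly (laguerre a n) (b * x) * x ^ j)"
    by (simp add: poly_laguerre sum_distrib_left sum_distrib_right power_mult_distrib power_add
        mult_ac)
  also have "(\<Sum>k\<le>n. (coeff (laguerre a n) k * b ^ k) *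
      (Gamma (a + real (k + j) + 1) / b powr (a + real (k + j) + 1))) =
      (\<Sum>k\<le>n. Gamma (a + real n + 1) / (fact n * b powr (a + real j + 1)) *
        ((-1) ^ k * real (n choose k) * pochhammer (a + 1 + real k) j))"
  proof (intro sum.cong refl)
    fix k
    have p: "pochhammer (a + 1 + real k) j = Gamma (a + 1 + real k + real j) / Gamma (a + 1 + real k)"
      using a by (intro pochhammer_Gamma) (auto simp: nonpos_Ints_def)
    have q: "b powr (a + 1 + real k + real j) = b powr (a + real j + 1) * b ^ k"
      using b by (simp flip: powr_realpow powr_add add: add_ac)
    have g: "a + real (k + j) + 1 = a + 1 + real k + real j" "a + real k + 1 = a + 1 + real k" by auto
    show "(coeff (laguerre a n) k * b ^ k) *
      (Gamma (a + real (k + j) + 1) / b powr (a + real (k + j) + 1)) =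
      Gamma (a + real n + 1) / (fact n * b powr (a + real j + 1)) *
        ((-1) ^ k * real (n choose k) * pochhammer (a + 1 + real k) j)"
      unfolding coeff_laguerre p g q using b by (simp add: divide_simps mult_ac)
  qed
  also have "\<dots> = Gamma (a + real n + 1) / (fact n * b powr (a + real j + 1)) *
      (if j = n then (-1) ^ n * fact n else 0)"
    unfolding sum_distrib_left[symmetric] by (subst alternating_sum_pochhammer[OF j]) simp
  also have "\<dots> = (if j = n then (-1) ^ n * Gamma (a + real n + 1) / b powr (a + real n + 1) else 0)"
    by simp
  finally show ?thesis .
qed

lemma has_bochner_integral_laguerre_mult:
  fixes a b :: real
  assumes a: "a > -1" and b: "b > 0" and m: "m \<le> n"
  shows "has_bochner_integral half_line
    (\<lambda>x. x powr a * exp (- b * x) * poly (laguerre a n) (b * x) * poly (laguerre a m) (b * x))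
    (if m = n then Gamma (a + real n + 1) / (fact n * b powr (a + 1)) else 0)"
proof -
  let ?f = "\<lambda>x. x powr a * exp (- b * x) * poly (laguerre a n) (b * x)"
  let ?v = "\<lambda>j. if j = n then (-1) ^ n * Gamma (a + real n + 1) / b powr (a + real n + 1) else 0"
  have "has_bochner_integral half_line
    (\<lambda>x. \<Sum>j\<le>m. (coeff (laguerre a m) j * b ^ j) * (?f x * x ^ j))
    (\<Sum>j\<le>m. (coeff (laguerre a m) j * b ^ j) * ?v j)"
    using m by (intro has_bochner_integral_sum has_bochner_integral_mult_right
        has_bochner_integral_laguerre_monomial a b) auto
  also have "(\<lambda>x. \<Sum>j\<le>m. (coeff (laguerre a m) j * b ^ j) * (?f x * x ^ j)) =
      (\<lambda>x. ?f x * poly (laguerre a m) (b * x))"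
    by (subst (3) poly_laguerre) (simp add: sum_distrib_left power_mult_distrib mult_ac)
  also have "(\<Sum>j\<le>m. (coeff (laguerre a m) j * b ^ j) * ?v j) =
      (\<Sum>j\<le>m. if j = n then (coeff (laguerre a m) j * b ^ j) * ?v j else 0)"
    by (intro sum.cong) auto
  also have "\<dots> = (if m = n then (coeff (laguerre a n) n * b ^ n) * ?v n else 0)"
    using m by (simp add: sum.delta)
  also have "(coeff (laguerre a n) n * b ^ n) * ?v n = Gamma (a + real n + 1) / (fact n * b powr (a + 1))"
  proof -
    have "Gamma (a + real n + 1) > 0" using a by (intro Gamma_real_pos) simp
    moreover have "b powr (a + real n + 1) = b powr (a + 1) * b ^ n"
      using b by (simp flip: powr_realpow powr_add add: add_ac)
    ultimately show ?thesis
      using b by (simp add: coeff_laguerre field_simps flip: power_mult_distrib)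
  qed
  finally show ?thesis .
qed

text \<open>The identity behind Rodrigues' formula: \<open>(x\<^bsup>a+1\<^esup> e\<^bsup>-x\<^esup> L\<^sub>n\<^bsup>(a+1)\<^esup>)' = (n+1) x\<^bsup>a\<^esup> e\<^bsup>-x\<^esup> L\<^bsub>n+1\<^esub>\<^bsup>(a)\<^esup>\<close>.\<close>

lemma laguerre_rodrigues:
  assumes "a > -1"
  shows "[:a + 1, -1:] * laguerre (a + 1) n + pCons 0 (pderiv (laguerre (a + 1) n)) =
    smult (real n + 1) (laguerre a (Suc n))"
proof (rule poly_eqI)
  fix k
  have G: "Gamma (a + 1 + real k + 1) = (a + 1 + real k) * Gamma (a + 1 + real k)" for k
    using assms by (intro Gamma_plus1) (auto simp: nonpos_Ints_def)
  have pos: "a + 1 + real k > 0" for k using assms by simp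
  have nz: "Gamma (a + 1 + real k) \<noteq> 0" "a + 1 + real k \<noteq> 0" for k
    using less_imp_neq[OF Gamma_real_pos[OF pos[of k]]] less_imp_neq[OF pos[of k]] by metis+
  show "coeff ([:a + 1, -1:] * laguerre (a + 1) n + pCons 0 (pderiv (laguerre (a + 1) n))) k =
    coeff (smult (real n + 1) (laguerre a (Suc n))) k"
  proof (cases k)
    case 0
    have "(a + 1) * (Gamma (a + 1 + real n + 1) / (fact n * Gamma (a + 1 + 1))) =
        Gamma (a + 1 + real n + 1) / (fact n * Gamma (a + 1))"
      using G[of 0] nz[of 0] by simp
    moreover have "(real n + 1) * (Gamma (a + real (Suc n) + 1) / (fact (Suc n) * Gamma (a + 1))) =
        Gamma (a + 1 + real n + 1) / (fact n * Gamma (a + 1))"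
    proof -
      have "fact (Suc n) = (real n + 1) * fact n" "real n + 1 \<noteq> 0" by auto
      thus ?thesis by (simp only: of_nat_Suc add_ac mult.assoc divide_divide_eq_left[symmetric]) simp
    qed
    ultimately have "(a + 1) * (Gamma (a + 1 + real n + 1) / (fact n * Gamma (a + 1 + 1))) =
      (real n + 1) * (Gamma (a + real (Suc n) + 1) / (fact (Suc n) * Gamma (a + 1)))" by simp
    thus ?thesis using 0 by (simp add: coeff_laguerre)
  next
    case (Suc i)
    have c1: "coeff (laguerre (a + 1) n) (Suc i) * (a + 1 + real (Suc i)) =
        - ((-1) ^ i) * real (n choose Suc i) * Gamma (a + real n + 2) / (fact n * Gamma (a + 2 + real i))"
    proof -
      let ?w = "a + 1 + real (Suc i)"
      have "coeff (laguerre (a + 1) n) (Suc i) * ?w = (-1) ^ Suc i * real (n choose Suc i) *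
          (Gamma (a + 1 + real n + 1) / (fact n * (?w * Gamma ?w)) * ?w)"
        by (simp only: coeff_laguerre G mult.assoc)
      also have "Gamma (a + 1 + real n + 1) / (fact n * (?w * Gamma ?w)) * ?w =
          Gamma (a + 1 + real n + 1) / (fact n * Gamma ?w)"
        using nz[of "Suc i"] by simp
      also have "?w = a + 2 + real i" by simp
      also have "a + 1 + real n + 1 = a + real n + 2" by simp
      finally show ?thesis by (simp add: add_ac)
    qed
    have c2: "coeff (laguerre (a + 1) n) i =
        (-1) ^ i * real (n choose i) * Gamma (a + real n + 2) / (fact n * Gamma (a + 2 + real i))"
      by (simp add: coeff_laguerre add_ac)
    have c3: "(real n + 1) * coeff (laguerre a (Suc n)) (Suc i) =
        - ((-1) ^ i) * (real (n choose i) + real (n choose Suc i)) * Gamma (a + real n + 2) /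
        (fact n * Gamma (a + 2 + real i))"
    proof -
      have f: "fact (Suc n) = (real n + 1) * fact n" by simp
      have "(real n + 1) * coeff (laguerre a (Suc n)) (Suc i) = (-1) ^ Suc i *
          real (Suc n choose Suc i) * ((real n + 1) *
          (Gamma (a + real (Suc n) + 1) / ((real n + 1) * fact n * Gamma (a + real (Suc i) + 1))))"
        by (simp only: coeff_laguerre f mult_ac)
      also have "(real n + 1) *
          (Gamma (a + real (Suc n) + 1) / ((real n + 1) * fact n * Gamma (a + real (Suc i) + 1))) =
          Gamma (a + real (Suc n) + 1) / (fact n * Gamma (a + real (Suc i) + 1))"
        by simp
      also have "a + real (Suc n) + 1 = a + real n + 2" by simp
      also have "a + real (Suc i) + 1 = a + 2 + real i" by simp
      finally show ?thesis by simp
    qed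
    have "coeff ([:a + 1, -1:] * laguerre (a + 1) n + pCons 0 (pderiv (laguerre (a + 1) n))) k =
       coeff (laguerre (a + 1) n) (Suc i) * (a + 1 + real (Suc i)) - coeff (laguerre (a + 1) n) i"
      by (simp add: Suc coeff_pderiv algebra_simps)
    also have "\<dots> = (real n + 1) * coeff (laguerre a (Suc n)) (Suc i)"
      unfolding c1 c2 c3 by (simp add: algebra_simps add_divide_distrib diff_divide_distrib)
    finally show ?thesis by (simp add: Suc)
  qed
qed

text \<open>Rodrigues' identity as a derivative; this is what makes repeated integration by parts against
  Laguerre weights raise the index and lower the parameter.\<close>

lemma has_real_derivative_laguerre_weight:
  fixes b x :: real
  assumes x: "x > 0"
  shows "((\<lambda>x. x ^ Suc l * exp (- b * x) * poly (laguerre (real (Suc l)) n) (b * x))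
    has_real_derivative
      (real n + 1) * (x ^ l * exp (- b * x) * poly (laguerre (real l) (Suc n)) (b * x))) (at x)"
proof -
  let ?L = "laguerre (real (Suc l)) n"
  have R: "(real l + 1 - y) * poly ?L y + y * poly (pderiv ?L) y =
      (real n + 1) * poly (laguerre (real l) (Suc n)) y" for y
    using arg_cong[OF laguerre_rodrigues[of "real l" n], of "\<lambda>p. poly p y"]
    by (simp add: algebra_simps)
  have D: "((\<lambda>x. x ^ Suc l) has_real_derivative real (Suc l) * x ^ l) (at x)"
    "((\<lambda>x. exp (- b * x)) has_real_derivative exp (- b * x) * (- b)) (at x)"
    "((\<lambda>x. poly ?L (b * x)) has_real_derivative poly (pderiv ?L) (b * x) * b) (at x)"
    using DERIV_pow[of "Suc l" x UNIV] by (auto intro!: derivative_eq_intros)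
  have "((\<lambda>x. x ^ Suc l * exp (- b * x) * poly ?L (b * x)) has_real_derivative
      (real (Suc l) * x ^ l * exp (- b * x) + x ^ Suc l * (exp (- b * x) * (- b))) * poly ?L (b * x) +
      x ^ Suc l * exp (- b * x) * (poly (pderiv ?L) (b * x) * b)) (at x)"
    using DERIV_mult[OF DERIV_mult[OF D(1,2)] D(3)] by (simp add: algebra_simps)
  also have "(real (Suc l) * x ^ l * exp (- b * x) + x ^ Suc l * (exp (- b * x) * (- b))) * poly ?L (b * x) +
      x ^ Suc l * exp (- b * x) * (poly (pderiv ?L) (b * x) * b) =
      x ^ l * exp (- b * x) * ((real l + 1 - b * x) * poly ?L (b * x) + b * x * poly (pderiv ?L) (b * x))"
    by (simp add: algebra_simps)
  finally show ?thesis unfolding R by (simp add: algebra_simps)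
qed

section \<open>Laguerre functions\<close>

text \<open>The weight \<open>x\<^sup>a e\<^bsup>-bx\<^esup>\<close> of the Laguerre polynomials is split evenly between the two factors of an inner
  product, so that these functions are orthonormal without a weight.\<close>

definition laguerre_fun :: "real \<Rightarrow> real \<Rightarrow> nat \<Rightarrow> real \<Rightarrow> real" where
  "laguerre_fun a b n x = sqrt (fact n * b powr (a + 1) / Gamma (a + real n + 1)) *
     (x powr (a / 2) * exp (- (b / 2) * x) * poly (laguerre a n) (b * x))"

lemma borel_measurable_poly_comp [measurable (raw)]:
  fixes p :: "'a::{real_normed_field, second_countable_topology} poly"
  assumes "f \<in> borel_measurable M"
  shows "(\<lambda>x. poly p (f x)) \<in> borel_measurable M"
proof -
  have "poly p \<in> borel_measurable borel"
    by (intro borel_measurable_continuous_onI continuous_intros)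
  thus ?thesis using assms by measurable
qed

lemma borel_measurable_laguerre_fun [measurable]: "laguerre_fun a b n \<in> borel_measurable borel"
  unfolding laguerre_fun_def[abs_def] by measurable

lemma laguerre_fun_mult:
  assumes "x > 0"
  shows "laguerre_fun a b n x * laguerre_fun a b m x =
    (sqrt (fact n * b powr (a + 1) / Gamma (a + real n + 1)) *
     sqrt (fact m * b powr (a + 1) / Gamma (a + real m + 1))) *
    (x powr a * exp (- b * x) * poly (laguerre a n) (b * x) * poly (laguerre a m) (b * x))"
proof -
  have "x powr (a / 2) * x powr (a / 2) = x powr a" by (simp flip: powr_add)
  moreover have "exp (- (b / 2) * x) * exp (- (b / 2) * x) = exp (- b * x)" by (simp flip: exp_add)
  moreover have "laguerre_fun a b n x * laguerre_fun a b m x =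
    (sqrt (fact n * b powr (a + 1) / Gamma (a + real n + 1)) *
     sqrt (fact m * b powr (a + 1) / Gamma (a + real m + 1))) *
    ((x powr (a / 2) * x powr (a / 2)) * (exp (- (b / 2) * x) * exp (- (b / 2) * x)) *
      poly (laguerre a n) (b * x) * poly (laguerre a m) (b * x))"
    unfolding laguerre_fun_def by (simp only: mult_ac)
  ultimately show ?thesis by simp
qed

lemma has_bochner_integral_laguerre_fun:
  fixes a b :: real
  assumes a: "a > -1" and b: "b > 0"
  shows "has_bochner_integral half_line (\<lambda>x. laguerre_fun a b n x * laguerre_fun a b m x)
    (if n = m then 1 else 0)"
proof -
  have le: "has_bochner_integral half_line (\<lambda>x. laguerre_fun a b n x * laguerre_fun a b m x)
    (if n = m then 1 else 0)" if m: "m \<le> n" for n m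
  proof -
    let ?C = "sqrt (fact n * b powr (a + 1) / Gamma (a + real n + 1)) *
     sqrt (fact m * b powr (a + 1) / Gamma (a + real m + 1))"
    have "has_bochner_integral half_line
      (\<lambda>x. ?C * (x powr a * exp (- b * x) * poly (laguerre a n) (b * x) * poly (laguerre a m) (b * x)))
      (?C * (if m = n then Gamma (a + real n + 1) / (fact n * b powr (a + 1)) else 0))"
      by (intro has_bochner_integral_mult_right has_bochner_integral_laguerre_mult a b m)
    also have "?C * (if m = n then Gamma (a + real n + 1) / (fact n * b powr (a + 1)) else 0) =
      (if n = m then 1 else 0)"
    proof -
      have "Gamma (a + real n + 1) > 0" using a by (intro Gamma_real_pos) simp
      thus ?thesis using b by auto
    qed
    also have "has_bochner_integral half_line
      (\<lambda>x. ?C * (x powr a * exp (- b * x) * poly (laguerre a n) (b * x) * poly (laguerre a m) (b * x)))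
      (if n = m then 1 else 0) \<longleftrightarrow> ?thesis"
      by (intro has_bochner_integral_cong refl) (simp add: laguerre_fun_mult)
    finally show ?thesis .
  qed
  show ?thesis
  proof (cases "m \<le> n")
    case True
    thus ?thesis by (rule le)
  next
    case False
    hence "n \<le> m" by simp
    from le[OF this] show ?thesis by (simp add: mult.commute eq_commute)
  qed
qed

lemma orthonormal_laguerre_fun:
  assumes "a > -1" "b > 0"
  shows "orthonormal_sequence half_line (laguerre_fun a b)"
proof
  show "laguerre_fun a b n \<in> borel_measurable half_line" for n
    by (intro borel_measurable_lebesgue_onI borel_measurable_laguerre_fun)
  show "integrable half_line (\<lambda>x. (laguerre_fun a b n x)\<^sup>2)" for n
    using has_bochner_integral_laguerre_fun[OF assms, of n n]
    by (simp add: has_bochner_integral_iff power2_eq_square)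
  show "(\<integral>x. laguerre_fun a b n x * laguerre_fun a b k x \<partial>half_line) = (if n = k then 1 else 0)" for n k
    using has_bochner_integral_laguerre_fun[OF assms, of n k] by (simp add: has_bochner_integral_iff)
qed

section \<open>Completeness of the Laguerre functions\<close>

context
  fixes b :: real
  assumes b: "b > 0"
begin

interpretation L: orthonormal_sequence half_line "laguerre_fun 0 b"
  using b by (intro orthonormal_laguerre_fun) auto

lemma laguerre_fun_0:
  assumes "x > 0"
  shows "laguerre_fun 0 b n x = sqrt b * (exp (- (b / 2) * x) * poly (laguerre 0 n) (b * x))"
  using b assms Gamma_fact[of n, where 'a = real] by (simp add: laguerre_fun_def add_ac)

lemma has_bochner_integral_exp_laguerre:
  "has_bochner_integral half_line (\<lambda>x. exp (- (b / 2 + real j) * x) * laguerre_fun 0 b n x)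
    (sqrt b / (b + real j) * (real j / (b + real j)) ^ n)"
proof -
  let ?c = "b + real j"
  have c: "?c > 0" using b by simp
  have "has_bochner_integral half_line
    (\<lambda>x. sqrt b * (\<Sum>k\<le>n. (coeff (laguerre 0 n) k * b ^ k) * (x powr 0 * exp (- ?c * x) * x ^ k)))
    (sqrt b * (\<Sum>k\<le>n. (coeff (laguerre 0 n) k * b ^ k) *
      (Gamma (0 + real k + 1) / ?c powr (0 + real k + 1))))"
    using c by (intro has_bochner_integral_mult_right has_bochner_integral_sum
        has_bochner_integral_gamma_power) auto
  also have "(\<Sum>k\<le>n. (coeff (laguerre 0 n) k * b ^ k) *
      (Gamma (0 + real k + 1) / ?c powr (0 + real k + 1))) =
      (\<Sum>k\<le>n. real (n choose k) * (- b / ?c) ^ k * 1 ^ (n - k)) / ?c"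
    unfolding sum_divide_distrib
  proof (intro sum.cong refl)
    fix k
    have G: "Gamma (0 + real k + 1) = fact k" "Gamma (0 + real n + 1) = fact n"
      using Gamma_fact[of k, where 'a = real] Gamma_fact[of n, where 'a = real] by (simp_all add: add_ac)
    have P: "?c powr (0 + real k + 1) = ?c ^ k * ?c"
      using c by (simp add: powr_add powr_realpow)
    show "(coeff (laguerre 0 n) k * b ^ k) * (Gamma (0 + real k + 1) / ?c powr (0 + real k + 1)) =
      real (n choose k) * (- b / ?c) ^ k * 1 ^ (n - k) / ?c"
      unfolding coeff_laguerre G P by (simp add: power_divide power_minus[of "b / ?c"])
  qed
  also have "\<dots> = (- b / ?c + 1) ^ n / ?c" by (simp only: binomial_ring)
  also have "- b / ?c + 1 = real j / ?c" using c by (simp add: field_simps)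
  also have "sqrt b * ((real j / ?c) ^ n / ?c) = sqrt b / ?c * (real j / ?c) ^ n" by simp
  also have "has_bochner_integral half_line
    (\<lambda>x. sqrt b * (\<Sum>k\<le>n. (coeff (laguerre 0 n) k * b ^ k) * (x powr 0 * exp (- ?c * x) * x ^ k)))
    (sqrt b / ?c * (real j / ?c) ^ n) \<longleftrightarrow> ?thesis"
  proof (intro has_bochner_integral_cong refl)
    fix x assume "x \<in> space half_line"
    hence x: "x > 0" by simp
    have e: "exp (- ?c * x) = exp (- (b / 2 + real j) * x) * exp (- (b / 2) * x)"
      by (simp flip: exp_add add: algebra_simps)
    show "sqrt b * (\<Sum>k\<le>n. (coeff (laguerre 0 n) k * b ^ k) * (x powr 0 * exp (- ?c * x) * x ^ k)) =
      exp (- (b / 2 + real j) * x) * laguerre_fun 0 b n x"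
      unfolding laguerre_fun_0[OF x] e poly_laguerre using x
      by (simp add: sum_distrib_left power_mult_distrib mult_ac)
  qed
  finally show ?thesis .
qed

text \<open>The Laguerre coefficients of an exponential form a geometric sequence, and Parseval's
  identity for it is the geometric series.\<close>

lemma expandable_exp: "L.expandable (\<lambda>x. of_real (exp (- (b / 2 + real j) * x)))"
proof (rule L.expandableI_parseval)
  let ?f = "\<lambda>x. complex_of_real (exp (- (b / 2 + real j) * x))"
  have I: "has_bochner_integral half_line (\<lambda>x. (cmod (?f x))\<^sup>2) (1 / (b + 2 * real j))"
  proof -
    have "has_bochner_integral half_line (\<lambda>x. x powr (1 - 1) * exp (- (b + 2 * real j) * x))
      (Gamma 1 / (b + 2 * real j) powr 1)"
      using b by (intro has_bochner_integral_gamma) auto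
    also have "?this \<longleftrightarrow> ?thesis"
      using b by (intro has_bochner_integral_cong)
        (auto simp: power2_eq_square algebra_simps simp flip: exp_add)
    finally show ?thesis .
  qed
  show "square_integrable half_line ?f"
    using I by (auto simp: square_integrable_def has_bochner_integral_iff
        intro!: borel_measurable_lebesgue_onI)
  have N: "sqnorm half_line ?f = 1 / (b + 2 * real j)"
    using I by (simp add: sqnorm_def has_bochner_integral_iff)
  let ?c = "b + real j"
  let ?q = "(real j / ?c)\<^sup>2"
  have coef: "L.coef ?f n = of_real (sqrt b / ?c * (real j / ?c) ^ n)" for n
    using has_bochner_integral_exp_laguerre[of j n]
    by (simp add: L.coef_def has_bochner_integral_iff integral_complex_of_real flip: of_real_mult)
  have sq: "(cmod (L.coef ?f n))\<^sup>2 = b / ?c\<^sup>2 * ?q ^ n" for n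
    unfolding coef norm_of_real power2_abs using b
    by (simp add: power_mult_distrib power_divide flip: power_mult add: mult.commute)
  have "\<bar>real j / ?c\<bar> < 1" using b by auto
  hence "norm ?q < 1" by (simp only: abs_square_less_1 real_norm_def abs_power2)
  hence "(\<lambda>n. b / ?c\<^sup>2 * ?q ^ n) sums (b / ?c\<^sup>2 * (1 / (1 - ?q)))"
    by (intro sums_mult geometric_sums)
  also have "b / ?c\<^sup>2 * (1 / (1 - ?q)) = 1 / (b + 2 * real j)"
  proof -
    have "?c\<^sup>2 * (1 - ?q) = b * (b + 2 * real j)"
      using b by (simp add: power_divide right_diff_distrib) (simp add: power2_eq_square algebra_simps)
    moreover have "b / ?c\<^sup>2 * (1 / (1 - ?q)) = b / (?c\<^sup>2 * (1 - ?q))" by simp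
    ultimately show ?thesis using b by simp
  qed
  finally show "(\<lambda>n. (cmod (L.coef ?f n))\<^sup>2) sums sqnorm half_line ?f" by (simp only: sq N)
qed

text \<open>Weierstrass' theorem in the variable \<open>t = e\<^bsup>-x\<^esup>\<close>.\<close>

lemma expandable_continuous:
  fixes h :: "real \<Rightarrow> real"
  assumes cont: "continuous_on UNIV h" and X: "X > 0" and supp: "\<And>x. x \<ge> X \<Longrightarrow> h x = 0"
  shows "L.expandable (\<lambda>x. of_real (h x))"
proof -
  \<comment> \<open>\<open>h(x) = e\<^bsup>-bx/2\<^esup> H(e\<^bsup>-x\<^esup>)\<close>; the compact support of \<open>h\<close> makes \<open>H\<close> continuous at \<open>0\<close>.\<close>
  define H where "H t = (if t \<le> exp (- X) then 0 else h (- ln t) * exp (- (b / 2) * ln t))" for t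
  have e1: "exp (- X) \<le> 1" using X by simp
  have "continuous_on ({0..exp (- X)} \<union> {exp (- X)..1}) H"
    unfolding H_def[abs_def]
  proof (rule continuous_on_If)
    have "continuous_on {exp (- X)..1} ln"
      by (intro continuous_on_ln continuous_on_id) (auto simp: dest: less_le_trans[OF exp_gt_zero])
    thus "continuous_on {exp (- X)..1} (\<lambda>t. h (- ln t) * exp (- (b / 2) * ln t))"
      by (intro continuous_intros continuous_on_compose2[OF cont]) auto
    show "0 = h (- ln t) * exp (- (b / 2) * ln t)"
      if "t \<in> {exp (- X)..1}" "t \<le> exp (- X)" for t
    proof -
      have "t = exp (- X)" using that by auto
      thus ?thesis by (simp add: supp)
    qed
  qed (auto simp: supp)
  moreover have "{0..exp (- X)} \<union> {exp (- X)..1} = {0..1}" using e1 by (intro ivl_disj_un_two_touch) auto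
  ultimately have Hc: "continuous_on {0..1} H" by simp
  have H_eq: "h x = exp (- (b / 2) * x) * H (exp (- x))" if "x > 0" for x
    by (cases "x \<ge> X") (auto simp: H_def supp simp flip: exp_add)
  have bound: "has_bochner_integral half_line (\<lambda>x. exp (- b * x)) (1 / b)"
  proof -
    have "has_bochner_integral half_line (\<lambda>x. x powr (1 - 1) * exp (- b * x)) (Gamma 1 / b powr 1)"
      using b by (intro has_bochner_integral_gamma) auto
    also have "?this \<longleftrightarrow> ?thesis"
      using b by (intro has_bochner_integral_cong) auto
    finally show ?thesis .
  qed
  have meas: "(\<lambda>x. complex_of_real (h x)) \<in> borel_measurable half_line"
    by (intro borel_measurable_lebesgue_onI borel_measurable_continuous_onI continuous_on_of_real cont)
  have approx: "\<exists>g. L.expandable g \<and>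
      (\<forall>x>0. (cmod (complex_of_real (h x) - g x))\<^sup>2 \<le> \<epsilon>\<^sup>2 * exp (- b * x))" if "\<epsilon> > 0" for \<epsilon>
  proof -
    obtain P where P: "real_polynomial_function P" "\<And>t. t \<in> {0..1} \<Longrightarrow> \<bar>H t - P t\<bar> < \<epsilon>"
      using Stone_Weierstrass_real_polynomial_function[OF compact_Icc Hc \<open>\<epsilon> > 0\<close>] by blast
    then obtain a n where P_eq: "P = (\<lambda>t. \<Sum>i\<le>n. a i * t ^ i)"
      unfolding real_polynomial_function_iff_sum by blast
    define g where "g x = (\<Sum>i\<le>n. complex_of_real (a i) * of_real (exp (- (b / 2 + real i) * x)))" for x
    have g: "g x = of_real (exp (- (b / 2) * x) * P (exp (- x)))" for x
    proof -
      have "exp (- (b / 2 + real i) * x) = exp (- (b / 2) * x) * exp (- x) ^ i" for i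
        by (simp flip: exp_of_nat_mult exp_add add: algebra_simps)
      thus ?thesis unfolding g_def P_eq by (simp add: sum_distrib_left mult_ac)
    qed
    have "(cmod (complex_of_real (h x) - g x))\<^sup>2 \<le> \<epsilon>\<^sup>2 * exp (- b * x)" if "x > 0" for x
    proof -
      have "cmod (complex_of_real (h x) - g x) = exp (- (b / 2) * x) * \<bar>H (exp (- x)) - P (exp (- x))\<bar>"
        unfolding g H_eq[OF that]
        by (simp flip: of_real_diff right_diff_distrib of_real_mult add: abs_mult)
      also have "\<dots> \<le> exp (- (b / 2) * x) * \<epsilon>"
        using P(2)[of "exp (- x)"] that by (intro mult_left_mono) auto
      finally have "(cmod (complex_of_real (h x) - g x))\<^sup>2 \<le> (exp (- (b / 2) * x) * \<epsilon>)\<^sup>2"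
        by (intro power_mono) auto
      also have "\<dots> = \<epsilon>\<^sup>2 * exp (- b * x)"
        by (simp add: power_mult_distrib power2_eq_square flip: exp_add)
      finally show ?thesis .
    qed
    moreover have "L.expandable g"
      unfolding g_def[abs_def] by (intro L.expandable_sum L.expandable_mult_left expandable_exp)
    ultimately show ?thesis by blast
  qed
  have sq: "square_integrable half_line (\<lambda>x. complex_of_real (h x))"
  proof -
    obtain g where g: "L.expandable g"
        "\<And>x. x > 0 \<Longrightarrow> (cmod (complex_of_real (h x) - g x))\<^sup>2 \<le> 1\<^sup>2 * exp (- b * x)"
      using approx[of 1] by auto
    have "square_integrable half_line (\<lambda>x. complex_of_real (h x) - g x)"
    proof (rule square_integrable_bound)
      show "integrable half_line (\<lambda>x. exp (- b * x))" using bound by (simp add: has_bochner_integral_iff)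
      show "(\<lambda>x. complex_of_real (h x) - g x) \<in> borel_measurable half_line"
        using meas square_integrableD(1)[OF L.expandable_square_integrable[OF g(1)]] by measurable
    qed (use g(2) in \<open>auto intro!: AE_half_lineI\<close>)
    from square_integrable_add[OF this L.expandable_square_integrable[OF g(1)]] show ?thesis by simp
  qed
  show ?thesis
  proof (rule L.expandable_closed[OF sq])
    fix \<epsilon> :: real assume "\<epsilon> > 0"
    define \<delta> where "\<delta> = sqrt (\<epsilon> * b / 2)"
    have \<delta>: "\<delta> > 0" "\<delta>\<^sup>2 / b < \<epsilon>" using \<open>\<epsilon> > 0\<close> b by (auto simp: \<delta>_def)
    obtain g where g: "L.expandable g"
        "\<And>x. x > 0 \<Longrightarrow> (cmod (complex_of_real (h x) - g x))\<^sup>2 \<le> \<delta>\<^sup>2 * exp (- b * x)"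
      using approx[OF \<delta>(1)] by auto
    have "sqnorm half_line (\<lambda>x. complex_of_real (h x) - g x) \<le> (\<integral>x. \<delta>\<^sup>2 * exp (- b * x) \<partial>half_line)"
      unfolding sqnorm_def using bound g(2)
        square_integrableD(2)[OF square_integrable_diff[OF sq L.expandable_square_integrable[OF g(1)]]]
      by (intro integral_mono) (auto simp: has_bochner_integral_iff)
    also have "\<dots> = \<delta>\<^sup>2 / b" using bound by (simp add: has_bochner_integral_iff)
    finally show "\<exists>g. L.expandable g \<and> sqnorm half_line (\<lambda>x. complex_of_real (h x) - g x) < \<epsilon>"
      using g(1) \<delta>(2) by (intro exI[of _ g]) auto
  qed
qed

text \<open>Continuous trapezoids decrease to the indicator of a compact interval.\<close>

lemma expandable_indicator_interval:
  fixes \<alpha> \<beta> :: real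
  assumes "\<alpha> \<le> \<beta>"
  shows "L.expandable (\<lambda>x. of_real (indicator {\<alpha>..\<beta>} x))"
proof (rule L.expandable_dominated_limit)
  let ?h = "\<lambda>i x. max 0 (1 - real i * (max 0 (\<alpha> - x) + max 0 (x - \<beta>)))"
  let ?X = "max 1 (\<beta> + 1)"
  show "L.expandable (\<lambda>x. of_real (?h (Suc i) x))" for i
  proof (rule expandable_continuous)
    show "continuous_on UNIV (?h (Suc i))" by (intro continuous_intros)
    show "?h (Suc i) x = 0" if "x \<ge> ?X" for x
    proof -
      have "1 * 1 \<le> real (Suc i) * (max 0 (\<alpha> - x) + max 0 (x - \<beta>))"
        using that by (intro mult_mono) auto
      thus ?thesis by simp
    qed
  qed simp
  have h01: "0 \<le> ?h i x" "?h i x \<le> 1" for i x by auto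
  have hX: "?h (Suc i) x = 0" if "x > ?X" for i x
  proof -
    have "1 * 1 \<le> real (Suc i) * (max 0 (\<alpha> - x) + max 0 (x - \<beta>))"
      using that by (intro mult_mono) auto
    thus ?thesis by simp
  qed
  show "integrable half_line (\<lambda>x. indicator {..?X} x :: real)" by (rule integrable_indicator_half_line)
  show "AE x in half_line. (cmod (of_real (?h (Suc i) x)))\<^sup>2 \<le> indicator {..?X} x" for i
  proof (rule AE_I2)
    fix x
    show "(cmod (of_real (?h (Suc i) x)))\<^sup>2 \<le> indicator {..?X} x"
    proof (cases "x \<le> ?X")
      case True
      have "(?h (Suc i) x)\<^sup>2 \<le> 1" using h01 by (intro power_le_one)
      thus ?thesis using True unfolding norm_of_real power2_abs by simp
    next
      case False
      hence "x > ?X" by (rule not_le_imp_less)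
      hence "?h (Suc i) x = 0" by (rule hX)
      thus ?thesis by (simp only:) simp
    qed
  qed
  show "AE x in half_line. (\<lambda>i. complex_of_real (?h (Suc i) x)) \<longlonglongrightarrow> of_real (indicator {\<alpha>..\<beta>} x)"
  proof (intro AE_I2 tendsto_of_real)
    fix x
    show "(\<lambda>i. ?h (Suc i) x) \<longlonglongrightarrow> indicator {\<alpha>..\<beta>} x"
    proof (cases "x \<in> {\<alpha>..\<beta>}")
      case True
      thus ?thesis by simp
    next
      case False
      let ?d = "max 0 (\<alpha> - x) + max 0 (x - \<beta>)"
      have d: "?d > 0" using False by auto
      obtain N where N: "1 / ?d < real N" using reals_Archimedean2 by blast
      have "\<forall>\<^sub>F i in sequentially. ?h (Suc i) x = 0"
      proof (intro eventually_sequentiallyI)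
        fix i assume "N \<le> i"
        hence "1 / ?d \<le> real (Suc i)" using N by linarith
        hence "1 \<le> real (Suc i) * ?d" using d by (simp only: pos_divide_le_eq)
        thus "?h (Suc i) x = 0" by simp
      qed
      thus ?thesis using False by (simp add: tendsto_eventually)
    qed
  qed
  show "(\<lambda>x. complex_of_real (indicator {\<alpha>..\<beta>} x)) \<in> borel_measurable half_line"
    by (intro borel_measurable_lebesgue_onI) measurable
qed

text \<open>Intersecting with a half line to the left keeps complements square-integrable, as the induction over
  Borel sets requires.\<close>

lemma expandable_indicator_bounded:
  fixes A :: "real set"
  assumes "A \<in> sets borel"
  shows "L.expandable (\<lambda>x. of_real (indicator (A \<inter> {..R}) x))"
  using assms
proof (induction A rule: borel_set_induct)
  case empty
  show ?case using L.expandable_zero by simp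
next
  case (interval \<alpha> \<beta>)
  have "{\<alpha>..\<beta>} \<inter> {..R} = {\<alpha>..min \<beta> R}" by auto
  moreover have "L.expandable (\<lambda>x. of_real (indicator {\<alpha>..min \<beta> R} x))"
  proof (cases "\<alpha> \<le> min \<beta> R")
    case True
    thus ?thesis by (rule expandable_indicator_interval)
  next
    case False
    hence "{\<alpha>..min \<beta> R} = {}" by auto
    thus ?thesis using L.expandable_zero by simp
  qed
  ultimately show ?case by simp
next
  case (compl A)
  have R: "L.expandable (\<lambda>x. of_real (indicator {0..max 0 R} x))"
    by (rule expandable_indicator_interval) simp
  have "L.expandable (\<lambda>x. of_real (indicator {0..max 0 R} x) - of_real (indicator (A \<inter> {..R}) x))"
    by (rule L.expandable_diff[OF R compl.IH])
  thus ?case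
  proof (rule L.expandable_cong_AE)
    show "(\<lambda>x. complex_of_real (indicator (- A \<inter> {..R}) x)) \<in> borel_measurable half_line"
      by (intro borel_measurable_lebesgue_onI) (use compl.hyps in measurable)
    show "AE x in half_line. complex_of_real (indicator {0..max 0 R} x) -
        complex_of_real (indicator (A \<inter> {..R}) x) = complex_of_real (indicator (- A \<inter> {..R}) x)"
      by (intro AE_half_lineI) (auto simp: indicator_def max_def)
  qed
next
  case (union A)
  show ?case
  proof (rule L.expandable_dominated_limit)
    let ?h = "\<lambda>n x. complex_of_real (indicator ((\<Union>i<n. A i) \<inter> {..R}) x)"
    show "L.expandable (?h n)" for n
    proof -
      have eq: "(\<lambda>x. \<Sum>i<n. complex_of_real (indicator (A i \<inter> {..R}) x)) = ?h n"
      proof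
        fix x
        have "(\<Sum>i<n. indicator (A i) x :: real) = indicator (\<Union>i<n. A i) x"
          using union.hyps(1) by (intro indicator_UN_disjoint[symmetric])
            (auto intro: disjoint_family_on_mono)
        thus "(\<Sum>i<n. complex_of_real (indicator (A i \<inter> {..R}) x)) = ?h n x"
          unfolding indicator_inter_arith of_real_mult sum_distrib_right[symmetric]
          by (metis of_real_sum)
      qed
      show ?thesis unfolding eq[symmetric] by (intro L.expandable_sum union.IH)
    qed
    show "integrable half_line (\<lambda>x. indicator {..R} x :: real)" by (rule integrable_indicator_half_line)
    show "AE x in half_line. (cmod (?h n x))\<^sup>2 \<le> indicator {..R} x" for n
      by (intro AE_I2) (auto simp: indicator_def)
    show "AE x in half_line. (\<lambda>n. ?h n x) \<longlonglongrightarrow> of_real (indicator (\<Union> (range A) \<inter> {..R}) x)"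
      unfolding indicator_inter_arith of_real_mult
      by (intro AE_I2 tendsto_mult tendsto_of_real tendsto_const LIMSEQ_indicator_UN)
    show "(\<lambda>x. complex_of_real (indicator (\<Union> (range A) \<inter> {..R}) x)) \<in> borel_measurable half_line"
      by (intro borel_measurable_lebesgue_onI) (use union.hyps in measurable)
  qed
qed

lemma expandable_nonneg:
  fixes u :: "real \<Rightarrow> real"
  assumes "u \<in> borel_measurable borel" "\<And>x. 0 \<le> u x"
    and "square_integrable half_line (\<lambda>x. of_real (u x))"
  shows "L.expandable (\<lambda>x. of_real (u x))"
  using assms
proof (induction u rule: borel_measurable_induct_real)
  case (set A)
  show ?case
  proof (rule L.expandable_dominated_limit)
    show "L.expandable (\<lambda>x. of_real (indicator (A \<inter> {..real n}) x))" for n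
      using set.hyps by (intro expandable_indicator_bounded) simp
    show "integrable half_line (\<lambda>x. (cmod (of_real (indicator A x)))\<^sup>2)"
      using set.prems by (rule square_integrableD)
    show "AE x in half_line. (cmod (of_real (indicator (A \<inter> {..real n}) x)))\<^sup>2 \<le>
        (cmod (of_real (indicator A x)))\<^sup>2" for n
      by (intro AE_I2) (auto simp: indicator_def)
    show "AE x in half_line. (\<lambda>n. complex_of_real (indicator (A \<inter> {..real n}) x)) \<longlonglongrightarrow>
        of_real (indicator A x)"
    proof (rule AE_I2)
      fix x :: real
      obtain N where N: "x \<le> real N" using real_arch_simple by blast
      have "\<forall>\<^sub>F n in sequentially. complex_of_real (indicator (A \<inter> {..real n}) x) = of_real (indicator A x)"
        using N by (intro eventually_sequentiallyI[of N]) (auto simp: indicator_def)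
      thus "(\<lambda>n. complex_of_real (indicator (A \<inter> {..real n}) x)) \<longlonglongrightarrow> of_real (indicator A x)"
        by (rule tendsto_eventually)
    qed
    show "(\<lambda>x. complex_of_real (indicator A x)) \<in> borel_measurable half_line"
      using set.prems by (rule square_integrableD)
  qed
next
  case (mult u c)
  show ?case
  proof (cases "c = 0")
    case True
    thus ?thesis using L.expandable_zero by simp
  next
    case False
    have "square_integrable half_line (\<lambda>x. of_real (1 / c) * of_real (c * u x))"
      by (rule square_integrable_mult_left[OF mult.prems])
    hence "square_integrable half_line (\<lambda>x. of_real (u x))" using False by simp
    from L.expandable_mult_left[OF mult.IH[OF this], of "of_real c"] show ?thesis by simp
  qed
next
  case (add u v)
  have bd: "square_integrable half_line (\<lambda>x. of_real (w x))"
    if "w \<in> borel_measurable borel" "\<And>x. 0 \<le> w x" "\<And>x. w x \<le> v x + u x" for w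
  proof (rule square_integrable_bound[OF square_integrableD(2)[OF add.prems]])
    show "(\<lambda>x. complex_of_real (w x)) \<in> borel_measurable half_line"
      by (intro borel_measurable_lebesgue_onI) (use that(1) in measurable)
    show "AE x in half_line. (cmod (of_real (w x)))\<^sup>2 \<le> (cmod (of_real (v x + u x)))\<^sup>2"
    proof (intro AE_I2 power_mono)
      fix x
      show "cmod (of_real (w x)) \<le> cmod (of_real (v x + u x))"
        using that(2,3)[of x] unfolding norm_of_real by linarith
    qed simp
  qed
  have "L.expandable (\<lambda>x. of_real (u x))" "L.expandable (\<lambda>x. of_real (v x))"
    using add.hyps by (auto intro!: add.IH bd)
  from L.expandable_add[OF this(2,1)] show ?case by simp
next
  case (seq U)
  have le: "U i x \<le> u x" for i x
    using seq.hyps(3,4) by (intro incseq_le) (auto simp: incseq_def le_fun_def)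
  show ?case
  proof (rule L.expandable_dominated_limit)
    show I: "integrable half_line (\<lambda>x. (cmod (of_real (u x)))\<^sup>2)"
      using seq.prems by (rule square_integrableD)
    show dom: "AE x in half_line. (cmod (of_real (U i x)))\<^sup>2 \<le> (cmod (of_real (u x)))\<^sup>2" for i
    proof (intro AE_I2 power_mono)
      fix x
      show "cmod (of_real (U i x)) \<le> cmod (of_real (u x))"
        using le[of i x] seq.hyps(2)[of i x] unfolding norm_of_real by linarith
    qed simp
    show "L.expandable (\<lambda>x. of_real (U i x))" for i
    proof (intro seq.IH square_integrable_bound[OF I _ dom])
      show "(\<lambda>x. complex_of_real (U i x)) \<in> borel_measurable half_line"
        by (intro borel_measurable_lebesgue_onI) (use seq.hyps(1) in measurable)
    qed
    show "AE x in half_line. (\<lambda>i. complex_of_real (U i x)) \<longlonglongrightarrow> of_real (u x)"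
      using seq.hyps(4) by (intro AE_I2 tendsto_of_real) simp
    show "(\<lambda>x. complex_of_real (u x)) \<in> borel_measurable half_line"
      using seq.prems by (rule square_integrableD)
  qed
qed

theorem expandable_laguerre:
  assumes "square_integrable half_line f"
  shows "L.expandable f"
proof -
  have real: "L.expandable (\<lambda>x. of_real (u x))"
    if u: "u \<in> borel_measurable borel" and sq: "square_integrable half_line (\<lambda>x. of_real (u x))"
    for u :: "real \<Rightarrow> real"
  proof -
    have part: "L.expandable (\<lambda>x. of_real (max 0 (c * u x)))" if "\<bar>c\<bar> = 1" for c :: real
    proof (rule expandable_nonneg)
      show "square_integrable half_line (\<lambda>x. of_real (max 0 (c * u x)))"
      proof (rule square_integrable_bound[OF square_integrableD(2)[OF sq]])
        show "(\<lambda>x. complex_of_real (max 0 (c * u x))) \<in> borel_measurable half_line"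
          by (intro borel_measurable_lebesgue_onI) (use u in measurable)
        show "AE x in half_line. (cmod (of_real (max 0 (c * u x))))\<^sup>2 \<le> (cmod (of_real (u x)))\<^sup>2"
        proof (intro AE_I2 power_mono)
          fix x
          have "\<bar>c * u x\<bar> = \<bar>u x\<bar>" using that by (simp add: abs_mult)
          thus "cmod (of_real (max 0 (c * u x))) \<le> cmod (of_real (u x))"
            unfolding norm_of_real by linarith
        qed simp
      qed
    qed (use u in auto)
    have "u x = max 0 (1 * u x) - max 0 (- 1 * u x)" for x by simp
    hence "(\<lambda>x. complex_of_real (u x)) =
        (\<lambda>x. of_real (max 0 (1 * u x)) - of_real (max 0 (- 1 * u x)))"
      by (metis of_real_diff)
    thus ?thesis using L.expandable_diff[OF part[of 1] part[of "-1"]] by simp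
  qed
  obtain f0 where f0: "f0 \<in> borel_measurable borel" "AE x in half_line. f x = f0 x"
    using half_line_borel_representative[OF square_integrableD(1)[OF assms]] by blast
  have sq0: "square_integrable half_line f0"
    by (rule square_integrable_cong_AE[OF assms borel_measurable_lebesgue_onI f0(2)]) (rule f0(1))
  have "square_integrable half_line (\<lambda>x. of_real (Re (f0 x)))"
    "square_integrable half_line (\<lambda>x. of_real (Im (f0 x)))"
    using f0(1) by (auto intro!: square_integrable_bound[OF square_integrableD(2)[OF sq0]] AE_I2
        borel_measurable_lebesgue_onI simp: cmod_power2)
  hence "L.expandable (\<lambda>x. of_real (Re (f0 x)))" "L.expandable (\<lambda>x. of_real (Im (f0 x)))"
    using f0(1) by (auto intro!: real)
  hence "L.expandable (\<lambda>x. of_real (Re (f0 x)) + \<i> * of_real (Im (f0 x)))"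
    by (intro L.expandable_add L.expandable_mult_left)
  also have "(\<lambda>x. of_real (Re (f0 x)) + \<i> * of_real (Im (f0 x))) = f0"
    by (auto simp: complex_eq_iff)
  finally show ?thesis
  proof (rule L.expandable_cong_AE)
    show "f \<in> borel_measurable half_line" by (rule square_integrableD(1)[OF assms])
    show "AE x in half_line. f0 x = f x" using f0(2) by eventually_elim simp
  qed
qed

end

section \<open>Fractional integrals\<close>

text \<open>Integrability up to \<open>0\<close>, but not up to infinity, is exactly what the fractional integrals need.\<close>

definition loc_integrable :: "(real \<Rightarrow> complex) \<Rightarrow> bool" where
  "loc_integrable F \<longleftrightarrow> (\<forall>x>0. set_integrable lebesgue {0<..<x} F)"

text \<open>With the limits of integration built into the kernel, fractional integrals become integrals over the whole
  line, to which Fubini's theorem applies directly.\<close>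

definition rl_kernel :: "real \<Rightarrow> real \<Rightarrow> real \<Rightarrow> real" where
  "rl_kernel a x y = (if 0 < y \<and> y < x then (x - y) powr (a - 1) / Gamma a else 0)"

lemma rl_kernel_nonneg: "a > 0 \<Longrightarrow> 0 \<le> rl_kernel a x y"
  by (simp add: rl_kernel_def Gamma_real_pos less_imp_le)

lemma borel_measurable_rl_kernel [measurable (raw)]:
  assumes "f \<in> borel_measurable M" "g \<in> borel_measurable M"
  shows "(\<lambda>z. rl_kernel a (f z) (g z)) \<in> borel_measurable M"
  using assms unfolding rl_kernel_def by measurable

lemma rl_integral_eq_half_line:
  "rl_integral a F x = (\<integral>y. rl_kernel a x y *\<^sub>R F y \<partial>half_line)"
proof -
  have "(\<integral>y. rl_kernel a x y *\<^sub>R F y \<partial>half_line) =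
      (\<integral>y. indicator {0<..} y *\<^sub>R (rl_kernel a x y *\<^sub>R F y) \<partial>lebesgue)"
    by (subst integral_restrict_space) auto
  also have "\<dots> = (\<integral>y. (1 / Gamma a) *\<^sub>R (indicator {0<..<x} y *\<^sub>R ((x - y) powr (a - 1)) *\<^sub>R F y) \<partial>lebesgue)"
    by (intro Bochner_Integration.integral_cong refl) (auto simp: rl_kernel_def indicator_def)
  also have "\<dots> = (1 / Gamma a) *\<^sub>R (\<integral>y. indicator {0<..<x} y *\<^sub>R ((x - y) powr (a - 1)) *\<^sub>R F y \<partial>lebesgue)"
    by (rule integral_scaleR_right)
  also have "\<dots> = rl_integral a F x"
    by (simp only: rl_integral_def set_lebesgue_integral_def)
  finally show ?thesis by simp
qed

lemma rl_integral_cong_pos: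
  assumes "\<And>y. y > 0 \<Longrightarrow> F y = G y"
  shows "rl_integral a F x = rl_integral a G x"
  unfolding rl_integral_eq_half_line using assms by (intro Bochner_Integration.integral_cong) auto

lemma rl_integral_cong_AE:
  assumes "F \<in> borel_measurable half_line" "G \<in> borel_measurable half_line"
    and "AE y in half_line. F y = G y"
  shows "rl_integral a F x = rl_integral a G x"
  unfolding rl_integral_eq_half_line
proof (rule integral_cong_AE)
  have K: "rl_kernel a x \<in> borel_measurable half_line"
    by (intro borel_measurable_lebesgue_onI) measurable
  show "(\<lambda>y. rl_kernel a x y *\<^sub>R F y) \<in> borel_measurable half_line"
    "(\<lambda>y. rl_kernel a x y *\<^sub>R G y) \<in> borel_measurable half_line"
    using K assms(1,2) by measurable
  show "AE y in half_line. rl_kernel a x y *\<^sub>R F y = rl_kernel a x y *\<^sub>R G y"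
    using assms(3) by eventually_elim simp
qed

lemma rl_integral_borel:
  assumes [measurable]: "F \<in> borel_measurable borel"
  shows "rl_integral a F x = (\<integral>y. rl_kernel a x y *\<^sub>R F y \<partial>lborel)"
proof -
  have "rl_integral a F x = (\<integral>y. indicator {0<..} y *\<^sub>R (rl_kernel a x y *\<^sub>R F y) \<partial>lborel)"
    unfolding rl_integral_eq_half_line by (rule integral_half_line_eq) measurable
  also have "\<dots> = (\<integral>y. rl_kernel a x y *\<^sub>R F y \<partial>lborel)"
    by (intro Bochner_Integration.integral_cong refl) (auto simp: rl_kernel_def indicator_def)
  finally show ?thesis .
qed

lemma loc_integrable_half_line_iff:
  "loc_integrable F \<longleftrightarrow> (\<forall>x>0. integrable half_line (\<lambda>y. indicator {..<x} y *\<^sub>R F y))"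
proof -
  have "integrable half_line (\<lambda>y. indicator {..<x} y *\<^sub>R F y) \<longleftrightarrow>
      set_integrable lebesgue {0<..<x} F" for x
    unfolding set_integrable_def
    by (subst integrable_restrict_space)
       (auto intro!: Bochner_Integration.integrable_cong simp: indicator_def)
  thus ?thesis by (simp add: loc_integrable_def)
qed

lemma loc_integrable_measurable:
  assumes "loc_integrable F"
  shows "F \<in> borel_measurable half_line"
proof (rule borel_measurable_LIMSEQ_metric)
  show "(\<lambda>y. indicator {..<real (Suc n)} y *\<^sub>R F y) \<in> borel_measurable half_line" for n
    using assms[unfolded loc_integrable_half_line_iff, rule_format, of "real (Suc n)"] by simp
  fix y :: real
  obtain N where N: "y < real N" using reals_Archimedean2 by blast
  have "\<forall>\<^sub>F n in sequentially. indicator {..<real (Suc n)} y *\<^sub>R F y = F y"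
    using N by (intro eventually_sequentiallyI[of N]) (auto simp: indicator_def)
  thus "(\<lambda>n. indicator {..<real (Suc n)} y *\<^sub>R F y) \<longlonglongrightarrow> F y" by (rule tendsto_eventually)
qed

lemma loc_integrable_cong_AE:
  assumes "loc_integrable F" "G \<in> borel_measurable half_line" "AE y in half_line. F y = G y"
  shows "loc_integrable G"
  unfolding loc_integrable_half_line_iff
proof (intro allI impI)
  fix x :: real assume "x > 0"
  show "integrable half_line (\<lambda>y. indicator {..<x} y *\<^sub>R G y)"
  proof (rule integrable_cong_AE_imp)
    show "integrable half_line (\<lambda>y. indicator {..<x} y *\<^sub>R F y)"
      using assms(1) \<open>x > 0\<close> by (auto simp: loc_integrable_half_line_iff)
    have "(\<lambda>y. indicator {..<x} y :: real) \<in> borel_measurable half_line"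
      by (intro borel_measurable_lebesgue_onI) measurable
    thus "(\<lambda>y. indicator {..<x} y *\<^sub>R G y) \<in> borel_measurable half_line"
      using assms(2) by measurable
    show "AE y in half_line. indicator {..<x} y *\<^sub>R F y = indicator {..<x} y *\<^sub>R G y"
      using assms(3) by eventually_elim simp
  qed
qed

lemma nn_integral_rl_kernel_exp:
  assumes a: "a > 0" and b: "b > 0"
  shows "(\<integral>\<^sup>+x. ennreal (exp (- b * x) * rl_kernel a x y) \<partial>lborel) =
    ennreal (exp (- b * y) / b powr a) * indicator {0<..} y"
proof (cases "y > 0")
  case True
  have G: "Gamma a > 0" using a by (rule Gamma_real_pos)
  have I: "has_bochner_integral half_line
      (\<lambda>t. (exp (- b * y) / Gamma a) * (t powr (a - 1) * exp (- b * t))) (exp (- b * y) / Gamma a * (Gamma a / b powr a))"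
    by (intro has_bochner_integral_mult_right has_bochner_integral_gamma a b)
  have "(\<integral>\<^sup>+x. ennreal (exp (- b * x) * rl_kernel a x y) \<partial>lborel) =
      (\<integral>\<^sup>+t. ennreal (exp (- b * (y + t)) * rl_kernel a (y + t) y) \<partial>lborel)"
    by (subst nn_integral_real_affine[where c = 1 and t = y]) (auto simp: one_ennreal_def[symmetric])
  also have "\<dots> = (\<integral>\<^sup>+t. ennreal ((exp (- b * y) / Gamma a) * (t powr (a - 1) * exp (- b * t)))
      * indicator {0<..} t \<partial>lborel)"
    using True
    by (intro nn_integral_cong)
       (auto simp: rl_kernel_def indicator_def distrib_left exp_add exp_diff exp_minus field_simps)
  also have "\<dots> = (\<integral>\<^sup>+t. ennreal ((exp (- b * y) / Gamma a) * (t powr (a - 1) * exp (- b * t))) \<partial>half_line)"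
    by (rule nn_integral_half_line_eq[symmetric]) measurable
  also have "\<dots> = ennreal (exp (- b * y) / Gamma a * (Gamma a / b powr a))"
    using I G by (subst nn_integral_eq_integral) (auto simp: has_bochner_integral_iff)
  finally show ?thesis using G True by simp
next
  case False
  thus ?thesis by (simp add: rl_kernel_def)
qed

text \<open>Tonelli: the Laplace transform turns the fractional integral into multiplication by
  \<open>b\<^bsup>-a\<^esup>\<close>.\<close>

lemma nn_integral_rl_laplace:
  fixes F :: "real \<Rightarrow> ennreal"
  assumes a: "a > 0" and b: "b > 0" and [measurable]: "F \<in> borel_measurable borel"
  shows "(\<integral>\<^sup>+x. ennreal (exp (- b * x)) * (\<integral>\<^sup>+y. ennreal (rl_kernel a x y) * F y \<partial>lborel) \<partial>lborel) =
    (\<integral>\<^sup>+y. ennreal (exp (- b * y) / b powr a) * F y * indicator {0<..} y \<partial>lborel)"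
proof -
  have "(\<integral>\<^sup>+x. ennreal (exp (- b * x)) * (\<integral>\<^sup>+y. ennreal (rl_kernel a x y) * F y \<partial>lborel) \<partial>lborel) =
      (\<integral>\<^sup>+x. (\<integral>\<^sup>+y. ennreal (exp (- b * x) * rl_kernel a x y) * F y \<partial>lborel) \<partial>lborel)"
    using a by (intro nn_integral_cong)
      (simp add: nn_integral_cmult[symmetric] ennreal_mult' rl_kernel_nonneg mult.assoc)
  also have "\<dots> = (\<integral>\<^sup>+y. (\<integral>\<^sup>+x. ennreal (exp (- b * x) * rl_kernel a x y) * F y \<partial>lborel) \<partial>lborel)"
    by (rule lborel_pair.Fubini') measurable
  also have "\<dots> = (\<integral>\<^sup>+y. ennreal (exp (- b * y) / b powr a) * F y * indicator {0<..} y \<partial>lborel)"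
  proof (intro nn_integral_cong)
    fix y
    have "(\<integral>\<^sup>+x. ennreal (exp (- b * x) * rl_kernel a x y) * F y \<partial>lborel) =
        (\<integral>\<^sup>+x. ennreal (exp (- b * x) * rl_kernel a x y) \<partial>lborel) * F y"
      by (rule nn_integral_multc) measurable
    thus "(\<integral>\<^sup>+x. ennreal (exp (- b * x) * rl_kernel a x y) * F y \<partial>lborel) =
        ennreal (exp (- b * y) / b powr a) * F y * indicator {0<..} y"
      unfolding nn_integral_rl_kernel_exp[OF a b] by (simp only: mult_ac)
  qed
  finally show ?thesis .
qed

lemma nn_integral_beta_interval:
  fixes a c t x :: real
  assumes a: "a > 0" and c: "c > 0" and tx: "t < x"
  shows "(\<integral>\<^sup>+y. ennreal ((x - y) powr (a - 1) * (y - t) powr (c - 1)) * indicator {t<..<x} y \<partial>lborel) =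
    ennreal (Beta c a * (x - t) powr (a + c - 1))"
proof -
  let ?d = "x - t"
  have d: "?d > 0" using tx by simp
  have "(\<integral>\<^sup>+y. ennreal ((x - y) powr (a - 1) * (y - t) powr (c - 1)) * indicator {t<..<x} y \<partial>lborel) =
    ennreal \<bar>?d\<bar> * (\<integral>\<^sup>+v. ennreal ((x - (t + ?d * v)) powr (a - 1) * (t + ?d * v - t) powr (c - 1)) *
      indicator {t<..<x} (t + ?d * v) \<partial>lborel)"
    using d by (intro nn_integral_real_affine) auto
  also have "(\<integral>\<^sup>+v. ennreal ((x - (t + ?d * v)) powr (a - 1) * (t + ?d * v - t) powr (c - 1)) *
      indicator {t<..<x} (t + ?d * v) \<partial>lborel) =
      (\<integral>\<^sup>+v. ennreal (?d powr (a + c - 2)) *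
        ennreal (indicator {0..1} v * (v powr (c - 1) * (1 - v) powr (a - 1))) \<partial>lborel)"
  proof (intro nn_integral_cong)
    fix v
    have iff: "t + ?d * v \<in> {t<..<x} \<longleftrightarrow> 0 < v \<and> v < 1"
    proof -
      have "t + ?d * v < x \<longleftrightarrow> ?d * v < ?d * 1" by auto
      also have "\<dots> \<longleftrightarrow> v < 1" using d by (simp only: mult_less_cancel_left_pos)
      finally show ?thesis using d by (auto simp: zero_less_mult_iff)
    qed
    show "ennreal ((x - (t + ?d * v)) powr (a - 1) * (t + ?d * v - t) powr (c - 1)) *
      indicator {t<..<x} (t + ?d * v) = ennreal (?d powr (a + c - 2)) *
        ennreal (indicator {0..1} v * (v powr (c - 1) * (1 - v) powr (a - 1)))"
    proof (cases "0 < v \<and> v < 1")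
      case True
      have "x - (t + ?d * v) = ?d * (1 - v)" by (simp add: algebra_simps)
      hence "(x - (t + ?d * v)) powr (a - 1) * (t + ?d * v - t) powr (c - 1) =
        (?d powr (a - 1) * ?d powr (c - 1)) * (v powr (c - 1) * (1 - v) powr (a - 1))"
        using True d by (simp only: powr_mult add_diff_cancel_left') (simp add: powr_mult)
      also have "?d powr (a - 1) * ?d powr (c - 1) = ?d powr (a + c - 2)"
        by (simp flip: powr_add)
      finally show ?thesis using True iff by (simp add: ennreal_mult)
    next
      case False
      hence "indicator {0..1} v * (v powr (c - 1) * (1 - v) powr (a - 1)) = (0::real)"
        by (cases "v = 0 \<or> v = 1") (auto simp: indicator_def)
      moreover have "t + ?d * v \<notin> {t<..<x}" using False iff by blast
      hence "indicator {t<..<x} (t + ?d * v) = (0::ennreal)" by (rule indicator_simps(2))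
      ultimately show ?thesis by (simp only: mult_zero_right ennreal_0)
    qed
  qed
  also have "\<dots> = ennreal (?d powr (a + c - 2)) *
      (\<integral>\<^sup>+v. ennreal (indicator {0..1} v * (v powr (c - 1) * (1 - v) powr (a - 1))) \<partial>lborel)"
    by (rule nn_integral_cmult) measurable
  also have "(\<integral>\<^sup>+v. ennreal (indicator {0..1} v * (v powr (c - 1) * (1 - v) powr (a - 1))) \<partial>lborel) =
      ennreal (Beta c a)"
    by (rule nn_integral_has_integral_lebesgue[OF _ has_integral_Beta_real[OF c a]]) auto
  also have "ennreal \<bar>?d\<bar> * (ennreal (?d powr (a + c - 2)) * ennreal (Beta c a)) =
      ennreal (Beta c a * ?d powr (a + c - 1))"
  proof -
    have "\<bar>?d\<bar> * (?d powr (a + c - 2)) = ?d powr (a + c - 1)"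
      using d powr_add[of ?d 1 "a + c - 2"] by simp
    moreover have "Beta c a \<ge> 0" using a c by (simp add: Beta_def Gamma_real_pos less_imp_le)
    ultimately show ?thesis by (simp add: mult_ac flip: ennreal_mult)
  qed
  finally show ?thesis .
qed

text \<open>The semigroup law on the level of kernels is Euler's Beta integral.\<close>

lemma nn_integral_rl_kernel_convolution:
  assumes a: "a > 0" and c: "c > 0"
  shows "(\<integral>\<^sup>+y. ennreal (rl_kernel a x y * rl_kernel c y t) \<partial>lborel) = ennreal (rl_kernel (a + c) x t)"
proof (cases "0 < t \<and> t < x")
  case True
  have G: "Gamma a > 0" "Gamma c > 0" "Gamma (a + c) > 0" using a c by (auto intro: Gamma_real_pos)
  have "(\<integral>\<^sup>+y. ennreal (rl_kernel a x y * rl_kernel c y t) \<partial>lborel) =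
    (\<integral>\<^sup>+y. ennreal (1 / (Gamma a * Gamma c)) *
      (ennreal ((x - y) powr (a - 1) * (y - t) powr (c - 1)) * indicator {t<..<x} y) \<partial>lborel)"
    using True G
    by (intro nn_integral_cong)
       (auto simp: rl_kernel_def indicator_def divide_ennreal simp flip: ennreal_mult)
  also have "\<dots> = ennreal (1 / (Gamma a * Gamma c)) * ennreal (Beta c a * (x - t) powr (a + c - 1))"
    using True by (subst nn_integral_cmult) (auto simp: nn_integral_beta_interval[OF a c])
  also have "\<dots> = ennreal (rl_kernel (a + c) x t)"
    using True G by (simp add: rl_kernel_def Beta_def add.commute flip: ennreal_mult)
  finally show ?thesis .
next
  case False
  have "rl_kernel a x y * rl_kernel c y t = 0" for y using False by (auto simp: rl_kernel_def)
  moreover have "rl_kernel (a + c) x t = 0" using False by (auto simp: rl_kernel_def)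
  ultimately show ?thesis by (simp only: ennreal_0) simp
qed

lemma has_bochner_integral_rl_kernel_power:
  assumes a: "a > 0" and x: "x > 0"
  shows "has_bochner_integral lborel (\<lambda>y. rl_kernel a x y * y ^ k)
    (fact k / Gamma (a + real k + 1) * x powr (a + real k))"
proof (rule has_bochner_integral_nn_integral)
  have G: "Gamma a > 0" "Gamma (a + real k + 1) > 0" using a by (auto intro: Gamma_real_pos)
  show "(\<lambda>y. rl_kernel a x y * y ^ k) \<in> borel_measurable lborel" by measurable
  show "AE y in lborel. 0 \<le> rl_kernel a x y * y ^ k"
    using G by (intro AE_I2) (auto simp: rl_kernel_def)
  show "0 \<le> fact k / Gamma (a + real k + 1) * x powr (a + real k)" using G by auto
  have "(\<integral>\<^sup>+y. ennreal (rl_kernel a x y * y ^ k) \<partial>lborel) = (\<integral>\<^sup>+y. ennreal (1 / Gamma a) *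
      (ennreal ((x - y) powr (a - 1) * (y - 0) powr (real k + 1 - 1)) * indicator {0<..<x} y) \<partial>lborel)"
    using G by (intro nn_integral_cong)
      (auto simp: rl_kernel_def indicator_def powr_realpow simp flip: ennreal_mult)
  also have "\<dots> = ennreal (1 / Gamma a) *
      (\<integral>\<^sup>+y. (ennreal ((x - y) powr (a - 1) * (y - 0) powr (real k + 1 - 1)) * indicator {0<..<x} y) \<partial>lborel)"
    by (rule nn_integral_cmult) measurable
  also have "(\<integral>\<^sup>+y. (ennreal ((x - y) powr (a - 1) * (y - 0) powr (real k + 1 - 1)) * indicator {0<..<x} y) \<partial>lborel) =
      ennreal (Beta (real k + 1) a * (x - 0) powr (a + (real k + 1) - 1))"
    by (rule nn_integral_beta_interval) (use a x in auto)
  also have "ennreal (1 / Gamma a) * ennreal (Beta (real k + 1) a * (x - 0) powr (a + (real k + 1) - 1)) =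
    ennreal (fact k / Gamma (a + real k + 1) * x powr (a + real k))"
    using G Gamma_fact[of k, where 'a = real]
    by (simp add: Beta_def add_ac flip: ennreal_mult)
  finally show "(\<integral>\<^sup>+y. ennreal (rl_kernel a x y * y ^ k) \<partial>lborel) =
    ennreal (fact k / Gamma (a + real k + 1) * x powr (a + real k))" .
qed

lemma has_bochner_integral_rl_kernel_power_half_line:
  assumes "a > 0" "x > 0"
  shows "has_bochner_integral half_line (\<lambda>y. rl_kernel a x y * y ^ k)
    (fact k / Gamma (a + real k + 1) * x powr (a + real k))"
proof -
  have "(\<lambda>y. indicator {0<..} y *\<^sub>R (rl_kernel a x y * y ^ k)) = (\<lambda>y. rl_kernel a x y * y ^ k)"
    by (auto simp: rl_kernel_def indicator_def)
  thus ?thesis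
    using has_bochner_integral_rl_kernel_power[OF assms, of k]
    unfolding has_bochner_integral_iff
    by (subst integrable_half_line_iff, measurable) (subst integral_half_line_eq, measurable)
qed

lemma cmod_rl_integral_le:
  assumes "integrable half_line B" "\<And>y. y > 0 \<Longrightarrow> cmod (rl_kernel a x y *\<^sub>R F y) \<le> B y"
  shows "cmod (rl_integral a F x) \<le> (\<integral>y. B y \<partial>half_line)"
proof (cases "integrable half_line (\<lambda>y. rl_kernel a x y *\<^sub>R F y)")
  case True
  thus ?thesis unfolding rl_integral_eq_half_line
    using assms by (intro Bochner_Integration.integral_norm_bound_integral) auto
next
  case False
  have "0 \<le> (\<integral>y. B y \<partial>half_line)"
    using assms(2) by (intro integral_nonneg_AE AE_half_lineI) (meson norm_ge_zero order_trans)
  thus ?thesis using False unfolding rl_integral_eq_half_line by (simp add: not_integrable_integral_eq)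
qed

lemma rl_integral_polynomial:
  fixes d :: "nat \<Rightarrow> complex"
  assumes a: "a > 0" and x: "x > 0"
  shows "rl_integral a (\<lambda>y. \<Sum>k\<in>I. d k * of_real y ^ k) x =
    (\<Sum>k\<in>I. d k * of_real (fact k / Gamma (a + real k + 1) * x powr (a + real k)))"
proof -
  have "has_bochner_integral lborel
      (\<lambda>y. \<Sum>k\<in>I. d k * complex_of_real (rl_kernel a x y * y ^ k))
      (\<Sum>k\<in>I. d k * of_real (fact k / Gamma (a + real k + 1) * x powr (a + real k)))"
    by (intro has_bochner_integral_sum has_bochner_integral_mult_right has_bochner_integral_of_real
        has_bochner_integral_rl_kernel_power a x)
  also have "(\<lambda>y. \<Sum>k\<in>I. d k * complex_of_real (rl_kernel a x y * y ^ k)) =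
      (\<lambda>y. rl_kernel a x y *\<^sub>R (\<Sum>k\<in>I. d k * of_real y ^ k))"
    by (simp add: scaleR_conv_of_real sum_distrib_left mult_ac)
  finally show ?thesis
    by (subst rl_integral_borel) (auto simp: has_bochner_integral_iff)
qed

section \<open>Local integrability and composition of fractional integrals\<close>

lemma loc_integrable_representative:
  assumes "loc_integrable F"
  obtains F0 where "F0 \<in> borel_measurable borel" "AE y in half_line. F y = F0 y"
    "loc_integrable F0"
proof -
  obtain F0 where F0: "F0 \<in> borel_measurable borel" "AE y in half_line. F y = F0 y"
    using half_line_borel_representative[OF loc_integrable_measurable[OF assms]] by blast
  moreover have "loc_integrable F0"
    using F0 by (intro loc_integrable_cong_AE[OF assms] borel_measurable_lebesgue_onI)
  ultimately show ?thesis by (rule that)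
qed

lemma loc_integrable_nn:
  assumes F: "loc_integrable F" and [measurable]: "F \<in> borel_measurable borel" and x: "x > 0"
  shows "(\<integral>\<^sup>+y. ennreal (cmod (F y)) * indicator {0<..<x} y \<partial>lborel) < \<infinity>"
proof -
  have "integrable half_line (\<lambda>y. indicator {..<x} y *\<^sub>R F y)"
    using F x by (simp add: loc_integrable_half_line_iff)
  hence "integrable lborel (\<lambda>y. indicator {0<..} y *\<^sub>R (indicator {..<x} y *\<^sub>R F y))"
    by (subst (asm) integrable_half_line_iff) auto
  hence "(\<integral>\<^sup>+y. ennreal (norm (indicator {0<..} y *\<^sub>R (indicator {..<x} y *\<^sub>R F y))) \<partial>lborel) < \<infinity>"
    by (simp add: integrable_iff_bounded)
  also have "(\<integral>\<^sup>+y. ennreal (norm (indicator {0<..} y *\<^sub>R (indicator {..<x} y *\<^sub>R F y))) \<partial>lborel) =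
      (\<integral>\<^sup>+y. ennreal (cmod (F y)) * indicator {0<..<x} y \<partial>lborel)"
    by (intro nn_integral_cong) (auto simp: indicator_def)
  finally show ?thesis .
qed

lemma nn_integral_rl_finite:
  assumes a: "a > 0" and F: "loc_integrable F" and [measurable]: "F \<in> borel_measurable borel" and X: "X > 0"
  shows "(\<integral>\<^sup>+x. (\<integral>\<^sup>+y. ennreal (rl_kernel a x y) * ennreal (cmod (F y)) \<partial>lborel) * indicator {..<X} x \<partial>lborel) < \<infinity>"
proof -
  let ?F = "\<lambda>y. ennreal (cmod (F y)) * indicator {0<..<X} y"
  have "(\<integral>\<^sup>+x. (\<integral>\<^sup>+y. ennreal (rl_kernel a x y) * ennreal (cmod (F y)) \<partial>lborel) * indicator {..<X} x \<partial>lborel)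
    \<le> (\<integral>\<^sup>+x. ennreal (exp X) * (ennreal (exp (- 1 * x)) * (\<integral>\<^sup>+y. ennreal (rl_kernel a x y) * ?F y \<partial>lborel)) \<partial>lborel)"
  proof (intro nn_integral_mono)
    fix x
    show "(\<integral>\<^sup>+y. ennreal (rl_kernel a x y) * ennreal (cmod (F y)) \<partial>lborel) * indicator {..<X} x
      \<le> ennreal (exp X) * (ennreal (exp (- 1 * x)) * (\<integral>\<^sup>+y. ennreal (rl_kernel a x y) * ?F y \<partial>lborel))"
    proof (cases "x < X")
      case True
      have "(\<integral>\<^sup>+y. ennreal (rl_kernel a x y) * ennreal (cmod (F y)) \<partial>lborel) =
          (\<integral>\<^sup>+y. ennreal (rl_kernel a x y) * ?F y \<partial>lborel)"
        using True by (intro nn_integral_cong) (auto simp: rl_kernel_def indicator_def)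
      also have "\<dots> = 1 * \<dots>" by simp
      also have "\<dots> \<le> ennreal (exp X * exp (- 1 * x)) * (\<integral>\<^sup>+y. ennreal (rl_kernel a x y) * ?F y \<partial>lborel)"
        using True by (intro mult_right_mono) (auto simp flip: exp_add)
      finally show ?thesis using True by (simp add: ennreal_mult' mult.assoc)
    qed simp
  qed
  also have "\<dots> = ennreal (exp X) * (\<integral>\<^sup>+y. ennreal (exp (- 1 * y) / 1 powr a) * ?F y * indicator {0<..} y \<partial>lborel)"
    using a by (subst nn_integral_cmult, measurable) (subst nn_integral_rl_laplace, auto)
  also have "\<dots> \<le> ennreal (exp X) * (\<integral>\<^sup>+y. ?F y \<partial>lborel)"
  proof (intro mult_left_mono nn_integral_mono)
    fix y
    show "ennreal (exp (- 1 * y) / 1 powr a) * ?F y * indicator {0<..} y \<le> ?F y"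
      using mult_right_mono[of "ennreal (exp (- y))" 1 "ennreal (cmod (F y))"]
      by (auto simp: indicator_def)
  qed simp
  also have "\<dots> < \<infinity>"
    using loc_integrable_nn[OF F _ X] by (simp add: ennreal_mult_less_top)
  finally show ?thesis .
qed

lemma nn_rl_kernel_eq_norm:
  assumes "a > 0"
  shows "(\<integral>\<^sup>+y. ennreal (rl_kernel a x y) * ennreal (cmod (F y)) \<partial>lborel) =
    (\<integral>\<^sup>+y. ennreal (norm (rl_kernel a x y *\<^sub>R F y)) \<partial>lborel)"
  using assms by (intro nn_integral_cong) (simp add: rl_kernel_nonneg flip: ennreal_mult)

lemma norm_rl_integral_le:
  assumes a: "a > 0" and [measurable]: "F \<in> borel_measurable borel"
  shows "ennreal (cmod (rl_integral a F x)) \<le>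
    (\<integral>\<^sup>+y. ennreal (rl_kernel a x y) * ennreal (cmod (F y)) \<partial>lborel)"
  unfolding nn_rl_kernel_eq_norm[OF a] rl_integral_borel[OF assms(2)]
proof (cases "integrable lborel (\<lambda>y. rl_kernel a x y *\<^sub>R F y)")
  case True
  thus "ennreal (cmod (\<integral>y. rl_kernel a x y *\<^sub>R F y \<partial>lborel)) \<le>
      (\<integral>\<^sup>+y. ennreal (norm (rl_kernel a x y *\<^sub>R F y)) \<partial>lborel)"
    by (rule integral_norm_bound_ennreal)
qed (simp add: not_integrable_integral_eq)

text \<open>Almost everywhere the fractional integral is an absolutely convergent integral.\<close>

lemma AE_integrable_rl_kernel:
  assumes a: "a > 0" and F: "loc_integrable F" and [measurable]: "F \<in> borel_measurable borel"
  shows "AE x in lborel. integrable lborel (\<lambda>y. rl_kernel a x y *\<^sub>R F y)"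
proof -
  let ?N = "\<lambda>x. \<integral>\<^sup>+y. ennreal (rl_kernel a x y) * ennreal (cmod (F y)) \<partial>lborel"
  have fin: "AE x in lborel. ?N x * indicator {..<X} x \<noteq> \<infinity>" if "X > 0" for X
  proof (rule nn_integral_PInf_AE)
    show "(\<lambda>x. ?N x * indicator {..<X} x) \<in> borel_measurable lborel" by measurable
    show "(\<integral>\<^sup>+x. ?N x * indicator {..<X} x \<partial>lborel) \<noteq> \<infinity>"
      using nn_integral_rl_finite[OF a F _ that] by simp
  qed
  have "AE x in lborel. \<forall>n::nat. ?N x * indicator {..<real (Suc n)} x \<noteq> \<infinity>"
    by (rule AE_all_countable[THEN iffD2], rule allI) (intro fin, simp)
  thus ?thesis
  proof eventually_elim
    case (elim x)
    obtain n where "x < real n" using reals_Archimedean2 by blast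
    hence "x < real (Suc n)" by simp
    with spec[OF elim, of n] have "?N x < \<infinity>" by (simp add: top.not_eq_extremum)
    thus ?case unfolding nn_rl_kernel_eq_norm[OF a] by (simp add: integrable_iff_bounded)
  qed
qed

lemma rl_integral_diff_AE:
  assumes a: "a > 0" and F: "loc_integrable F" and G: "loc_integrable G"
  shows "AE x in half_line. rl_integral a (\<lambda>y. F y - G y) x = rl_integral a F x - rl_integral a G x"
proof -
  obtain F0 where F0: "F0 \<in> borel_measurable borel" "AE y in half_line. F y = F0 y" "loc_integrable F0"
    using loc_integrable_representative[OF F] by blast
  obtain G0 where G0: "G0 \<in> borel_measurable borel" "AE y in half_line. G y = G0 y" "loc_integrable G0"
    using loc_integrable_representative[OF G] by blast
  note meas = loc_integrable_measurable[OF F] loc_integrable_measurable[OF G]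
    borel_measurable_lebesgue_onI[OF F0(1)] borel_measurable_lebesgue_onI[OF G0(1)]
  have eq: "AE y in half_line. F y - G y = F0 y - G0 y"
    using F0(2) G0(2) by eventually_elim simp
  have d: "(\<lambda>y. F y - G y) \<in> borel_measurable half_line" "(\<lambda>y. F0 y - G0 y) \<in> borel_measurable half_line"
    using meas by (auto intro: borel_measurable_diff)
  have d0: "(\<lambda>y. F0 y - G0 y) \<in> borel_measurable borel" using F0(1) G0(1) by (rule borel_measurable_diff)
  show ?thesis
    unfolding rl_integral_cong_AE[OF d eq] rl_integral_cong_AE[OF meas(1,3) F0(2)]
      rl_integral_cong_AE[OF meas(2,4) G0(2)] AE_half_line_iff
    using AE_integrable_rl_kernel[OF a F0(3,1)] AE_integrable_rl_kernel[OF a G0(3,1)]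
  proof eventually_elim
    case (elim x)
    show ?case
      unfolding rl_integral_borel[OF d0] rl_integral_borel[OF F0(1)] rl_integral_borel[OF G0(1)]
      using elim by (simp add: scaleR_diff_right)
  qed
qed

lemma borel_measurable_rl_integral_borel:
  assumes [measurable]: "F \<in> borel_measurable borel"
  shows "rl_integral a F \<in> borel_measurable borel"
proof -
  have "(\<lambda>x. \<integral>y. rl_kernel a x y *\<^sub>R F y \<partial>lborel) \<in> borel_measurable borel"
    by (rule lborel.borel_measurable_lebesgue_integral) measurable
  thus ?thesis using rl_integral_borel[OF assms] by (simp cong: measurable_cong)
qed

lemma loc_integrable_rl_integral_borel:
  assumes a: "a > 0" and F: "loc_integrable F" and [measurable]: "F \<in> borel_measurable borel"
  shows "loc_integrable (rl_integral a F)"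
  unfolding loc_integrable_half_line_iff
proof (intro allI impI)
  fix X :: real assume X: "X > 0"
  note [measurable] = borel_measurable_rl_integral_borel[OF assms(3), of a]
  have "integrable lborel (\<lambda>y. indicator {0<..} y *\<^sub>R (indicator {..<X} y *\<^sub>R rl_integral a F y))"
  proof (rule integrableI_bounded)
    have "(\<integral>\<^sup>+y. ennreal (norm (indicator {0<..} y *\<^sub>R (indicator {..<X} y *\<^sub>R rl_integral a F y))) \<partial>lborel) \<le>
        (\<integral>\<^sup>+x. (\<integral>\<^sup>+y. ennreal (rl_kernel a x y) * ennreal (cmod (F y)) \<partial>lborel) * indicator {..<X} x \<partial>lborel)"
      using norm_rl_integral_le[OF a assms(3)]
      by (intro nn_integral_mono) (auto simp: indicator_def)
    also have "\<dots> < \<infinity>" by (rule nn_integral_rl_finite[OF a F _ X]) simp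
    finally show "(\<integral>\<^sup>+y. ennreal (norm (indicator {0<..} y *\<^sub>R (indicator {..<X} y *\<^sub>R rl_integral a F y))) \<partial>lborel) < \<infinity>" .
  qed measurable
  thus "integrable half_line (\<lambda>y. indicator {..<X} y *\<^sub>R rl_integral a F y)"
    by (subst integrable_half_line_iff) measurable
qed

lemma loc_integrable_rl_integral:
  assumes a: "a > 0" and F: "loc_integrable F"
  shows "loc_integrable (rl_integral a F)"
proof -
  obtain F0 where F0: "F0 \<in> borel_measurable borel" "AE y in half_line. F y = F0 y" "loc_integrable F0"
    using loc_integrable_representative[OF F] by blast
  have "rl_integral a F = rl_integral a F0"
    by (intro ext rl_integral_cong_AE[OF loc_integrable_measurable[OF F]
          borel_measurable_lebesgue_onI[OF F0(1)] F0(2)])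
  thus ?thesis using loc_integrable_rl_integral_borel[OF a F0(3,1)] by simp
qed

text \<open>For total order at least \<open>1\<close> the composed kernel is bounded, so that Fubini's theorem applies
  at every point and not only almost everywhere.\<close>

lemma rl_kernel_le_indicator:
  assumes "a \<ge> 1"
  shows "rl_kernel a x t \<le> x powr (a - 1) / Gamma a * indicator {0<..<x} t"
  using assms Gamma_real_pos[of a]
  by (auto simp: rl_kernel_def indicator_def intro!: divide_right_mono powr_mono2)

lemma rl_integral_rl_integral_borel:
  assumes a: "a > 0" and c: "c > 0" and ac: "a + c \<ge> 1" and x: "x > 0"
    and F: "loc_integrable F" and [measurable]: "F \<in> borel_measurable borel"
  shows "rl_integral a (rl_integral c F) x = rl_integral (a + c) F x"
proof -
  \<comment> \<open>Integrating \<open>f\<close> over \<open>y\<close> convolves the kernels; integrating it over \<open>t\<close> gives the inner integral.\<close>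
  define f where "f y t = (rl_kernel a x y * rl_kernel c y t) *\<^sub>R F t" for y t
  have norm_f: "ennreal (norm (f y t)) = ennreal (rl_kernel a x y * rl_kernel c y t) * ennreal (cmod (F t))" for y t
    using a c by (simp add: f_def rl_kernel_nonneg abs_mult flip: ennreal_mult)
  have meas: "case_prod f \<in> borel_measurable (lborel \<Otimes>\<^sub>M lborel)"
    unfolding f_def by measurable
  have inner: "(\<integral>\<^sup>+y. ennreal (norm (f y t)) \<partial>lborel) = ennreal (rl_kernel (a + c) x t) * ennreal (cmod (F t))" for t
    unfolding norm_f
    by (subst nn_integral_multc) (measurable, simp only: nn_integral_rl_kernel_convolution[OF a c])
  have "integrable (lborel \<Otimes>\<^sub>M lborel) (case_prod f)"
  proof (rule integrableI_bounded[OF meas])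
    have "(\<integral>\<^sup>+z. ennreal (norm (case_prod f z)) \<partial>(lborel \<Otimes>\<^sub>M lborel)) =
        (\<integral>\<^sup>+t. \<integral>\<^sup>+y. ennreal (norm (f y t)) \<partial>lborel \<partial>lborel)"
      using meas by (subst lborel_pair.nn_integral_snd[symmetric]) auto
    also have "\<dots> = (\<integral>\<^sup>+t. ennreal (rl_kernel (a + c) x t) * ennreal (cmod (F t)) \<partial>lborel)"
      by (simp only: inner)
    also have "\<dots> \<le> (\<integral>\<^sup>+t. ennreal (x powr (a + c - 1) / Gamma (a + c)) *
        (ennreal (cmod (F t)) * indicator {0<..<x} t) \<partial>lborel)"
    proof (intro nn_integral_mono)
      fix t
      have "ennreal (rl_kernel (a + c) x t) \<le> ennreal (x powr (a + c - 1) / Gamma (a + c) * indicator {0<..<x} t)"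
        by (intro ennreal_leI rl_kernel_le_indicator ac)
      also have "\<dots> = ennreal (x powr (a + c - 1) / Gamma (a + c)) * indicator {0<..<x} t"
        by (simp add: indicator_def)
      finally have "ennreal (rl_kernel (a + c) x t) * ennreal (cmod (F t)) \<le>
          (ennreal (x powr (a + c - 1) / Gamma (a + c)) * indicator {0<..<x} t) * ennreal (cmod (F t))"
        by (rule mult_right_mono) simp
      thus "ennreal (rl_kernel (a + c) x t) * ennreal (cmod (F t)) \<le>
          ennreal (x powr (a + c - 1) / Gamma (a + c)) * (ennreal (cmod (F t)) * indicator {0<..<x} t)"
        by (simp only: mult_ac)
    qed
    also have "\<dots> = ennreal (x powr (a + c - 1) / Gamma (a + c)) *
        (\<integral>\<^sup>+t. ennreal (cmod (F t)) * indicator {0<..<x} t \<partial>lborel)"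
      by (rule nn_integral_cmult) measurable
    also have "\<dots> < \<infinity>"
      using loc_integrable_nn[OF F _ x] by (simp add: ennreal_mult_less_top)
    finally show "(\<integral>\<^sup>+z. ennreal (norm (case_prod f z)) \<partial>(lborel \<Otimes>\<^sub>M lborel)) < \<infinity>" .
  qed
  hence "(\<integral>t. (\<integral>y. f y t \<partial>lborel) \<partial>lborel) = (\<integral>y. (\<integral>t. f y t \<partial>lborel) \<partial>lborel)"
    by (rule lborel_pair.Fubini_integral)
  moreover have "(\<integral>y. f y t \<partial>lborel) = rl_kernel (a + c) x t *\<^sub>R F t" for t
  proof -
    have "has_bochner_integral lborel (\<lambda>y. rl_kernel a x y * rl_kernel c y t) (rl_kernel (a + c) x t)"
      using a c nn_integral_rl_kernel_convolution[OF a c, of x t]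
      by (intro has_bochner_integral_nn_integral) (auto simp: rl_kernel_nonneg)
    hence "has_bochner_integral lborel (\<lambda>y. f y t) (rl_kernel (a + c) x t *\<^sub>R F t)"
      unfolding f_def by (intro has_bochner_integral_scaleR_left)
    thus ?thesis by (rule has_bochner_integral_integral_eq)
  qed
  moreover have "(\<integral>t. f y t \<partial>lborel) = rl_kernel a x y *\<^sub>R rl_integral c F y" for y
    unfolding f_def rl_integral_borel[OF assms(6)] scaleR_scaleR[symmetric] by (rule integral_scaleR_right)
  ultimately show ?thesis
    using rl_integral_borel[OF assms(6), of "a + c" x]
      rl_integral_borel[OF borel_measurable_rl_integral_borel[OF assms(6), of c], of a x] by simp
qed

lemma rl_integral_rl_integral:
  assumes a: "a > 0" and c: "c > 0" and ac: "a + c \<ge> 1" and x: "x > 0" and F: "loc_integrable F"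
  shows "rl_integral a (rl_integral c F) x = rl_integral (a + c) F x"
proof -
  obtain F0 where F0: "F0 \<in> borel_measurable borel" "AE y in half_line. F y = F0 y" "loc_integrable F0"
    using loc_integrable_representative[OF F] by blast
  have "rl_integral d F = rl_integral d F0" for d
    by (intro ext rl_integral_cong_AE[OF loc_integrable_measurable[OF F]
          borel_measurable_lebesgue_onI[OF F0(1)] F0(2)])
  thus ?thesis using rl_integral_rl_integral_borel[OF a c ac x F0(3,1)] by simp
qed

lemma rl_integral_one:
  "rl_integral 1 F x = (LINT y:{0<..<x}|lebesgue. F y)"
  unfolding rl_integral_def set_lebesgue_integral_def
  by (auto intro!: Bochner_Integration.integral_cong simp: indicator_def)

section \<open>Locally absolutely continuous functions\<close>

definition ac_step :: "(real \<Rightarrow> complex) \<Rightarrow> (real \<Rightarrow> complex) \<Rightarrow> bool" where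
  "ac_step h h' \<longleftrightarrow> (\<forall>a b. 0 < a \<and> a \<le> b \<longrightarrow>
     set_integrable lebesgue {a..b} h' \<and> h b - h a = (LINT x:{a..b}|lebesgue. h' x))"

lemma ac_deriv_Suc: "ac_deriv (Suc j) h g \<longleftrightarrow> (\<exists>h'. ac_step h h' \<and> ac_deriv j h' g)"
  by (simp add: ac_step_def)

declare ac_deriv.simps(2) [simp del]

lemma ac_stepD:
  assumes "ac_step h h'" "0 < a" "a \<le> b"
  shows "set_integrable lebesgue {a..b} h'" "h b - h a = (LINT x:{a..b}|lebesgue. h' x)"
  using assms by (auto simp: ac_step_def)

lemma ac_step_measurable:
  assumes "ac_step h h'"
  shows "h' \<in> borel_measurable half_line"
proof (rule borel_measurable_LIMSEQ_metric)
  let ?S = "\<lambda>n. {1 / real (Suc n)..real (Suc n)}"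
  show "(\<lambda>y. indicator (?S n) y *\<^sub>R h' y) \<in> borel_measurable half_line" for n
  proof -
    have "1 / real (Suc n) \<le> 1" "1 \<le> real (Suc n)" by simp_all
    hence "1 / real (Suc n) \<le> real (Suc n)" by linarith
    hence "set_integrable lebesgue (?S n) h'"
      by (intro ac_stepD(1)[OF assms]) simp_all
    hence "(\<lambda>y. indicator (?S n) y *\<^sub>R h' y) \<in> borel_measurable lebesgue"
      by (auto simp: set_integrable_def)
    thus ?thesis by (rule measurable_restrict_space1)
  qed
  fix y :: real assume "y \<in> space half_line"
  hence y: "y > 0" by simp
  obtain N where N: "max y (1 / y) < real N" using reals_Archimedean2 by blast
  have "\<forall>\<^sub>F n in sequentially. indicator (?S n) y *\<^sub>R h' y = h' y"
  proof (intro eventually_sequentiallyI)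
    fix n assume "N \<le> n"
    hence n: "real N \<le> real (Suc n)" by simp
    have "y \<le> real (Suc n)" "1 / y \<le> real (Suc n)" using N n by auto
    hence "y \<in> ?S n" using y by (auto simp: field_simps)
    thus "indicator (?S n) y *\<^sub>R h' y = h' y" by simp
  qed
  thus "(\<lambda>n. indicator (?S n) y *\<^sub>R h' y) \<longlonglongrightarrow> h' y" by (rule tendsto_eventually)
qed

lemma AE_half_line_imp_Icc:
  assumes "AE x in half_line. P x" "0 < (a::real)"
  shows "AE x\<in>{a..b} in lebesgue. P x"
  using assms(1) unfolding AE_half_line_iff AE_completion_iff
  by eventually_elim (use assms(2) in auto)

lemma ac_step_cong_AE:
  assumes step: "ac_step h h'" and k: "k \<in> borel_measurable half_line"
    and eq: "AE x in half_line. h' x = k x"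
  shows "ac_step h k"
  unfolding ac_step_def
proof (intro allI impI)
  fix a b :: real assume ab: "0 < a \<and> a \<le> b"
  have I: "integrable lebesgue (\<lambda>x. indicator {a..b} x *\<^sub>R h' x)"
    using ac_stepD(1)[OF step, of a b] ab by (simp add: set_integrable_def)
  have "(\<lambda>x. indicator {0<..} x *\<^sub>R k x) \<in> borel_measurable lebesgue"
    using k by (subst (asm) borel_measurable_restrict_space_iff) auto
  moreover have "(indicator {a..b} :: real \<Rightarrow> real) \<in> borel_measurable lebesgue"
    by (intro borel_measurable_indicator) auto
  ultimately have "(\<lambda>x. indicator {a..b} x *\<^sub>R (indicator {0<..} x *\<^sub>R k x)) \<in> borel_measurable lebesgue"
    by (rule borel_measurable_scaleR[rotated])
  also have "(\<lambda>x. indicator {a..b} x *\<^sub>R (indicator {0<..} x *\<^sub>R k x)) = (\<lambda>x. indicator {a..b} x *\<^sub>R k x)"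
  proof
    fix x
    show "indicator {a..b} x *\<^sub>R (indicator {0<..} x *\<^sub>R k x) = indicator {a..b} x *\<^sub>R k x"
      using ab by (cases "x \<in> {a..b}") auto
  qed
  finally have K: "(\<lambda>x. indicator {a..b} x *\<^sub>R k x) \<in> borel_measurable lebesgue" .
  have E: "AE x in lebesgue. indicator {a..b} x *\<^sub>R h' x = indicator {a..b} x *\<^sub>R k x"
    using AE_half_line_imp_Icc[OF eq conjunct1[OF ab], of b]
    by eventually_elim (auto simp: indicator_def)
  have "integrable lebesgue (\<lambda>x. indicator {a..b} x *\<^sub>R k x)"
    by (rule integrable_cong_AE_imp[OF I K E])
  moreover have "(\<integral>x. indicator {a..b} x *\<^sub>R h' x \<partial>lebesgue) = (\<integral>x. indicator {a..b} x *\<^sub>R k x \<partial>lebesgue)"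
    using I K E by (intro integral_cong_AE) auto
  ultimately show "set_integrable lebesgue {a..b} k \<and> h b - h a = (LINT x:{a..b}|lebesgue. k x)"
    using ac_stepD(2)[OF step, of a b] ab by (simp add: set_integrable_def set_lebesgue_integral_def)
qed

lemma ac_step_cong_pos:
  assumes "ac_step h h'" "\<And>x. x > 0 \<Longrightarrow> h x = k x"
  shows "ac_step k h'"
  using assms by (auto simp: ac_step_def)

lemma ac_step_add:
  assumes "ac_step h h'" "ac_step k k'"
  shows "ac_step (\<lambda>x. h x + k x) (\<lambda>x. h' x + k' x)"
  unfolding ac_step_def
proof (intro allI impI)
  fix a b :: real assume ab: "0 < a \<and> a \<le> b"
  note H = ac_stepD[OF assms(1), of a b] and K = ac_stepD[OF assms(2), of a b]
  show "set_integrable lebesgue {a..b} (\<lambda>x. h' x + k' x) \<and>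
    h b + k b - (h a + k a) = (LINT x:{a..b}|lebesgue. h' x + k' x)"
    using ab H K set_integral_add[of lebesgue "{a..b}" h' k'] by (simp add: algebra_simps)
qed

lemma ac_step_uminus:
  assumes "ac_step h h'"
  shows "ac_step (\<lambda>x. - h x) (\<lambda>x. - h' x)"
  unfolding ac_step_def
proof (intro allI impI)
  fix a b :: real assume ab: "0 < a \<and> a \<le> b"
  note H = ac_stepD[OF assms(1), of a b]
  show "set_integrable lebesgue {a..b} (\<lambda>x. - h' x) \<and>
    - h b - - h a = (LINT x:{a..b}|lebesgue. - h' x)"
    using ab H by (simp add: set_integrable_def set_lebesgue_integral_def algebra_simps)
qed

lemma ac_step_continuous:
  assumes "ac_step h h'"
  shows "continuous_on {0<..} h"
proof (rule continuous_at_imp_continuous_on, intro ballI)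
  fix x :: real assume "x \<in> {0<..}"
  hence x: "x > 0" by simp
  let ?a = "x / 2" and ?b = "x + 1"
  have I: "set_integrable lebesgue {?a..?b} h'" by (rule ac_stepD(1)[OF assms]) (use x in auto)
  hence HK: "h' integrable_on {?a..?b}" by (rule set_lebesgue_integral_eq_integral(1))
  have eq: "h y = h ?a + integral {?a..y} h'" if "y \<in> {?a..?b}" for y
  proof -
    have "set_integrable lebesgue {?a..y} h'" using that x by (intro ac_stepD(1)[OF assms]) auto
    thus ?thesis
      using ac_stepD(2)[OF assms, of ?a y] that x set_lebesgue_integral_eq_integral(2)[of "{?a..y}" h']
      by (simp add: algebra_simps)
  qed
  have "continuous_on {?a..?b} (\<lambda>y. h ?a + integral {?a..y} h')"
    by (intro continuous_on_add continuous_on_const indefinite_integral_continuous_1 HK)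
  hence "continuous_on {?a..?b} h" by (rule continuous_on_eq) (rule eq[symmetric])
  thus "isCont h x" using x by (intro continuous_on_interior) auto
qed

lemma continuous_on_AE_eq:
  fixes h k :: "real \<Rightarrow> complex"
  assumes h: "continuous_on {0<..} h" and k: "continuous_on {0<..} k"
    and eq: "AE x in half_line. h x = k x" and x: "x > 0"
  shows "h x = k x"
proof (rule ccontr)
  assume ne: "h x \<noteq> k x"
  define U where "U = {0<..} \<inter> (\<lambda>y. h y - k y) -` (- {0})"
  have "openin (top_of_set {0<..}) U"
    unfolding U_def by (rule continuous_openin_preimage_gen[OF continuous_on_diff[OF h k]]) auto
  hence op: "open U"
    by (rule openin_open_trans[OF _ open_greaterThan])
  have ae: "AE y in lebesgue. y \<notin> U"
    using eq unfolding AE_half_line_iff AE_completion_iff by eventually_elim (auto simp: U_def)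
  have "U \<in> sets lebesgue" using op by simp
  from AE_iff_null_sets[OF this, THEN iffD2, OF ae]
  have "negligible U" by (simp add: negligible_iff_null_sets)
  hence "U = {}" using open_not_negligible[OF op] by auto
  thus False using x ne by (auto simp: U_def)
qed

lemma ac_step_eq_pos:
  assumes "ac_step h h'" "ac_step k k'" "AE x in half_line. h x = k x" "x > 0"
  shows "h x = k x"
  using continuous_on_AE_eq[OF ac_step_continuous[OF assms(1)] ac_step_continuous[OF assms(2)] assms(3,4)] .

text \<open>An indefinite integral has the integrand as its derivative almost everywhere. The integrand need not be
  integrable near \<open>0\<close>, hence the countably many cut-offs away from \<open>0\<close>.\<close>

lemma ac_step_zero:
  assumes step: "ac_step (\<lambda>x. 0) d"
  shows "AE x in half_line. d x = 0"
proof -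
  have "AE x in lebesgue. 1 / real (Suc n) < x \<longrightarrow> d x = 0" for n
  proof -
    let ?c = "1 / real (Suc n)"
    let ?d = "\<lambda>x. indicator {?c..} x *\<^sub>R d x"
    have int: "?d integrable_on cbox a b" for a b
    proof -
      have "set_integrable lebesgue {?c..max ?c b} d" by (rule ac_stepD(1)[OF step]) auto
      hence "integrable lebesgue (\<lambda>x. indicator {?c..max ?c b} x *\<^sub>R d x)"
        by (simp add: set_integrable_def)
      hence "integrable lebesgue (\<lambda>x. indicator {a..b} x *\<^sub>R (indicator {?c..max ?c b} x *\<^sub>R d x))"
        by (rule integrable_mult_indicator[rotated]) simp
      also have "(\<lambda>x. indicator {a..b} x *\<^sub>R (indicator {?c..max ?c b} x *\<^sub>R d x)) =
          (\<lambda>x. indicator {a..b} x *\<^sub>R ?d x)"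
        by (auto simp: indicator_def)
      finally have "set_integrable lebesgue {a..b} ?d" by (simp add: set_integrable_def)
      thus ?thesis using set_lebesgue_integral_eq_integral(1) by auto
    qed
    obtain N where N: "negligible N"
      and deriv: "\<And>x e. \<lbrakk>x \<notin> N; 0 < e\<rbrakk> \<Longrightarrow> \<exists>\<delta>>0. \<forall>h. 0 < h \<and> h < \<delta> \<longrightarrow>
        norm (integral (cbox x (x + h *\<^sub>R One)) ?d /\<^sub>R h ^ DIM(real) - ?d x) < e"
      by (rule integrable_ccontinuous_explicit[of ?d, OF int]) blast
    have d0: "d x = 0" if x: "?c < x" "x \<notin> N" for x
    proof (rule ccontr)
      assume "d x \<noteq> 0"
      then obtain \<delta> where \<delta>: "\<delta> > 0" "\<And>h. 0 < h \<Longrightarrow> h < \<delta> \<Longrightarrow>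
        norm (integral (cbox x (x + h *\<^sub>R One)) ?d /\<^sub>R h ^ DIM(real) - ?d x) < cmod (d x)"
        using deriv[OF x(2), of "cmod (d x)"] by auto
      have pos: "0 < x" using x(1) by (meson divide_pos_pos less_trans of_nat_0_less_iff zero_less_Suc zero_less_one)
      have "integral (cbox x (x + (\<delta> / 2) *\<^sub>R One)) ?d = integral {x..x + \<delta> / 2} d"
        using x by (auto intro!: integral_cong)
      also have "\<dots> = (LINT y:{x..x + \<delta> / 2}|lebesgue. d y)"
        using pos \<delta>(1) by (intro set_lebesgue_integral_eq_integral(2)[symmetric] ac_stepD(1)[OF step]) auto
      also have "\<dots> = 0"
        using ac_stepD(2)[OF step, of x "x + \<delta> / 2"] pos \<delta>(1) by simp
      finally show False using \<delta>(2)[of "\<delta> / 2"] \<delta>(1) x by simp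
    qed
    have "AE x in lebesgue. x \<notin> N"
      using N by (simp add: negligible_iff_null_sets AE_not_in)
    thus ?thesis by eventually_elim (use d0 in blast)
  qed
  hence "AE x in lebesgue. \<forall>n. 1 / real (Suc n) < x \<longrightarrow> d x = 0"
    by (intro AE_all_countable[THEN iffD2] allI)
  hence "AE x in lborel. \<forall>n. 1 / real (Suc n) < x \<longrightarrow> d x = 0" by (simp only: AE_completion_iff)
  thus ?thesis unfolding AE_half_line_iff
  proof eventually_elim
    case (elim x)
    show ?case
    proof
      assume "0 < x"
      then obtain n where "1 / real (Suc n) < x" using nat_approx_posE by blast
      thus "d x = 0" using elim by blast
    qed
  qed
qed

lemma ac_step_unique:
  assumes "ac_step h h'" "ac_step k k'" "\<And>x. x > 0 \<Longrightarrow> h x = k x"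
  shows "AE x in half_line. h' x = k' x"
proof -
  have "ac_step (\<lambda>x. h x + - k x) (\<lambda>x. h' x + - k' x)"
    by (intro ac_step_add ac_step_uminus assms)
  hence "ac_step (\<lambda>x. 0) (\<lambda>x. h' x + - k' x)" by (rule ac_step_cong_pos) (simp add: assms(3))
  from ac_step_zero[OF this] show ?thesis by eventually_elim simp
qed

text \<open>Although each derivative is only determined almost everywhere, the intermediate ones are continuous and
  therefore determined everywhere.\<close>

lemma ac_deriv_unique:
  assumes "ac_deriv j h g" "ac_deriv j k g'" "AE x in half_line. h x = k x"
  shows "AE x in half_line. g x = g' x"
  using assms
proof (induction j arbitrary: h k)
  case 0
  hence "AE x in half_line. h x = g x" "AE x in half_line. k x = g' x" by simp_all
  thus ?case using "0.prems"(3) by eventually_elim simp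
next
  case (Suc j)
  then obtain h' k' where *: "ac_step h h'" "ac_deriv j h' g" "ac_step k k'" "ac_deriv j k' g'"
    by (auto simp: ac_deriv_Suc)
  have "AE x in half_line. h' x = k' x"
    using ac_step_eq_pos[OF *(1,3) Suc.prems(3)] by (intro ac_step_unique[OF *(1,3)])
  thus ?case by (rule Suc.IH[OF *(2,4)])
qed

text \<open>The last derivative of the first chain is known only almost everywhere; it has to be exchanged for the
  version \<open>g2\<close> that can be differentiated further.\<close>

lemma ac_deriv_concat:
  assumes "ac_deriv (Suc i) h g1" "AE x in half_line. g1 x = g2 x" "g2 \<in> borel_measurable half_line"
    and "ac_deriv j g2 g3"
  shows "ac_deriv (Suc i + j) h g3"
  using assms(1)
proof (induction i arbitrary: h)
  case 0
  then obtain h' where h': "ac_step h h'" "AE x in half_line. h' x = g1 x"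
    by (auto simp: ac_deriv_Suc)
  have "AE x in half_line. h' x = g2 x" using h'(2) assms(2) by eventually_elim simp
  from ac_step_cong_AE[OF h'(1) assms(3) this] assms(4) show ?case by (auto simp: ac_deriv_Suc)
next
  case (Suc i)
  then obtain h' where h': "ac_step h h'" "ac_deriv (Suc i) h' g1" using ac_deriv_Suc by blast
  have "ac_deriv (Suc (Suc i + j)) h g3"
    using ac_deriv_Suc[THEN iffD2, OF exI, OF conjI, OF h'(1) Suc.IH[OF h'(2)]] .
  thus ?case by simp
qed

section \<open>Derivatives of fractional integrals\<close>

lemma ac_step_rl_integral_one:
  assumes F: "loc_integrable F"
  shows "ac_step (rl_integral 1 F) F"
  unfolding ac_step_def
proof (intro allI impI)
  fix a b :: real assume ab: "0 < a \<and> a \<le> b"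
  have b1: "set_integrable lebesgue {0<..<b + 1} F"
    using F ab by (auto simp: loc_integrable_def)
  have I: "set_integrable lebesgue {a..b} F"
    by (rule set_integrable_subset[OF b1]) (use ab in auto)
  have Ia: "set_integrable lebesgue {0<..<a} F"
    by (rule set_integrable_subset[OF b1]) (use ab in auto)
  have "rl_integral 1 F b = (LINT y:{0<..b}|lebesgue. F y)"
    unfolding rl_integral_one
  proof (rule set_integral_cong_set)
    have Ib: "set_integrable lebesgue {0<..b} F" "set_integrable lebesgue {0<..<b} F"
      by (rule set_integrable_subset[OF b1]; use ab in auto)+
    show "set_borel_measurable lebesgue {0<..<b} F" "set_borel_measurable lebesgue {0<..b} F"
      using Ib by (auto simp: set_integrable_def set_borel_measurable_def)
    show "AE x in lebesgue. (x \<in> {0<..b}) = (x \<in> {0<..<b})"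
      using AE_lborel_singleton[of b] unfolding AE_completion_iff by eventually_elim auto
  qed
  also have "{0<..b} = {0<..<a} \<union> {a..b}" using ab by auto
  also have "(LINT y:{0<..<a} \<union> {a..b}|lebesgue. F y) =
      (LINT y:{0<..<a}|lebesgue. F y) + (LINT y:{a..b}|lebesgue. F y)"
    by (rule set_integral_Un[OF _ Ia I]) auto
  finally show "set_integrable lebesgue {a..b} F \<and>
    rl_integral 1 F b - rl_integral 1 F a = (LINT x:{a..b}|lebesgue. F x)"
    using I by (simp add: rl_integral_one)
qed

lemma ac_step_rl_integral:
  assumes c: "c > 0" and F: "loc_integrable F"
  shows "ac_step (rl_integral (c + 1) F) (rl_integral c F)"
proof (rule ac_step_cong_pos)
  show "ac_step (rl_integral 1 (rl_integral c F)) (rl_integral c F)"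
    by (intro ac_step_rl_integral_one loc_integrable_rl_integral c F)
  show "rl_integral 1 (rl_integral c F) x = rl_integral (c + 1) F x" if "x > 0" for x
    using rl_integral_rl_integral[of 1 c x F] c F that by (simp add: add.commute)
qed

lemma ac_deriv_rl_integral:
  assumes "loc_integrable F"
  shows "ac_deriv (Suc k) (rl_integral (real (Suc k)) F) F"
proof (induction k)
  case 0
  show ?case using ac_step_rl_integral_one[OF assms] by (auto simp: ac_deriv_Suc)
next
  case (Suc k)
  have "ac_step (rl_integral (real (Suc k) + 1) F) (rl_integral (real (Suc k)) F)"
    by (rule ac_step_rl_integral[OF _ assms]) simp
  thus ?case using Suc ac_deriv_Suc[of "Suc k"] by (auto simp: add_ac)
qed

lemma ac_step_monomial:
  "ac_step (\<lambda>x. c / of_nat (Suc i) * of_real x ^ Suc i) (\<lambda>x. c * of_real x ^ i)"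
  unfolding ac_step_def
proof (intro allI impI)
  fix a b :: real assume ab: "0 < a \<and> a \<le> b"
  have cont: "continuous_on {a..b} (\<lambda>x. c * complex_of_real x ^ i)" by (intro continuous_intros)
  have I: "set_integrable lebesgue {a..b} (\<lambda>x. c * complex_of_real x ^ i)"
    using absolutely_integrable_continuous_real[OF cont] .
  have "((\<lambda>x. c * complex_of_real x ^ i) has_integral
      (c / of_nat (Suc i) * of_real b ^ Suc i - c / of_nat (Suc i) * of_real a ^ Suc i)) {a..b}"
  proof (rule fundamental_theorem_of_calculus)
    show "((\<lambda>x. c / of_nat (Suc i) * complex_of_real x ^ Suc i) has_vector_derivative
        c * complex_of_real x ^ i) (at x within {a..b})" for x
    proof -
      have "((\<lambda>z. c / of_nat (Suc i) * z ^ Suc i) has_field_derivative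
          c / of_nat (Suc i) * (of_nat (Suc i) * complex_of_real x ^ i)) (at (of_real x))"
        using DERIV_power_Suc[OF DERIV_ident, of i "complex_of_real x" UNIV]
        by (intro DERIV_cmult) simp
      from has_vector_derivative_real_field[OF this] show ?thesis
        by (auto intro: has_vector_derivative_at_within simp del: of_nat_Suc)
    qed
  qed (use ab in simp)
  thus "set_integrable lebesgue {a..b} (\<lambda>x. c * complex_of_real x ^ i) \<and>
    c / of_nat (Suc i) * of_real b ^ Suc i - c / of_nat (Suc i) * of_real a ^ Suc i =
    (LINT x:{a..b}|lebesgue. c * of_real x ^ i)"
    unfolding set_lebesgue_integral_eq_integral(2)[OF I] by (intro conjI I integral_unique[symmetric])
qed

lemma ac_step_const: "ac_step (\<lambda>x. c) (\<lambda>x. 0)"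
  by (auto simp: ac_step_def set_integrable_def)

lemma ac_step_sum:
  "finite I \<Longrightarrow> (\<And>i. i \<in> I \<Longrightarrow> ac_step (h i) (h' i)) \<Longrightarrow>
    ac_step (\<lambda>x. \<Sum>i\<in>I. h i x) (\<lambda>x. \<Sum>i\<in>I. h' i x)"
  by (induction I rule: finite_induct) (auto intro: ac_step_add ac_step_const)

lemma ac_step_same_deriv:
  assumes "ac_step h h'" "ac_step k k'" "\<And>x. x > 0 \<Longrightarrow> h' x = k' x" "x > 0"
  shows "h x = k x + (h 1 - k 1)"
proof -
  have *: "h b - h a = k b - k a" if "0 < a" "a \<le> b" for a b
  proof -
    have "(LINT x:{a..b}|lebesgue. h' x) = (LINT x:{a..b}|lebesgue. k' x)"
      using assms(3) that by (intro set_lebesgue_integral_cong) auto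
    thus ?thesis using ac_stepD(2)[OF assms(1) that] ac_stepD(2)[OF assms(2) that] by simp
  qed
  show ?thesis
    using *[of 1 x] *[of x 1] assms(4) by (cases "x \<le> 1") (auto simp: algebra_simps)
qed

text \<open>Taylor's formula with the remainder as an iterated integral.\<close>

lemma ac_deriv_taylor:
  assumes F: "loc_integrable F" and "ac_deriv (Suc k) h F"
  shows "\<exists>d. \<forall>x>0. h x = (\<Sum>i<Suc k. d i * of_real x ^ i) + rl_integral (real (Suc k)) F x"
  using assms(2)
proof (induction k arbitrary: h)
  case 0
  then obtain h' where h': "ac_step h h'" "AE x in half_line. h' x = F x"
    by (auto simp: ac_deriv_Suc)
  have hF: "ac_step h F" by (rule ac_step_cong_AE[OF h'(1) loc_integrable_measurable[OF F] h'(2)])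
  have "h x = (\<Sum>i<Suc 0. (h 1 - rl_integral 1 F 1) * of_real x ^ i) + rl_integral (real (Suc 0)) F x"
    if "x > 0" for x
    using ac_step_same_deriv[OF hF ac_step_rl_integral_one[OF F] refl that] by simp
  thus ?case by (intro exI[of _ "\<lambda>_. h 1 - rl_integral 1 F 1"] allI impI)
next
  case (Suc k)
  from ac_deriv_Suc[THEN iffD1, OF Suc.prems]
  obtain h' where h'_both: "ac_step h h' \<and> ac_deriv (Suc k) h' F" by (rule exE)
  note h' = conjunct1[OF h'_both] conjunct2[OF h'_both]
  from Suc.IH[OF h'(2)] obtain d
    where d': "\<forall>x>0. h' x = (\<Sum>i<Suc k. d i * of_real x ^ i) + rl_integral (real (Suc k)) F x"
    by (rule exE)
  note d = d'[rule_format]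
  define P where "P x = (\<Sum>i<Suc k. d i / of_nat (Suc i) * complex_of_real x ^ Suc i)" for x
  have "ac_step (\<lambda>x. P x + rl_integral (real (Suc k) + 1) F x)
    (\<lambda>x. (\<Sum>i<Suc k. d i * of_real x ^ i) + rl_integral (real (Suc k)) F x)"
    unfolding P_def by (intro ac_step_add ac_step_sum ac_step_monomial ac_step_rl_integral F) auto
  note same = ac_step_same_deriv[OF h'(1) this d]
  define C where "C = h 1 - (P 1 + rl_integral (real (Suc k) + 1) F 1)"
  have C: "h x = P x + rl_integral (real (Suc k) + 1) F x + C" if "x > 0" for x
    unfolding C_def by (rule same) (use that in simp_all)
  define d' where "d' i = (case i of 0 \<Rightarrow> C | Suc i \<Rightarrow> d i / of_nat (Suc i))" for i
  have "(\<Sum>i<Suc (Suc k). d' i * of_real x ^ i) = C + P x" for x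
    unfolding P_def by (subst sum.lessThan_Suc_shift) (simp add: d'_def)
  hence "h x = (\<Sum>i<Suc (Suc k). d' i * of_real x ^ i) + rl_integral (real (Suc (Suc k))) F x" if "x > 0" for x
    using C[OF that] by (simp add: add_ac)
  thus ?case by (intro exI[of _ d'] allI impI)
qed

section \<open>The initial value problem\<close>

text \<open>\<open>f(x) = o(x\<^sup>k)\<close> as \<open>x\<close> decreases to \<open>0\<close>.\<close>

definition vanishes_at_0 :: "nat \<Rightarrow> (real \<Rightarrow> complex) \<Rightarrow> bool" where
  "vanishes_at_0 k f \<longleftrightarrow> (\<forall>\<epsilon>>0. \<exists>\<delta>>0. \<forall>x. 0 < x \<and> x < \<delta> \<longrightarrow> cmod (f x) \<le> \<epsilon> * x ^ k)"

lemma vanishes_at_0D: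
  assumes "vanishes_at_0 k f" "\<epsilon> > 0"
  obtains \<delta> where "\<delta> > 0" "\<delta> \<le> 1" "\<And>x. 0 < x \<Longrightarrow> x < \<delta> \<Longrightarrow> cmod (f x) \<le> \<epsilon> * x ^ k"
proof -
  obtain \<delta> where "\<delta> > 0" "\<And>x. 0 < x \<Longrightarrow> x < \<delta> \<Longrightarrow> cmod (f x) \<le> \<epsilon> * x ^ k"
    using assms unfolding vanishes_at_0_def by blast
  thus ?thesis by (intro that[of "min \<delta> 1"]) auto
qed

lemma vanishes_at_0_diff:
  assumes "vanishes_at_0 k f" "vanishes_at_0 k g"
  shows "vanishes_at_0 k (\<lambda>x. f x - g x)"
  unfolding vanishes_at_0_def
proof (intro allI impI)
  fix \<epsilon> :: real assume "\<epsilon> > 0"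
  hence e2: "\<epsilon> / 2 > 0" by simp
  obtain \<delta>1 where 1: "\<delta>1 > 0" "\<And>x. 0 < x \<Longrightarrow> x < \<delta>1 \<Longrightarrow> cmod (f x) \<le> \<epsilon> / 2 * x ^ k"
    by (rule vanishes_at_0D[OF assms(1) e2]) blast
  obtain \<delta>2 where 2: "\<delta>2 > 0" "\<And>x. 0 < x \<Longrightarrow> x < \<delta>2 \<Longrightarrow> cmod (g x) \<le> \<epsilon> / 2 * x ^ k"
    by (rule vanishes_at_0D[OF assms(2) e2]) blast
  show "\<exists>\<delta>>0. \<forall>x. 0 < x \<and> x < \<delta> \<longrightarrow> cmod (f x - g x) \<le> \<epsilon> * x ^ k"
  proof (intro exI[of _ "min \<delta>1 \<delta>2"] conjI allI impI)
    fix x assume x: "0 < x \<and> x < min \<delta>1 \<delta>2"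
    have "cmod (f x - g x) \<le> cmod (f x) + cmod (g x)" by (rule norm_triangle_ineq4)
    also have "\<dots> \<le> \<epsilon> / 2 * x ^ k + \<epsilon> / 2 * x ^ k" using 1(2)[of x] 2(2)[of x] x by (intro add_mono) auto
    finally show "cmod (f x - g x) \<le> \<epsilon> * x ^ k" by simp
  qed (use 1 2 in simp)
qed

lemma vanishes_at_0_cong:
  assumes "vanishes_at_0 k f" "\<And>x. x > 0 \<Longrightarrow> f x = g x"
  shows "vanishes_at_0 k g"
  using assms unfolding vanishes_at_0_def by simp

lemma vanishes_at_0_constant_term:
  fixes d :: "nat \<Rightarrow> complex"
  assumes v: "vanishes_at_0 k (\<lambda>x. \<Sum>i<Suc k. d i * of_real x ^ i)"
  shows "d 0 = 0"
proof -
  let ?p = "\<lambda>x::real. \<Sum>i<Suc k. d i * complex_of_real x ^ i"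
  have "(?p \<longlongrightarrow> (\<Sum>i<Suc k. d i * complex_of_real 0 ^ i)) (at_right 0)"
    by (intro tendsto_intros)
  also have "(\<Sum>i<Suc k. d i * complex_of_real 0 ^ i) = d 0"
    by (subst sum.lessThan_Suc_shift) simp
  finally have lim: "((\<lambda>x. cmod (?p x)) \<longlongrightarrow> cmod (d 0)) (at_right 0)" by (rule tendsto_norm)
  have "cmod (d 0) \<le> 0 + \<epsilon>" if \<epsilon>: "\<epsilon> > 0" for \<epsilon>
  proof -
    obtain \<delta> where \<delta>: "\<delta> > 0" "\<delta> \<le> 1" "\<And>x. 0 < x \<Longrightarrow> x < \<delta> \<Longrightarrow> cmod (?p x) \<le> \<epsilon> * x ^ k"
      by (rule vanishes_at_0D[OF v \<epsilon>]) blast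
    have "cmod (?p x) \<le> \<epsilon>" if "0 < x" "x < \<delta>" for x
    proof -
      have "x ^ k \<le> 1" using that \<delta>(2) by (intro power_le_one) auto
      hence "\<epsilon> * x ^ k \<le> \<epsilon> * 1" using \<epsilon> by (intro mult_left_mono) auto
      thus ?thesis using \<delta>(3)[OF that] by simp
    qed
    hence "\<forall>\<^sub>F x in at_right 0. cmod (?p x) \<le> \<epsilon>"
      using \<delta>(1) by (intro eventually_at_rightI[of 0 \<delta>]) auto
    with lim have "cmod (d 0) \<le> \<epsilon>" by (rule tendsto_upperbound) simp
    thus ?thesis by simp
  qed
  hence "cmod (d 0) \<le> 0" by (rule field_le_epsilon)
  thus ?thesis by simp
qed

lemma vanishes_at_0_polynomial:
  fixes d :: "nat \<Rightarrow> complex"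
  assumes "vanishes_at_0 k (\<lambda>x. \<Sum>i<Suc k. d i * of_real x ^ i)" "i < Suc k"
  shows "d i = 0"
  using assms
proof (induction k arbitrary: d i)
  case 0
  have "i = 0" using "0.prems"(2) by simp
  thus ?case using vanishes_at_0_constant_term[OF "0.prems"(1)] by simp
next
  case (Suc k)
  have d0: "d 0 = 0" by (rule vanishes_at_0_constant_term[OF Suc.prems(1)])
  have shift: "(\<Sum>i<Suc (Suc k). d i * of_real x ^ i) = of_real x * (\<Sum>i<Suc k. d (Suc i) * complex_of_real x ^ i)" for x
    by (subst sum.lessThan_Suc_shift) (simp add: d0 sum_distrib_left distrib_left mult_ac)
  have v: "vanishes_at_0 k (\<lambda>x. \<Sum>i<Suc k. d (Suc i) * of_real x ^ i)"
    unfolding vanishes_at_0_def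
  proof (intro allI impI)
    fix \<epsilon> :: real assume \<epsilon>: "\<epsilon> > 0"
    obtain \<delta> where \<delta>: "\<delta> > 0"
      "\<And>x. 0 < x \<Longrightarrow> x < \<delta> \<Longrightarrow> cmod (\<Sum>i<Suc (Suc k). d i * of_real x ^ i) \<le> \<epsilon> * x ^ Suc k"
      by (rule vanishes_at_0D[OF Suc.prems(1) \<epsilon>]) blast
    show "\<exists>\<delta>>0. \<forall>x. 0 < x \<and> x < \<delta> \<longrightarrow> cmod (\<Sum>i<Suc k. d (Suc i) * complex_of_real x ^ i) \<le> \<epsilon> * x ^ k"
    proof (intro exI[of _ \<delta>] conjI allI impI \<delta>(1))
      fix x assume x: "0 < x \<and> x < \<delta>"
      hence "x * cmod (\<Sum>i<Suc k. d (Suc i) * complex_of_real x ^ i) \<le> x * (\<epsilon> * x ^ k)"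
        using \<delta>(2)[of x] unfolding shift norm_mult by (simp add: mult_ac)
      thus "cmod (\<Sum>i<Suc k. d (Suc i) * complex_of_real x ^ i) \<le> \<epsilon> * x ^ k"
        using x mult_le_cancel_left_pos by blast
    qed
  qed
  show ?case
  proof (cases i)
    case 0
    thus ?thesis using d0 by simp
  next
    case (Suc j)
    hence "j < Suc k" using Suc.prems(2) by simp
    with Suc.IH[OF v] Suc show ?thesis by simp
  qed
qed

lemma vanishes_at_0_rl_integral:
  assumes a: "a > 0" and F: "vanishes_at_0 p F"
  shows "vanishes_at_0 p (rl_integral a F)"
  unfolding vanishes_at_0_def
proof (intro allI impI)
  fix \<epsilon> :: real assume \<epsilon>: "\<epsilon> > 0"
  let ?G = "Gamma (a + real p + 1)"
  have G: "?G > 0" "Gamma a > 0" using a by (auto intro: Gamma_real_pos)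
  define \<eta> where "\<eta> = \<epsilon> * ?G / fact p"
  have \<eta>: "\<eta> > 0" using \<epsilon> G by (simp add: \<eta>_def)
  obtain \<delta> where \<delta>: "\<delta> > 0" "\<delta> \<le> 1" "\<And>x. 0 < x \<Longrightarrow> x < \<delta> \<Longrightarrow> cmod (F x) \<le> \<eta> * x ^ p"
    by (rule vanishes_at_0D[OF F \<eta>]) blast
  show "\<exists>\<delta>>0. \<forall>x. 0 < x \<and> x < \<delta> \<longrightarrow> cmod (rl_integral a F x) \<le> \<epsilon> * x ^ p"
  proof (intro exI[of _ \<delta>] conjI allI impI \<delta>(1))
    fix x assume x: "0 < x \<and> x < \<delta>"
    have I: "has_bochner_integral half_line (\<lambda>y. \<eta> * (rl_kernel a x y * y ^ p))
      (\<eta> * (fact p / ?G * x powr (a + real p)))"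
      using x a by (intro has_bochner_integral_mult_right has_bochner_integral_rl_kernel_power_half_line) auto
    have "cmod (rl_integral a F x) \<le> (\<integral>y. \<eta> * (rl_kernel a x y * y ^ p) \<partial>half_line)"
    proof (rule cmod_rl_integral_le)
      show "integrable half_line (\<lambda>y. \<eta> * (rl_kernel a x y * y ^ p))"
        using I by (simp only: has_bochner_integral_iff)
      fix y :: real assume y: "y > 0"
      show "cmod (rl_kernel a x y *\<^sub>R F y) \<le> \<eta> * (rl_kernel a x y * y ^ p)"
      proof (cases "y < x")
        case True
        hence "cmod (F y) \<le> \<eta> * y ^ p" using \<delta>(3)[of y] x y by auto
        hence "rl_kernel a x y * cmod (F y) \<le> rl_kernel a x y * (\<eta> * y ^ p)"
          by (intro mult_left_mono rl_kernel_nonneg a)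
        thus ?thesis using a by (simp add: rl_kernel_nonneg mult_ac)
      next
        case False
        thus ?thesis by (simp add: rl_kernel_def)
      qed
    qed
    also have "\<dots> = \<eta> * (fact p / ?G * x powr (a + real p))"
      using I by (simp only: has_bochner_integral_iff)
    also have "\<dots> = \<epsilon> * (x powr a * x ^ p)"
      using G x by (simp add: \<eta>_def powr_add powr_realpow)
    also have "\<dots> \<le> \<epsilon> * (1 * x ^ p)"
      using x \<delta>(2) a \<epsilon> by (intro mult_left_mono mult_right_mono powr_le1) auto
    finally show "cmod (rl_integral a F x) \<le> \<epsilon> * x ^ p" by simp
  qed
qed

lemma vanishes_at_0_iterated_integral:
  assumes F: "loc_integrable F"
  shows "vanishes_at_0 k (rl_integral (real (Suc k)) F)"
  unfolding vanishes_at_0_def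
proof (intro allI impI)
  fix \<epsilon> :: real assume \<epsilon>: "\<epsilon> > 0"
  let ?B = "\<lambda>x y. indicator {..<x} y * cmod (F y)"
  have int: "integrable half_line (?B x)" if "x > 0" for x
  proof -
    have "integrable half_line (\<lambda>y. norm (indicator {..<x} y *\<^sub>R F y))"
      using F that unfolding loc_integrable_half_line_iff by (intro integrable_norm) blast
    thus ?thesis by simp
  qed
  have meas: "(\<lambda>y. cmod (F y)) \<in> borel_measurable half_line"
    using loc_integrable_measurable[OF F] by measurable
  have "(\<lambda>n. \<integral>y. ?B (1 / real (Suc n)) y \<partial>half_line) \<longlonglongrightarrow> (\<integral>y. 0 \<partial>half_line)"
  proof (rule integral_dominated_convergence[where w = "?B 1"])
    show "?B (1 / real (Suc n)) \<in> borel_measurable half_line" for n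
      using int[of "1 / real (Suc n)"] by simp
    show "integrable half_line (?B 1)" by (rule int) simp
    show "AE y in half_line. (\<lambda>n. ?B (1 / real (Suc n)) y) \<longlonglongrightarrow> 0"
    proof (rule AE_half_lineI)
      fix y :: real assume "y > 0"
      then obtain N where N: "1 / real (Suc N) < y" using nat_approx_posE by blast
      have "\<forall>\<^sub>F n in sequentially. ?B (1 / real (Suc n)) y = 0"
      proof (intro eventually_sequentiallyI)
        fix n assume "N \<le> n"
        hence "1 / real (Suc n) \<le> 1 / real (Suc N)" by (intro divide_left_mono) auto
        hence "1 / real (Suc n) \<le> y" using N by linarith
        thus "?B (1 / real (Suc n)) y = 0" by simp
      qed
      thus "(\<lambda>n. ?B (1 / real (Suc n)) y) \<longlonglongrightarrow> 0" by (rule tendsto_eventually)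
    qed
    show "AE y in half_line. norm (?B (1 / real (Suc n)) y) \<le> ?B 1 y" for n
    proof (rule AE_half_lineI)
      fix y :: real
      have "1 / real (Suc n) \<le> 1" by simp
      hence "y < 1" if "y < 1 / real (Suc n)" using that by linarith
      thus "norm (?B (1 / real (Suc n)) y) \<le> ?B 1 y" by (auto simp: indicator_def)
    qed
  qed simp
  hence "\<forall>\<^sub>F n in sequentially. (\<integral>y. ?B (1 / real (Suc n)) y \<partial>half_line) < \<epsilon> * fact k"
    using \<epsilon> by (intro order_tendstoD(2)) auto
  then obtain n where n: "(\<integral>y. ?B (1 / real (Suc n)) y \<partial>half_line) < \<epsilon> * fact k"
    unfolding eventually_sequentially by blast
  let ?\<delta> = "1 / real (Suc n)"
  show "\<exists>\<delta>>0. \<forall>x. 0 < x \<and> x < \<delta> \<longrightarrow> cmod (rl_integral (real (Suc k)) F x) \<le> \<epsilon> * x ^ k"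
  proof (intro exI[of _ ?\<delta>] conjI allI impI)
    fix x assume x: "0 < x \<and> x < ?\<delta>"
    have G: "Gamma (real (Suc k)) = fact k" using Gamma_fact[of k, where 'a = real] by (simp add: add_ac)
    have "cmod (rl_integral (real (Suc k)) F x) \<le> (\<integral>y. x ^ k / fact k * ?B ?\<delta> y \<partial>half_line)"
    proof (rule cmod_rl_integral_le)
      show "integrable half_line (\<lambda>y. x ^ k / fact k * ?B ?\<delta> y)"
        by (intro integrable_mult_right int) simp
      fix y :: real assume "y > 0"
      have "rl_kernel (real (Suc k)) x y \<le> x powr (real (Suc k) - 1) / Gamma (real (Suc k)) * indicator {0<..<x} y"
        by (rule rl_kernel_le_indicator) simp
      also have "x powr (real (Suc k) - 1) = x ^ k" using x by (simp add: powr_realpow)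
      also have "x ^ k / Gamma (real (Suc k)) * indicator {0<..<x} y \<le> x ^ k / fact k * indicator {..<?\<delta>} y"
        unfolding G using x by (intro mult_left_mono) (auto simp: indicator_def)
      finally have "rl_kernel (real (Suc k)) x y * cmod (F y) \<le> (x ^ k / fact k * indicator {..<?\<delta>} y) * cmod (F y)"
        by (intro mult_right_mono) auto
      thus "cmod (rl_kernel (real (Suc k)) x y *\<^sub>R F y) \<le> x ^ k / fact k * ?B ?\<delta> y"
        by (simp add: rl_kernel_nonneg mult.assoc)
    qed
    also have "\<dots> = x ^ k / fact k * (\<integral>y. ?B ?\<delta> y \<partial>half_line)" by (rule integral_mult_right_zero)
    also have "\<dots> \<le> x ^ k / fact k * (\<epsilon> * fact k)" using n x by (intro mult_left_mono) auto
    also have "\<dots> = \<epsilon> * x ^ k" by simp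
    finally show "cmod (rl_integral (real (Suc k)) F x) \<le> \<epsilon> * x ^ k" .
  qed simp
qed

text \<open>Integrating a little-o bound by the mean value inequality.\<close>

lemma vanishes_at_0_mean_value:
  assumes "vanishes_at_0 p V'" "V 0 = (0::complex)" "continuous (at 0 within {0..}) V"
    and deriv: "\<And>x. x > 0 \<Longrightarrow> (V has_vector_derivative V' x) (at x)"
  shows "vanishes_at_0 (Suc p) V"
  unfolding vanishes_at_0_def
proof (intro allI impI)
  fix \<epsilon> :: real assume \<epsilon>: "\<epsilon> > 0"
  obtain \<delta> where \<delta>: "\<delta> > 0" "\<And>x. 0 < x \<Longrightarrow> x < \<delta> \<Longrightarrow> cmod (V' x) \<le> \<epsilon> * x ^ p"
    by (rule vanishes_at_0D[OF assms(1) \<epsilon>]) blast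
  show "\<exists>\<delta>>0. \<forall>x. 0 < x \<and> x < \<delta> \<longrightarrow> cmod (V x) \<le> \<epsilon> * x ^ Suc p"
  proof (intro exI[of _ \<delta>] conjI allI impI \<delta>(1))
    fix x assume x: "0 < x \<and> x < \<delta>"
    have cont: "continuous_on {0..x} V"
      unfolding continuous_on_eq_continuous_within
    proof
      fix y assume y: "y \<in> {0..x}"
      show "continuous (at y within {0..x}) V"
      proof (cases "y = 0")
        case True
        thus ?thesis using assms(3) by (auto intro: continuous_within_subset)
      next
        case False
        hence "isCont V y" using y deriv[of y] by (intro has_vector_derivative_continuous) auto
        thus ?thesis by (rule continuous_at_imp_continuous_at_within)
      qed
    qed
    have "\<exists>y\<in>{0<..<x}. norm (V x - V 0) \<le> norm ((\<lambda>t. t *\<^sub>R V' y) (x - 0))"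
      using x cont deriv by (intro mvt_general) (auto simp: has_vector_derivative_def)
    then obtain y where y: "0 < y" "y < x" "cmod (V x - V 0) \<le> norm ((x - 0) *\<^sub>R V' y)" by auto
    have "cmod (V x) \<le> x * cmod (V' y)" using y(3) x assms(2) by simp
    also have "\<dots> \<le> x * (\<epsilon> * y ^ p)" using \<delta>(2)[of y] y x by (intro mult_left_mono) auto
    also have "\<dots> \<le> x * (\<epsilon> * x ^ p)" using y x \<epsilon> by (intro mult_left_mono power_mono) auto
    finally show "cmod (V x) \<le> \<epsilon> * x ^ Suc p" by (simp add: mult_ac)
  qed
qed

text \<open>The derivative of order \<open>p\<close> exists only at \<open>0\<close>: its definition gives the bound for the derivative of order
  \<open>p - 1\<close>, and the mean value inequality gives the bounds for the lower ones.\<close>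

lemma zero_initial_derivs_vanishes:
  assumes "zero_initial_derivs (Suc p) u"
  shows "vanishes_at_0 p u"
proof -
  obtain U where U: "U 0 = u" "\<And>j. j < Suc p \<Longrightarrow> U j 0 = 0"
    "\<And>j. Suc j < Suc p \<Longrightarrow> (U j has_vector_derivative U (Suc j) 0) (at 0 within {0..})"
    "\<And>j x. Suc (Suc j) < Suc p \<Longrightarrow> 0 < x \<Longrightarrow> (U j has_vector_derivative U (Suc j) x) (at x)"
    and cont: "continuous (at 0 within {0..}) u"
    using assms unfolding zero_initial_derivs_def by blast
  show ?thesis
  proof (cases p)
    case 0
    have u0: "u 0 = 0" using U(1) U(2)[of 0] by simp
    show ?thesis unfolding vanishes_at_0_def
    proof (intro allI impI)
      fix \<epsilon> :: real assume "\<epsilon> > 0"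
      then obtain \<delta> where \<delta>: "\<delta> > 0" "\<forall>x\<in>{0..}. dist x 0 < \<delta> \<longrightarrow> dist (u x) (u 0) < \<epsilon>"
        using cont unfolding continuous_within_eps_delta by blast
      thus "\<exists>\<delta>>0. \<forall>x. 0 < x \<and> x < \<delta> \<longrightarrow> cmod (u x) \<le> \<epsilon> * x ^ p"
        using u0 0 by (intro exI[of _ \<delta>]) (auto simp: less_imp_le)
    qed
  next
    case (Suc q)
    have "vanishes_at_0 (Suc n) (U (q - n))" if "n \<le> q" for n
      using that
    proof (induction n)
      case 0
      have "(U q has_derivative (\<lambda>t. t *\<^sub>R U (Suc q) 0)) (at 0 within {0..})"
        using U(3)[of q] Suc by (simp add: has_vector_derivative_def)
      hence *: "\<forall>\<epsilon>>0. \<exists>\<delta>>0. \<forall>y\<in>{0..}. norm (y - 0) < \<delta> \<longrightarrow>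
          norm (U q y - U q 0 - (y - 0) *\<^sub>R U (Suc q) 0) \<le> \<epsilon> * norm (y - 0)"
        unfolding has_derivative_within_alt by blast
      have z: "U q 0 = 0" "U (Suc q) 0 = 0" using U(2) Suc by auto
      show ?case unfolding vanishes_at_0_def
      proof (intro allI impI)
        fix \<epsilon> :: real assume "\<epsilon> > 0"
        then obtain \<delta> where \<delta>: "\<delta> > 0" "\<forall>y\<in>{0..}. norm (y - 0) < \<delta> \<longrightarrow>
          norm (U q y - U q 0 - (y - 0) *\<^sub>R U (Suc q) 0) \<le> \<epsilon> * norm (y - 0)"
          using * by blast
        thus "\<exists>\<delta>>0. \<forall>x. 0 < x \<and> x < \<delta> \<longrightarrow> cmod (U (q - 0) x) \<le> \<epsilon> * x ^ Suc 0"
          using z by (intro exI[of _ \<delta>]) auto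
      qed
    next
      case (Suc n)
      define j where "j = q - Suc n"
      have j: "Suc j = q - n" "Suc (Suc j) < Suc p" using Suc.prems \<open>p = Suc q\<close> by (auto simp: j_def)
      show ?case unfolding j_def[symmetric]
      proof (rule vanishes_at_0_mean_value)
        show "vanishes_at_0 (Suc n) (U (Suc j))" using Suc j by simp
        show "U j 0 = 0" using U(2) j by simp
        show "continuous (at 0 within {0..}) (U j)"
          using U(3)[of j] j by (intro has_vector_derivative_continuous) auto
        show "(U j has_vector_derivative U (Suc j) x) (at x)" if "x > 0" for x
          using U(4)[of j x] j that by simp
      qed
    qed
    from this[of q] show ?thesis using U(1) Suc by simp
  qed
qed

lemma nat_floor_add:
  assumes "1 \<le> k" "real k - 1 \<le> s" "s < real k"
  shows "nat \<lfloor>s + real m\<rfloor> + 1 = k + m"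
proof -
  have "\<lfloor>s + real m\<rfloor> = int k - 1 + int m"
    using assms by (intro floor_unique) auto
  thus ?thesis using assms(1) by simp
qed

text \<open>A literal solution is given by the integral formula: the Taylor polynomial of \<open>I\<^bsup>k-s\<^esup> (e\<^bsup>\<lambda>x\<^esup> u)\<close> at \<open>0\<close> has degree
  less than \<open>k\<close>, whereas the initial conditions make \<open>u\<close>, hence \<open>I\<^bsup>k-s\<^esup> (e\<^bsup>\<lambda>x\<^esup> u)\<close>, equal to
  \<open>o(x\<^bsup>k-1\<^esup>)\<close>, as is the remainder term. So the Taylor polynomial is zero, and \<open>I\<^bsup>k-s\<^esup>\<close> can be cancelled by
  applying \<open>I\<^sup>s\<close> and differentiating \<open>k\<close> times.\<close>

lemma solves_tempered_ivp_integral_formula: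
  assumes k: "1 \<le> k" "real k - 1 \<le> s" "s < real k" and lam: "0 < lam"
    and F: "loc_integrable (\<lambda>t. exp (lam * t) *\<^sub>R f t)"
    and sol: "solves_tempered_ivp k s lam f u"
  shows "AE x in half_line. u x = tempered_integral s lam f x"
proof -
  define F where "F t = exp (lam * t) *\<^sub>R f t" for t
  define U where "U t = exp (lam * t) *\<^sub>R u t" for t
  have locF: "loc_integrable F" using F by (simp add: F_def[abs_def])
  obtain p where p: "k = Suc p" using k(1) by (cases k) auto
  have ks: "real k - s > 0" using k(3) by simp
  have fl: "nat \<lfloor>s\<rfloor> + 1 = k" using nat_floor_add[OF k, of 0] by simp
  obtain h where h: "has_rl_deriv s U h" "f = (\<lambda>x. exp (- lam * x) *\<^sub>R h x)"
    using sol unfolding solves_tempered_ivp_def has_tempered_deriv_def U_def by blast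
  have hF: "h = F"
  proof
    fix x
    have "exp (lam * x) * exp (- lam * x) = 1" by (simp flip: exp_add)
    thus "h x = F x" unfolding F_def h(2) by simp
  qed
  have locU: "loc_integrable U" and ac: "ac_deriv (Suc p) (rl_integral (real k - s) U) F"
    using h(1) unfolding has_rl_deriv_def Let_def fl hF p loc_integrable_def by auto
  obtain d where d: "\<forall>x>0. rl_integral (real k - s) U x =
      (\<Sum>i<Suc p. d i * of_real x ^ i) + rl_integral (real (Suc p)) F x"
    using ac_deriv_taylor[OF locF ac] by (rule exE)
  have vu: "vanishes_at_0 p u"
    using sol unfolding solves_tempered_ivp_def p by (intro zero_initial_derivs_vanishes) simp
  have vU: "vanishes_at_0 p U"
    unfolding vanishes_at_0_def
  proof (intro allI impI)
    fix \<epsilon> :: real assume \<epsilon>: "\<epsilon> > 0"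
    hence e: "\<epsilon> / exp lam > 0" by simp
    obtain \<delta> where \<delta>: "\<delta> > 0" "\<delta> \<le> 1" "\<And>x. 0 < x \<Longrightarrow> x < \<delta> \<Longrightarrow> cmod (u x) \<le> \<epsilon> / exp lam * x ^ p"
      by (rule vanishes_at_0D[OF vu e]) blast
    show "\<exists>\<delta>>0. \<forall>x. 0 < x \<and> x < \<delta> \<longrightarrow> cmod (U x) \<le> \<epsilon> * x ^ p"
    proof (intro exI[of _ \<delta>] conjI allI impI \<delta>(1))
      fix x assume x: "0 < x \<and> x < \<delta>"
      have "cmod (U x) = exp (lam * x) * cmod (u x)" by (simp add: U_def)
      also have "\<dots> \<le> exp lam * (\<epsilon> / exp lam * x ^ p)"
        using x \<delta>(2) \<delta>(3)[of x] lam by (intro mult_mono) auto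
      finally show "cmod (U x) \<le> \<epsilon> * x ^ p" by simp
    qed
  qed
  have "vanishes_at_0 p (\<lambda>x. rl_integral (real k - s) U x - rl_integral (real (Suc p)) F x)"
    by (intro vanishes_at_0_diff vanishes_at_0_rl_integral[OF ks vU] vanishes_at_0_iterated_integral locF)
  hence "vanishes_at_0 p (\<lambda>x. \<Sum>i<Suc p. d i * of_real x ^ i)"
    by (rule vanishes_at_0_cong) (simp add: d)
  hence "d i = 0" if "i < Suc p" for i using that by (rule vanishes_at_0_polynomial)
  hence eq: "rl_integral (real k - s) U x = rl_integral (real k) F x" if "x > 0" for x
    using d[rule_format, OF that] by (simp add: p)
  have "AE x in half_line. U x = (if s = 0 then F x else rl_integral s F x)"
  proof (cases "s = 0")
    case True
    have "k = 1" using k True by simp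
    hence "rl_integral 1 U x = rl_integral 1 F x" if "x > 0" for x using eq[OF that] True by simp
    from ac_step_unique[OF ac_step_rl_integral_one[OF locU] ac_step_rl_integral_one[OF locF] this]
    show ?thesis using True by simp
  next
    case False
    hence s: "s > 0" using k by simp
    have "AE x in half_line. U x = rl_integral s F x"
    proof (rule ac_deriv_unique)
      show "ac_deriv (Suc p) (rl_integral (real (Suc p)) U) U"
        by (rule ac_deriv_rl_integral[OF locU])
      show "ac_deriv (Suc p) (rl_integral (real (Suc p)) (rl_integral s F)) (rl_integral s F)"
        by (rule ac_deriv_rl_integral[OF loc_integrable_rl_integral[OF s locF]])
      show "AE x in half_line. rl_integral (real (Suc p)) U x = rl_integral (real (Suc p)) (rl_integral s F) x"
      proof (rule AE_half_lineI)
        fix x :: real assume x: "x > 0"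
        have "rl_integral (real (Suc p)) U x = rl_integral s (rl_integral (real k - s) U) x"
          using rl_integral_rl_integral[OF s ks _ x locU] by (simp add: p)
        also have "\<dots> = rl_integral s (rl_integral (real k) F) x" by (rule rl_integral_cong_pos[OF eq])
        also have "\<dots> = rl_integral (s + real k) F x"
          using s k(1) by (intro rl_integral_rl_integral locF x) auto
        also have "\<dots> = rl_integral (real k) (rl_integral s F) x"
          using rl_integral_rl_integral[OF _ s _ x locF, of "real k"] s k(1) by (simp add: add.commute)
        finally show "rl_integral (real (Suc p)) U x = rl_integral (real (Suc p)) (rl_integral s F) x"
          by (simp only: p)
      qed
    qed
    thus ?thesis using False by simp
  qed
  thus ?thesis
  proof eventually_elim
    case (elim x)
    have "exp (- lam * x) * exp (lam * x) = 1" by (simp flip: exp_add)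
    hence "u x = exp (- lam * x) *\<^sub>R U x" "f x = exp (- lam * x) *\<^sub>R F x"
      by (simp_all add: U_def F_def)
    thus ?case using elim unfolding tempered_integral_def F_def[abs_def, symmetric]
      by (auto split: if_splits)
  qed
qed

text \<open>The composition \<open>I\<^bsup>k-s\<^esup> I\<^sup>s = I\<^sup>k\<close>, covering \<open>s = 0\<close> as well.\<close>

lemma tempered_integral_rl:
  assumes k: "1 \<le> k" "real k - 1 \<le> s" "s < real k"
    and F: "loc_integrable (\<lambda>t. exp (lam * t) *\<^sub>R f t)"
    and u: "AE x in half_line. u x = tempered_integral s lam f x"
  shows "loc_integrable (\<lambda>t. exp (lam * t) *\<^sub>R u t)"
    and "x > 0 \<Longrightarrow> rl_integral (real k - s) (\<lambda>t. exp (lam * t) *\<^sub>R u t) x =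
      rl_integral (real k) (\<lambda>t. exp (lam * t) *\<^sub>R f t) x"
proof -
  define F where "F t = exp (lam * t) *\<^sub>R f t" for t
  define U where "U t = exp (lam * t) *\<^sub>R u t" for t
  define R where "R = (if s = 0 then F else rl_integral s F)"
  have locF: "loc_integrable F" using F by (simp add: F_def[abs_def])
  have s: "s \<ge> 0" using k by simp
  have locR: "loc_integrable R"
    using s loc_integrable_rl_integral[OF _ locF, of s] by (auto simp: R_def locF)
  have RU: "AE x in half_line. R x = U x"
    using u
  proof eventually_elim
    case (elim x)
    have "exp (lam * x) * exp (- lam * x) = 1" by (simp flip: exp_add)
    thus ?case using elim by (simp add: tempered_integral_def R_def U_def F_def[abs_def])
  qed
  have measU: "U \<in> borel_measurable half_line"
    by (rule half_line_measurable_AE[OF loc_integrable_measurable[OF locR] RU])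
  have locU: "loc_integrable U" by (rule loc_integrable_cong_AE[OF locR measU RU])
  thus "loc_integrable (\<lambda>t. exp (lam * t) *\<^sub>R u t)" by (simp add: U_def[abs_def])
  assume x: "x > 0"
  have "rl_integral (real k - s) U x = rl_integral (real k - s) R x"
    by (rule rl_integral_cong_AE[OF loc_integrable_measurable[OF locR] measU RU, symmetric])
  also have "\<dots> = rl_integral (real k) F x"
    using rl_integral_rl_integral[OF _ _ _ x locF, of "real k - s" s] k s by (auto simp: R_def)
  finally show "rl_integral (real k - s) (\<lambda>t. exp (lam * t) *\<^sub>R u t) x =
      rl_integral (real k) (\<lambda>t. exp (lam * t) *\<^sub>R f t) x"
    by (simp only: U_def[abs_def] F_def[abs_def])
qed

section \<open>Integration by parts against Laguerre weights\<close>

text \<open>The product rule for an absolutely continuous and a smooth function, obtained from Fubini's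
  theorem on the triangle \<open>a \<le> t \<le> x \<le> c\<close>.\<close>

lemma ac_integration_by_parts:
  fixes \<rho> \<rho>' :: "real \<Rightarrow> real"
  assumes step: "ac_step \<Phi> \<Psi>" and ac: "0 < a" "a \<le> c"
    and \<rho>: "\<And>x. x \<in> {a..c} \<Longrightarrow> (\<rho> has_real_derivative \<rho>' x) (at x)"
    and cont': "continuous_on {a..c} \<rho>'"
  shows "(LINT x:{a..c}|lebesgue. \<rho> x *\<^sub>R \<Psi> x) =
    \<rho> c *\<^sub>R \<Phi> c - \<rho> a *\<^sub>R \<Phi> a - (LINT x:{a..c}|lebesgue. \<rho>' x *\<^sub>R \<Phi> x)"
proof -
  obtain \<Psi>0 where \<Psi>0[measurable]: "\<Psi>0 \<in> borel_measurable borel" and eq: "AE x in half_line. \<Psi> x = \<Psi>0 x"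
    using half_line_borel_representative[OF ac_step_measurable[OF step]] by blast
  have step0: "ac_step \<Phi> \<Psi>0"
    by (rule ac_step_cong_AE[OF step borel_measurable_lebesgue_onI[OF \<Psi>0] eq])
  have cont\<rho>: "continuous_on {a..c} \<rho>"
    using \<rho> by (intro continuous_at_imp_continuous_on ballI DERIV_isCont)
  have cont\<Phi>: "continuous_on {a..c} \<Phi>"
    using ac by (intro continuous_on_subset[OF ac_step_continuous[OF step]]) auto
  define r where "r x = indicator {a..c} x *\<^sub>R \<rho>' x" for x
  have r[measurable]: "r \<in> borel_measurable borel"
    unfolding r_def[abs_def] by (rule borel_measurable_continuous_on_indicator[OF _ cont']) simp
  obtain M where M: "\<And>x. x \<in> {a..c} \<Longrightarrow> norm (\<rho>' x) \<le> M"
    using compact_imp_bounded[OF compact_continuous_image[OF cont' compact_Icc]]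
    unfolding bounded_iff by blast
  \<comment> \<open>The triangle \<open>a \<le> t \<le> x\<close>; the restriction \<open>x \<le> c\<close> is contained in \<open>r\<close>.\<close>
  define f where "f t x = (if a \<le> t \<and> t \<le> x then r x else 0) *\<^sub>R \<Psi>0 t" for t x
  have I0: "integrable lborel (\<lambda>t. indicator {a..x} t *\<^sub>R \<Psi>0 t)" if "a \<le> x" for x
  proof -
    have L: "integrable lebesgue (\<lambda>t. indicator {a..x} t *\<^sub>R \<Psi>0 t)"
      using ac_stepD(1)[OF step0 ac(1) that] by (simp add: set_integrable_def)
    have m: "(\<lambda>t. indicator {a..x} t *\<^sub>R \<Psi>0 t) \<in> borel_measurable lborel" by measurable
    show ?thesis by (rule integrable_completion[OF m, THEN iffD1, OF L])
  qed
  have I0_eq: "(\<integral>t. indicator {a..x} t *\<^sub>R \<Psi>0 t \<partial>lborel) = \<Phi> x - \<Phi> a" if "a \<le> x" for x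
  proof -
    have "(\<integral>t. indicator {a..x} t *\<^sub>R \<Psi>0 t \<partial>lebesgue) = (\<integral>t. indicator {a..x} t *\<^sub>R \<Psi>0 t \<partial>lborel)"
      by (rule integral_completion) measurable
    thus ?thesis
      using ac_stepD(2)[OF step0 ac(1) that] by (simp add: set_lebesgue_integral_def)
  qed
  have meas: "case_prod f \<in> borel_measurable (lborel \<Otimes>\<^sub>M lborel)"
    unfolding f_def by measurable
  have bound: "norm (f t x) \<le> norm (indicator {a..c} t *\<^sub>R \<Psi>0 t) * (\<bar>M\<bar> * indicator {a..c} x)" for t x
  proof (cases "a \<le> t \<and> t \<le> x \<and> x \<le> c")
    case True
    hence "norm (\<rho>' x) \<le> \<bar>M\<bar>" using M[of x] by auto
    thus ?thesis using True by (auto simp: f_def r_def mult.commute intro!: mult_right_mono)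
  next
    case False
    hence "f t x = 0" by (auto simp: f_def r_def)
    thus ?thesis by simp
  qed
  have "integrable (lborel \<Otimes>\<^sub>M lborel) (case_prod f)"
  proof (rule integrableI_bounded[OF meas])
    have "(\<integral>\<^sup>+z. ennreal (norm (case_prod f z)) \<partial>(lborel \<Otimes>\<^sub>M lborel)) =
        (\<integral>\<^sup>+x. \<integral>\<^sup>+t. ennreal (norm (f t x)) \<partial>lborel \<partial>lborel)"
      using meas by (subst lborel_pair.nn_integral_snd[symmetric]) auto
    also have "\<dots> \<le> (\<integral>\<^sup>+x. \<integral>\<^sup>+t. ennreal (norm (indicator {a..c} t *\<^sub>R \<Psi>0 t)) *
        ennreal (\<bar>M\<bar> * indicator {a..c} x) \<partial>lborel \<partial>lborel)"
      by (intro nn_integral_mono) (simp only: ennreal_mult[symmetric] norm_ge_zero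
          ennreal_leI[OF bound] mult_nonneg_nonneg abs_ge_zero indicator_pos_le)
    also have "\<dots> = (\<integral>\<^sup>+x. (\<integral>\<^sup>+t. ennreal (norm (indicator {a..c} t *\<^sub>R \<Psi>0 t)) \<partial>lborel) *
        ennreal (\<bar>M\<bar> * indicator {a..c} x) \<partial>lborel)"
      by (intro nn_integral_cong nn_integral_multc) measurable
    also have "\<dots> = (\<integral>\<^sup>+t. ennreal (norm (indicator {a..c} t *\<^sub>R \<Psi>0 t)) \<partial>lborel) *
        (\<integral>\<^sup>+x. ennreal (\<bar>M\<bar> * indicator {a..c} x) \<partial>lborel)"
      by (intro nn_integral_cmult) measurable
    also have "\<dots> < \<infinity>"
    proof -
      have "integrable lborel (\<lambda>x. \<bar>M\<bar> * indicator {a..c} x)"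
        using ac by (intro integrable_mult_right integrable_real_indicator) auto
      hence "(\<integral>\<^sup>+x. ennreal (norm (\<bar>M\<bar> * indicator {a..c} x)) \<partial>lborel) < \<infinity>"
        by (simp only: integrable_iff_bounded)
      moreover have "norm (\<bar>M\<bar> * indicator {a..c} x) = \<bar>M\<bar> * indicator {a..c} x" for x :: real
        by (simp add: abs_mult)
      ultimately have "(\<integral>\<^sup>+x. ennreal (\<bar>M\<bar> * indicator {a..c} x) \<partial>lborel) < \<infinity>"
        by (simp only:)
      moreover have "(\<integral>\<^sup>+t. ennreal (norm (indicator {a..c} t *\<^sub>R \<Psi>0 t)) \<partial>lborel) < \<infinity>"
        using I0[OF ac(2)] by (simp only: integrable_iff_bounded)
      ultimately show ?thesis by (simp only: ennreal_mult_less_top infinity_ennreal_def) blast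
    qed
    finally show "(\<integral>\<^sup>+z. ennreal (norm (case_prod f z)) \<partial>(lborel \<Otimes>\<^sub>M lborel)) < \<infinity>" .
  qed
  hence fub: "(\<integral>x. (\<integral>t. f t x \<partial>lborel) \<partial>lborel) = (\<integral>t. (\<integral>x. f t x \<partial>lborel) \<partial>lborel)"
    by (rule lborel_pair.Fubini_integral)
  have inner_t: "(\<integral>t. f t x \<partial>lborel) = r x *\<^sub>R (\<Phi> x - \<Phi> a)" for x
  proof (cases "x \<in> {a..c}")
    case True
    have "(\<lambda>t. f t x) = (\<lambda>t. r x *\<^sub>R (indicator {a..x} t *\<^sub>R \<Psi>0 t))"
      by (auto simp: f_def indicator_def)
    hence "(\<integral>t. f t x \<partial>lborel) = r x *\<^sub>R (\<integral>t. indicator {a..x} t *\<^sub>R \<Psi>0 t \<partial>lborel)"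
      by (simp only: integral_scaleR_right)
    thus ?thesis using True I0_eq[of x] by simp
  next
    case False
    hence "r x = 0" by (auto simp: r_def)
    hence "(\<lambda>t. f t x) = (\<lambda>t. 0)" by (auto simp: f_def)
    thus ?thesis using \<open>r x = 0\<close> by simp
  qed
  have inner_x: "(\<integral>x. f t x \<partial>lborel) = indicator {a..c} t *\<^sub>R ((\<rho> c - \<rho> t) *\<^sub>R \<Psi>0 t)" for t
  proof (cases "t \<in> {a..c}")
    case True
    have "(\<rho>' has_integral (\<rho> c - \<rho> t)) {t..c}"
      using True \<rho> by (intro fundamental_theorem_of_calculus)
        (auto simp: has_real_derivative_iff_has_vector_derivative[symmetric] intro: has_field_derivative_at_within)
    moreover have "set_integrable lborel {t..c} \<rho>'"
      unfolding set_integrable_def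
      using True by (intro borel_integrable_compact continuous_on_subset[OF cont']) auto
    ultimately have "has_bochner_integral lborel (\<lambda>x. indicator {t..c} x *\<^sub>R \<rho>' x) (\<rho> c - \<rho> t)"
      using set_borel_integral_eq_integral[of "{t..c}" \<rho>']
      by (simp add: has_bochner_integral_iff set_integrable_def set_lebesgue_integral_def integral_unique)
    hence "has_bochner_integral lborel (\<lambda>x. (indicator {t..c} x *\<^sub>R \<rho>' x) *\<^sub>R \<Psi>0 t) ((\<rho> c - \<rho> t) *\<^sub>R \<Psi>0 t)"
      by (rule has_bochner_integral_scaleR_left)
    also have "(\<lambda>x. (indicator {t..c} x *\<^sub>R \<rho>' x) *\<^sub>R \<Psi>0 t) = f t"
      using True by (auto simp: f_def r_def indicator_def)
    finally show ?thesis using True by (simp add: has_bochner_integral_iff)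
  next
    case False
    hence "f t x = 0" for x by (auto simp: f_def r_def)
    thus ?thesis using False by simp
  qed
  have iL: "set_integrable lebesgue {a..c} (\<lambda>x. \<rho>' x *\<^sub>R \<Phi> x)" "set_integrable lebesgue {a..c} (\<lambda>x. \<rho>' x *\<^sub>R \<Phi> a)"
    "set_integrable lebesgue {a..c} (\<lambda>x. \<rho>' x)"
    by (intro absolutely_integrable_continuous_real continuous_intros cont' cont\<Phi>)+
  have "(\<integral>x. r x *\<^sub>R (\<Phi> x - \<Phi> a) \<partial>lborel) =
      (LINT x:{a..c}|lebesgue. \<rho>' x *\<^sub>R \<Phi> x) - (\<rho> c - \<rho> a) *\<^sub>R \<Phi> a"
  proof -
    have m: "(\<lambda>x. indicator {a..c} x *\<^sub>R (\<rho>' x *\<^sub>R (\<Phi> x - \<Phi> a))) \<in> borel_measurable borel"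
      by (intro borel_measurable_continuous_on_indicator continuous_intros cont' cont\<Phi>) simp
    have "(\<integral>x. r x *\<^sub>R (\<Phi> x - \<Phi> a) \<partial>lborel) = (\<integral>x. indicator {a..c} x *\<^sub>R (\<rho>' x *\<^sub>R (\<Phi> x - \<Phi> a)) \<partial>lborel)"
      by (simp add: r_def)
    also have "\<dots> = (LINT x:{a..c}|lebesgue. \<rho>' x *\<^sub>R \<Phi> x - \<rho>' x *\<^sub>R \<Phi> a)"
      unfolding set_lebesgue_integral_def scaleR_diff_right[symmetric]
      by (rule integral_completion[symmetric]) (use m in simp)
    also have "\<dots> = (LINT x:{a..c}|lebesgue. \<rho>' x *\<^sub>R \<Phi> x) - (LINT x:{a..c}|lebesgue. \<rho>' x *\<^sub>R \<Phi> a)"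
      by (rule set_integral_diff[OF iL(1,2)])
    also have "(LINT x:{a..c}|lebesgue. \<rho>' x *\<^sub>R \<Phi> a) = (LINT x:{a..c}|lebesgue. \<rho>' x) *\<^sub>R \<Phi> a"
    proof -
      have "(\<lambda>x. indicator {a..c} x *\<^sub>R (\<rho>' x *\<^sub>R \<Phi> a)) =
          (\<lambda>x. (indicator {a..c} x *\<^sub>R \<rho>' x) *\<^sub>R \<Phi> a)" by (simp add: fun_eq_iff)
      moreover have "(\<integral>x. (indicator {a..c} x *\<^sub>R \<rho>' x) *\<^sub>R \<Phi> a \<partial>lebesgue) =
          (\<integral>x. indicator {a..c} x *\<^sub>R \<rho>' x \<partial>lebesgue) *\<^sub>R \<Phi> a"
        using iL(3) unfolding set_integrable_def by (intro integral_scaleR_left)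
      ultimately show ?thesis by (simp only: set_lebesgue_integral_def)
    qed
    also have "(LINT x:{a..c}|lebesgue. \<rho>' x) = \<rho> c - \<rho> a"
    proof -
      have "(\<rho>' has_integral (\<rho> c - \<rho> a)) {a..c}"
        using ac \<rho> by (intro fundamental_theorem_of_calculus)
          (auto simp: has_real_derivative_iff_has_vector_derivative[symmetric] intro: has_field_derivative_at_within)
      thus ?thesis using set_lebesgue_integral_eq_integral(2)[OF iL(3)] by (simp add: integral_unique)
    qed
    finally show ?thesis .
  qed
  moreover have "(\<integral>t. indicator {a..c} t *\<^sub>R ((\<rho> c - \<rho> t) *\<^sub>R \<Psi>0 t) \<partial>lborel) =
      \<rho> c *\<^sub>R (\<Phi> c - \<Phi> a) - (LINT x:{a..c}|lebesgue. \<rho> x *\<^sub>R \<Psi> x)"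
  proof -
    have ic: "integrable lborel (\<lambda>t. \<rho> c *\<^sub>R (indicator {a..c} t *\<^sub>R \<Psi>0 t))"
      by (intro integrable_scaleR_right I0 ac)
    obtain K where K: "\<And>x. x \<in> {a..c} \<Longrightarrow> norm (\<rho> x) \<le> K"
      using compact_imp_bounded[OF compact_continuous_image[OF cont\<rho> compact_Icc]]
      unfolding bounded_iff by blast
    have mrho: "(\<lambda>t. (indicator {a..c} t *\<^sub>R \<rho> t) *\<^sub>R \<Psi>0 t) \<in> borel_measurable lborel"
    proof -
      have "(\<lambda>t. indicator {a..c} t *\<^sub>R \<rho> t) \<in> borel_measurable borel"
        by (rule borel_measurable_continuous_on_indicator[OF _ cont\<rho>]) simp
      thus ?thesis by measurable
    qed
    have ir: "integrable lborel (\<lambda>t. (indicator {a..c} t *\<^sub>R \<rho> t) *\<^sub>R \<Psi>0 t)"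
    proof (rule Bochner_Integration.integrable_bound[OF _ mrho])
      show "integrable lborel (\<lambda>t. K *\<^sub>R (indicator {a..c} t *\<^sub>R \<Psi>0 t))"
        by (intro integrable_scaleR_right I0 ac)
      show "AE t in lborel. norm ((indicator {a..c} t *\<^sub>R \<rho> t) *\<^sub>R \<Psi>0 t) \<le>
          norm (K *\<^sub>R (indicator {a..c} t *\<^sub>R \<Psi>0 t))"
      proof (rule AE_I2)
        fix t
        show "norm ((indicator {a..c} t *\<^sub>R \<rho> t) *\<^sub>R \<Psi>0 t) \<le> norm (K *\<^sub>R (indicator {a..c} t *\<^sub>R \<Psi>0 t))"
        proof (cases "t \<in> {a..c}")
          case True
          hence "\<bar>\<rho> t\<bar> \<le> \<bar>K\<bar>" using K[OF True] by simp
          thus ?thesis using True by (simp add: mult_right_mono)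
        qed simp
      qed
    qed
    have "(\<integral>t. indicator {a..c} t *\<^sub>R ((\<rho> c - \<rho> t) *\<^sub>R \<Psi>0 t) \<partial>lborel) =
      (\<integral>t. \<rho> c *\<^sub>R (indicator {a..c} t *\<^sub>R \<Psi>0 t) - (indicator {a..c} t *\<^sub>R \<rho> t) *\<^sub>R \<Psi>0 t \<partial>lborel)"
      by (intro Bochner_Integration.integral_cong refl) (simp add: indicator_def scaleR_diff_left)
    also have "\<dots> = \<rho> c *\<^sub>R (\<Phi> c - \<Phi> a) - (\<integral>t. (indicator {a..c} t *\<^sub>R \<rho> t) *\<^sub>R \<Psi>0 t \<partial>lborel)"
      using I0_eq[OF ac(2)] by (simp only: Bochner_Integration.integral_diff[OF ic ir] integral_scaleR_right)
    also have "(\<integral>t. (indicator {a..c} t *\<^sub>R \<rho> t) *\<^sub>R \<Psi>0 t \<partial>lborel) =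
        (\<integral>t. (indicator {a..c} t *\<^sub>R \<rho> t) *\<^sub>R \<Psi>0 t \<partial>lebesgue)"
      by (rule integral_completion[OF mrho, symmetric])
    also have "\<dots> = (\<integral>t. indicator {a..c} t *\<^sub>R (\<rho> t *\<^sub>R \<Psi> t) \<partial>lebesgue)"
    proof (rule integral_cong_AE)
      show E: "AE t in lebesgue. (indicator {a..c} t *\<^sub>R \<rho> t) *\<^sub>R \<Psi>0 t = indicator {a..c} t *\<^sub>R (\<rho> t *\<^sub>R \<Psi> t)"
        using AE_half_line_imp_Icc[OF eq ac(1), of c] by eventually_elim (auto simp: indicator_def)
      show m0: "(\<lambda>t. (indicator {a..c} t *\<^sub>R \<rho> t) *\<^sub>R \<Psi>0 t) \<in> borel_measurable lebesgue"
        using measurable_completion[OF mrho] .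
      show "(\<lambda>t. indicator {a..c} t *\<^sub>R (\<rho> t *\<^sub>R \<Psi> t)) \<in> borel_measurable lebesgue"
        by (rule borel_measurable_AE[OF m0 E])
    qed
    finally show ?thesis by (simp only: set_lebesgue_integral_def)
  qed
  ultimately have "(LINT x:{a..c}|lebesgue. \<rho>' x *\<^sub>R \<Phi> x) - (\<rho> c - \<rho> a) *\<^sub>R \<Phi> a =
      \<rho> c *\<^sub>R (\<Phi> c - \<Phi> a) - (LINT x:{a..c}|lebesgue. \<rho> x *\<^sub>R \<Psi> x)"
    using fub unfolding inner_t inner_x by simp
  thus ?thesis by (simp add: algebra_simps)
qed

lemma integral_half_line_limit:
  fixes h :: "real \<Rightarrow> complex"
  assumes "integrable half_line h"
  shows "(\<lambda>n. LINT x:{1 / real (Suc n)..real (Suc n)}|lebesgue. h x) \<longlonglongrightarrow> integral\<^sup>L half_line h"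
proof -
  let ?S = "\<lambda>n. {1 / real (Suc n)..real (Suc n)}"
  have eq: "(LINT x:?S n|lebesgue. h x) = (\<integral>x. indicator (?S n) x *\<^sub>R h x \<partial>half_line)" for n
  proof -
    have "0 < 1 / real (Suc n)" by simp
    from less_le_trans[OF this] have pos: "x > 0" if "x \<in> ?S n" for x
      using that unfolding atLeastAtMost_iff by blast
    have "(\<integral>x. indicator (?S n) x *\<^sub>R h x \<partial>half_line) =
        (\<integral>x. indicator {0<..} x *\<^sub>R (indicator (?S n) x *\<^sub>R h x) \<partial>lebesgue)"
      by (subst integral_restrict_space) auto
    also have "\<dots> = (LINT x:?S n|lebesgue. h x)"
      unfolding set_lebesgue_integral_def
    proof (intro Bochner_Integration.integral_cong refl)
      fix x
      show "indicator {0<..} x *\<^sub>R (indicator (?S n) x *\<^sub>R h x) = indicator (?S n) x *\<^sub>R h x"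
        using pos[of x] by (cases "x \<in> ?S n") auto
    qed
    finally show ?thesis by simp
  qed
  show ?thesis unfolding eq
  proof (rule integral_dominated_convergence)
    show "integrable half_line (\<lambda>x. norm (h x))" using assms by (rule integrable_norm)
    show "h \<in> borel_measurable half_line" using assms by simp
    show "(\<lambda>x. indicator (?S n) x *\<^sub>R h x) \<in> borel_measurable half_line" for n
    proof -
      have "(indicator (?S n) :: real \<Rightarrow> real) \<in> borel_measurable half_line"
        by (intro borel_measurable_lebesgue_onI borel_measurable_indicator) simp
      thus ?thesis using assms by measurable
    qed
    show "AE x in half_line. norm (indicator (?S n) x *\<^sub>R h x) \<le> norm (h x)" for n
      by (intro AE_I2) (simp add: indicator_def)
    show "AE x in half_line. (\<lambda>n. indicator (?S n) x *\<^sub>R h x) \<longlonglongrightarrow> h x"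
    proof (rule AE_half_lineI)
      fix x :: real assume x: "x > 0"
      obtain N where N: "max x (1 / x) < real N" using reals_Archimedean2 by blast
      have "\<forall>\<^sub>F n in sequentially. indicator (?S n) x *\<^sub>R h x = h x"
      proof (intro eventually_sequentiallyI)
        fix n assume "N \<le> n"
        hence n: "real N \<le> real (Suc n)" by simp
        have "x \<le> real (Suc n)" "1 / x \<le> real (Suc n)" using N n by auto
        hence "x \<in> ?S n" using x by (auto simp: field_simps)
        thus "indicator (?S n) x *\<^sub>R h x = h x" by simp
      qed
      thus "(\<lambda>n. indicator (?S n) x *\<^sub>R h x) \<longlonglongrightarrow> h x" by (rule tendsto_eventually)
    qed
  qed
qed

lemma half_line_integration_by_parts:
  fixes \<rho> \<rho>' :: "real \<Rightarrow> real"
  assumes step: "ac_step \<Phi> \<Psi>"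
    and \<rho>: "\<And>x. x > 0 \<Longrightarrow> (\<rho> has_real_derivative \<rho>' x) (at x)"
    and cont': "continuous_on {0<..} \<rho>'"
    and int: "integrable half_line (\<lambda>x. \<rho> x *\<^sub>R \<Psi> x)" "integrable half_line (\<lambda>x. \<rho>' x *\<^sub>R \<Phi> x)"
    and lim0: "((\<lambda>x. \<rho> x *\<^sub>R \<Phi> x) \<longlongrightarrow> 0) (at_right 0)" and limtop: "((\<lambda>x. \<rho> x *\<^sub>R \<Phi> x) \<longlongrightarrow> 0) at_top"
  shows "(\<integral>x. \<rho> x *\<^sub>R \<Psi> x \<partial>half_line) = - (\<integral>x. \<rho>' x *\<^sub>R \<Phi> x \<partial>half_line)"
proof -
  let ?a = "\<lambda>n. 1 / real (Suc n)" and ?c = "\<lambda>n. real (Suc n)"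
  have parts: "(LINT x:{?a n..?c n}|lebesgue. \<rho> x *\<^sub>R \<Psi> x) =
      \<rho> (?c n) *\<^sub>R \<Phi> (?c n) - \<rho> (?a n) *\<^sub>R \<Phi> (?a n) - (LINT x:{?a n..?c n}|lebesgue. \<rho>' x *\<^sub>R \<Phi> x)" for n
  proof (rule ac_integration_by_parts[OF step])
    show "0 < ?a n" by simp
    have "1 / real (Suc n) \<le> 1" "1 \<le> real (Suc n)" by simp_all
    thus "?a n \<le> ?c n" by linarith
    show "(\<rho> has_real_derivative \<rho>' x) (at x)" if "x \<in> {?a n..?c n}" for x
      using less_le_trans[OF \<open>0 < ?a n\<close>, of x] that by (intro \<rho>) simp
    show "continuous_on {?a n..?c n} \<rho>'"
      using \<open>0 < ?a n\<close> by (intro continuous_on_subset[OF cont'] subsetI)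
        (simp only: atLeastAtMost_iff greaterThan_iff, rule less_le_trans[OF _ conjunct1])
  qed
  have "?a \<longlonglongrightarrow> 0" using LIMSEQ_Suc[OF lim_1_over_n[where 'a = real]] .
  hence "filterlim ?a (at_right 0) sequentially"
    unfolding filterlim_at by (simp del: of_nat_Suc)
  from filterlim_compose[OF lim0 this] have l0: "(\<lambda>n. \<rho> (?a n) *\<^sub>R \<Phi> (?a n)) \<longlonglongrightarrow> 0" .
  have "filterlim ?c at_top sequentially"
    by (rule filterlim_compose[OF filterlim_real_sequentially filterlim_Suc])
  from filterlim_compose[OF limtop this] have lt: "(\<lambda>n. \<rho> (?c n) *\<^sub>R \<Phi> (?c n)) \<longlonglongrightarrow> 0" .
  have "(\<lambda>n. LINT x:{?a n..?c n}|lebesgue. \<rho> x *\<^sub>R \<Psi> x) \<longlonglongrightarrow> 0 - 0 - (\<integral>x. \<rho>' x *\<^sub>R \<Phi> x \<partial>half_line)"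
    unfolding parts by (intro tendsto_diff l0 lt integral_half_line_limit int)
  from LIMSEQ_unique[OF integral_half_line_limit[OF int(1)] this] show ?thesis by simp
qed

text \<open>A pointwise bound that survives integration: it passes from a derivative to the function itself,
  losing one power of the singularity at \<open>0\<close> and nothing at infinity. The integrable part \<open>\<kappa>\<close> is needed for
  the highest derivative alone, about which only a weighted \<open>L\<^sup>2\<close> bound is known.\<close>

definition growth_bound :: "real \<Rightarrow> real \<Rightarrow> (real \<Rightarrow> complex) \<Rightarrow> bool" where
  "growth_bound lam q \<Psi> \<longleftrightarrow> (\<exists>\<kappa> C. integrable half_line \<kappa> \<and> (\<forall>y. 0 \<le> \<kappa> y) \<and> 0 \<le> C \<and>
     (AE y in half_line. cmod (\<Psi> y) \<le> exp (lam * y) * (\<kappa> y + C * (1 + y powr - q))))"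

lemma integrable_Icc_half_line:
  fixes \<kappa> :: "real \<Rightarrow> real"
  assumes \<kappa>: "integrable half_line \<kappa>" "\<And>y. 0 \<le> \<kappa> y" and a: "0 < a"
  shows "set_integrable lebesgue {a..c} \<kappa>" "(LINT y:{a..c}|lebesgue. \<kappa> y) \<le> integral\<^sup>L half_line \<kappa>"
proof -
  have I: "integrable lebesgue (\<lambda>y. indicator {0<..} y *\<^sub>R \<kappa> y)"
    using \<kappa>(1) by (subst (asm) integrable_restrict_space) auto
  have "integrable lebesgue (\<lambda>y. indicator {a..c} y *\<^sub>R (indicator {0<..} y *\<^sub>R \<kappa> y))"
    by (rule integrable_mult_indicator[OF _ I]) simp
  also have "(\<lambda>y. indicator {a..c} y *\<^sub>R (indicator {0<..} y *\<^sub>R \<kappa> y)) = (\<lambda>y. indicator {a..c} y *\<^sub>R \<kappa> y)"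
    using a by (auto simp: indicator_def fun_eq_iff)
  finally show S: "set_integrable lebesgue {a..c} \<kappa>" by (simp only: set_integrable_def)
  have "(LINT y:{a..c}|lebesgue. \<kappa> y) \<le> (\<integral>y. indicator {0<..} y *\<^sub>R \<kappa> y \<partial>lebesgue)"
    unfolding set_lebesgue_integral_def
    using S I \<kappa>(2) a by (intro integral_mono) (auto simp: set_integrable_def indicator_def)
  also have "\<dots> = integral\<^sup>L half_line \<kappa>" by (subst integral_restrict_space) auto
  finally show "(LINT y:{a..c}|lebesgue. \<kappa> y) \<le> integral\<^sup>L half_line \<kappa>" .
qed

lemma set_integral_Icc_deriv:
  fixes G g :: "real \<Rightarrow> real"
  assumes "a \<le> c" "\<And>x. x \<in> {a..c} \<Longrightarrow> (G has_real_derivative g x) (at x)" "continuous_on {a..c} g"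
  shows "set_integrable lebesgue {a..c} g" "(LINT x:{a..c}|lebesgue. g x) = G c - G a"
proof -
  show I: "set_integrable lebesgue {a..c} g"
    using absolutely_integrable_continuous_real[OF assms(3)] .
  have "(g has_integral (G c - G a)) {a..c}"
    using assms(1,2) by (intro fundamental_theorem_of_calculus)
      (auto simp: has_real_derivative_iff_has_vector_derivative[symmetric] intro: has_field_derivative_at_within)
  thus "(LINT x:{a..c}|lebesgue. g x) = G c - G a"
    using set_lebesgue_integral_eq_integral(2)[OF I] by (simp add: integral_unique)
qed

lemma cmod_ac_step_diff_le:
  assumes step: "ac_step \<Phi> \<Psi>" and ac: "0 < a" "a \<le> c"
    and B: "set_integrable lebesgue {a..c} B" "AE y in half_line. y \<in> {a..c} \<longrightarrow> cmod (\<Psi> y) \<le> B y"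
  shows "cmod (\<Phi> c - \<Phi> a) \<le> (LINT y:{a..c}|lebesgue. B y)"
proof -
  have S: "set_integrable lebesgue {a..c} \<Psi>" by (rule ac_stepD(1)[OF step ac])
  have "cmod (\<Phi> c - \<Phi> a) \<le> (\<integral>y. norm (indicator {a..c} y *\<^sub>R \<Psi> y) \<partial>lebesgue)"
    unfolding ac_stepD(2)[OF step ac] set_lebesgue_integral_def by (rule integral_norm_bound)
  also have "\<dots> \<le> (\<integral>y. indicator {a..c} y *\<^sub>R B y \<partial>lebesgue)"
  proof (rule integral_mono_AE)
    show "integrable lebesgue (\<lambda>y. norm (indicator {a..c} y *\<^sub>R \<Psi> y))"
      using S unfolding set_integrable_def by (rule integrable_norm)
    show "integrable lebesgue (\<lambda>y. indicator {a..c} y *\<^sub>R B y)"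
      using B(1) unfolding set_integrable_def .
    show "AE y in lebesgue. norm (indicator {a..c} y *\<^sub>R \<Psi> y) \<le> indicator {a..c} y *\<^sub>R B y"
      using AE_half_line_imp_Icc[OF B(2) ac(1), of c] by eventually_elim (auto simp: indicator_def)
  qed
  finally show ?thesis by (simp only: set_lebesgue_integral_def)
qed

lemma growth_bound_integrate:
  assumes lam: "lam > 0" and q: "q > 0" and step: "ac_step \<Phi> \<Psi>" and gb: "growth_bound lam (q + 1) \<Psi>"
  obtains D where "D \<ge> 0" "\<And>x. x > 0 \<Longrightarrow> cmod (\<Phi> x) \<le> D * (exp (lam * x) * (1 + x powr - q))"
proof -
  obtain \<kappa> C where \<kappa>: "integrable half_line \<kappa>" "\<And>y. 0 \<le> \<kappa> y" and C: "0 \<le> C"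
    and bd: "AE y in half_line. cmod (\<Psi> y) \<le> exp (lam * y) * (\<kappa> y + C * (1 + y powr - (q + 1)))"
    using gb unfolding growth_bound_def by blast
  define K where "K = integral\<^sup>L half_line \<kappa>"
  have K: "K \<ge> 0" unfolding K_def using \<kappa>(2) by simp
  \<comment> \<open>\<open>D1\<close> bounds the change of \<open>\<Phi>\<close> beyond \<open>1\<close>, and \<open>D2\<close> the change below \<open>1\<close>.\<close>
  define D1 where "D1 = K + 2 * C / lam"
  define D2 where "D2 = exp lam * (K + 2 * C / q)"
  have D12: "D1 \<ge> 0" "D2 \<ge> 0" using K C lam q by (auto simp: D1_def D2_def)
  show ?thesis
  proof (rule that)
    show "0 \<le> cmod (\<Phi> 1) + D1 + D2" using D12 by simp
    fix x :: real assume x: "x > 0"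
    have E1: "1 \<le> exp (lam * x)" using x lam by simp
    have X0: "0 \<le> x powr - q" by simp
    have base: "1 \<le> exp (lam * x) * (1 + x powr - q)"
      using mult_mono[OF E1, of 1 "1 + x powr - q"] X0 by simp
    have "cmod (\<Phi> x - \<Phi> 1) \<le> (D1 + D2) * (exp (lam * x) * (1 + x powr - q))"
    proof (cases "x \<ge> 1")
      case True
      let ?B = "\<lambda>y. exp (lam * x) * \<kappa> y + 2 * C * exp (lam * y)"
      have s1: "set_integrable lebesgue {1..x} (\<lambda>y. exp (lam * x) * \<kappa> y)"
        using integrable_Icc_half_line(1)[OF \<kappa>, of 1 x] by simp
      have s2: "set_integrable lebesgue {1..x} (\<lambda>y. 2 * C * exp (lam * y))"
        by (intro absolutely_integrable_continuous_real continuous_intros)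
      have v2: "(LINT y:{1..x}|lebesgue. 2 * C * exp (lam * y)) =
          2 * C / lam * exp (lam * x) - 2 * C / lam * exp (lam * 1)"
        using True lam by (intro set_integral_Icc_deriv)
          (auto intro!: derivative_eq_intros continuous_intros)
      have "cmod (\<Phi> x - \<Phi> 1) \<le> (LINT y:{1..x}|lebesgue. ?B y)"
      proof (rule cmod_ac_step_diff_le[OF step _ True])
        show "set_integrable lebesgue {1..x} ?B" using s1 s2 by (rule set_integral_add(1))
        show "AE y in half_line. y \<in> {1..x} \<longrightarrow> cmod (\<Psi> y) \<le> ?B y"
          using bd
        proof eventually_elim
          case (elim y)
          show ?case
          proof
            assume y: "y \<in> {1..x}"
            have "y powr - (q + 1) \<le> y powr 0" using y q by (intro powr_mono) auto
            hence "y powr - (q + 1) \<le> 1" using y by simp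
            hence "C * (1 + y powr - (q + 1)) \<le> C * 2" using C by (intro mult_left_mono) auto
            hence "exp (lam * y) * (C * (1 + y powr - (q + 1))) \<le> exp (lam * y) * (C * 2)"
              by (rule mult_left_mono) simp
            moreover have "exp (lam * y) * (C * 2) = 2 * C * exp (lam * y)" by simp
            moreover have "cmod (\<Psi> y) \<le> exp (lam * y) * \<kappa> y + exp (lam * y) * (C * (1 + y powr - (q + 1)))"
              using elim unfolding distrib_left[of "exp (lam * y)" "\<kappa> y"] .
            moreover have "exp (lam * y) * \<kappa> y \<le> exp (lam * x) * \<kappa> y"
              using y lam \<kappa>(2) by (intro mult_right_mono) auto
            ultimately show "cmod (\<Psi> y) \<le> ?B y" by linarith
          qed
        qed
      qed simp
      also have "\<dots> = exp (lam * x) * (LINT y:{1..x}|lebesgue. \<kappa> y) +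
          (2 * C / lam * exp (lam * x) - 2 * C / lam * exp (lam * 1))"
        unfolding set_integral_add(2)[OF s1 s2] v2 by simp
      also have "\<dots> \<le> exp (lam * x) * K + 2 * C / lam * exp (lam * x)"
        using integrable_Icc_half_line(2)[OF \<kappa>, of 1 x] C lam unfolding K_def
        by (intro add_mono mult_left_mono) auto
      also have "\<dots> = D1 * exp (lam * x)" by (simp add: D1_def algebra_simps)
      also have "\<dots> \<le> (D1 + D2) * (exp (lam * x) * (1 + x powr - q))"
        using D12 X0 by (intro mult_mono) auto
      finally show ?thesis .
    next
      case False
      hence x1: "x \<le> 1" by simp
      let ?B = "\<lambda>y. exp lam * \<kappa> y + exp lam * (2 * C) * y powr - (q + 1)"
      have s1: "set_integrable lebesgue {x..1} (\<lambda>y. exp lam * \<kappa> y)"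
        using integrable_Icc_half_line(1)[OF \<kappa> x, of 1] by simp
      have dv: "((\<lambda>y. - (exp lam * (2 * C) / q) * y powr - q) has_real_derivative
          exp lam * (2 * C) * y powr - (q + 1)) (at y)" if "y \<in> {x..1}" for y
      proof -
        have "y > 0" using that x by simp
        have "((\<lambda>y. y powr - q) has_real_derivative - q * y powr (- q - 1)) (at y)"
          using has_real_derivative_powr[OF \<open>y > 0\<close>, of "- q"] by simp
        from DERIV_cmult[OF this, of "- (exp lam * (2 * C) / q)"] show ?thesis
          using q by (simp add: mult.assoc)
      qed
      have ct: "continuous_on {x..1} (\<lambda>y. exp lam * (2 * C) * y powr - (q + 1))"
        using x by (intro continuous_intros) auto
      note s2 = set_integral_Icc_deriv[OF x1 dv ct]
      have "cmod (\<Phi> 1 - \<Phi> x) \<le> (LINT y:{x..1}|lebesgue. ?B y)"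
      proof (rule cmod_ac_step_diff_le[OF step x x1])
        show "set_integrable lebesgue {x..1} ?B" using s1 s2(1) by (rule set_integral_add(1))
        show "AE y in half_line. y \<in> {x..1} \<longrightarrow> cmod (\<Psi> y) \<le> ?B y"
          using bd
        proof eventually_elim
          case (elim y)
          show ?case
          proof
            assume y: "y \<in> {x..1}"
            hence y0: "y > 0" using x by simp
            have "y powr 0 \<le> y powr - (q + 1)" using y y0 q by (intro powr_mono') auto
            hence "1 \<le> y powr - (q + 1)" using y0 by simp
            hence "\<kappa> y + C * (1 + y powr - (q + 1)) \<le> \<kappa> y + C * (2 * y powr - (q + 1))"
              using C by (intro add_mono mult_left_mono) auto
            hence "exp (lam * y) * (\<kappa> y + C * (1 + y powr - (q + 1))) \<le>
                exp lam * (\<kappa> y + C * (2 * y powr - (q + 1)))"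
              using y lam C \<kappa>(2)[of y] by (intro mult_mono) (auto intro!: add_nonneg_nonneg)
            thus "cmod (\<Psi> y) \<le> ?B y" using elim by (simp add: algebra_simps)
          qed
        qed
      qed
      also have "\<dots> = exp lam * (LINT y:{x..1}|lebesgue. \<kappa> y) +
          (- (exp lam * (2 * C) / q) * 1 powr - q - - (exp lam * (2 * C) / q) * x powr - q)"
      proof -
        have "(LINT y:{x..1}|lebesgue. ?B y) = (LINT y:{x..1}|lebesgue. exp lam * \<kappa> y) +
            (LINT y:{x..1}|lebesgue. exp lam * (2 * C) * y powr - (q + 1))"
          by (rule set_integral_add(2)[OF s1 s2(1)])
        moreover have "(LINT y:{x..1}|lebesgue. exp lam * (2 * C) * y powr - (q + 1)) =
            - (exp lam * (2 * C) / q) * 1 powr - q - - (exp lam * (2 * C) / q) * x powr - q"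
          by (rule s2(2))
        moreover have "(LINT y:{x..1}|lebesgue. exp lam * \<kappa> y) = exp lam * (LINT y:{x..1}|lebesgue. \<kappa> y)"
          by (rule set_integral_mult_right)
        ultimately show ?thesis by (simp only:)
      qed
      also have "\<dots> \<le> exp lam * K + exp lam * (2 * C) / q * x powr - q"
        using integrable_Icc_half_line(2)[OF \<kappa> x, of 1] C q unfolding K_def
        by (intro add_mono mult_left_mono) auto
      also have "\<dots> \<le> D2 * (1 + x powr - q)"
      proof -
        let ?E = "exp lam * (2 * C) / q"
        have "0 \<le> exp lam * K * x powr - q" "0 \<le> ?E" using K C q by auto
        moreover have "D2 = exp lam * K + ?E" by (simp add: D2_def distrib_left)
        hence "D2 * (1 + x powr - q) = exp lam * K + ?E + (exp lam * K * x powr - q + ?E * x powr - q)"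
          by (simp only: distrib_left distrib_right mult_1_right)
        ultimately show ?thesis by linarith
      qed
      also have "\<dots> \<le> (D1 + D2) * (exp (lam * x) * (1 + x powr - q))"
      proof (rule mult_mono)
        have "1 * (1 + x powr - q) \<le> exp (lam * x) * (1 + x powr - q)"
          by (rule mult_right_mono[OF E1]) (use X0 in linarith)
        thus "1 + x powr - q \<le> exp (lam * x) * (1 + x powr - q)" by simp
        show "0 \<le> 1 + x powr - q" using X0 by linarith
      qed (use D12 in auto)
      finally show ?thesis by (simp add: norm_minus_commute)
    qed
    moreover have "cmod (\<Phi> 1) * 1 \<le> cmod (\<Phi> 1) * (exp (lam * x) * (1 + x powr - q))"
      using base by (intro mult_left_mono) auto
    moreover have "cmod (\<Phi> x) \<le> cmod (\<Phi> 1) + cmod (\<Phi> x - \<Phi> 1)"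
      using norm_triangle_ineq[of "\<Phi> 1" "\<Phi> x - \<Phi> 1"] by simp
    ultimately show "cmod (\<Phi> x) \<le> (cmod (\<Phi> 1) + D1 + D2) * (exp (lam * x) * (1 + x powr - q))"
      by (simp add: distrib_right)
  qed
qed

text \<open>By Rodrigues' identity the derivative of the weight with indices \<open>l + 1, n\<close> is \<open>n + 1\<close> times the one
  with indices \<open>l, n + 1\<close>.\<close>

definition laguerre_weight :: "real \<Rightarrow> nat \<Rightarrow> nat \<Rightarrow> real \<Rightarrow> real" where
  "laguerre_weight b l n x = x ^ l * exp (- b * x) * poly (laguerre (real l) n) (b * x)"

lemma integrable_powr_exp_poly:
  fixes p :: "real poly"
  assumes "a > -1" "\<mu> > 0"
  shows "integrable half_line (\<lambda>x. x powr a * exp (- \<mu> * x) * poly p (b * x))"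
proof -
  have "integrable half_line (\<lambda>x. \<Sum>k\<le>degree p. (coeff p k * b ^ k) * (x powr a * exp (- \<mu> * x) * x ^ k))"
    using has_bochner_integral_gamma_power[OF assms]
    by (intro Bochner_Integration.integrable_sum integrable_mult_right) (auto simp: has_bochner_integral_iff)
  also have "(\<lambda>x. \<Sum>k\<le>degree p. (coeff p k * b ^ k) * (x powr a * exp (- \<mu> * x) * x ^ k)) =
      (\<lambda>x. x powr a * exp (- \<mu> * x) * poly p (b * x))"
    by (simp add: poly_altdef sum_distrib_left power_mult_distrib mult_ac)
  finally show ?thesis .
qed

lemma tendsto_exp_poly_at_top:
  fixes p :: "real poly"
  assumes \<mu>: "\<mu> > 0"
  shows "((\<lambda>x. exp (- \<mu> * x) * poly p x) \<longlongrightarrow> 0) at_top"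
proof -
  have mono: "((\<lambda>x. exp (- \<mu> * x) * x ^ k) \<longlongrightarrow> 0) at_top" for k
  proof -
    have "filterlim (\<lambda>x. \<mu> * x) at_top at_top"
      by (rule filterlim_tendsto_pos_mult_at_top[OF tendsto_const \<mu> filterlim_ident])
    from filterlim_compose[OF tendsto_power_div_exp_0 this]
    have "((\<lambda>x. (1 / \<mu> ^ k) * ((\<mu> * x) ^ k / exp (\<mu> * x))) \<longlongrightarrow> (1 / \<mu> ^ k) * 0) at_top"
      by (intro tendsto_mult tendsto_const)
    thus ?thesis using \<mu> by (simp add: power_mult_distrib exp_minus field_simps)
  qed
  have "((\<lambda>x. \<Sum>k\<le>degree p. coeff p k * (exp (- \<mu> * x) * x ^ k)) \<longlongrightarrow> (\<Sum>k\<le>degree p. coeff p k * 0)) at_top"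
    by (intro tendsto_sum tendsto_mult tendsto_const mono)
  thus ?thesis by (simp add: poly_altdef sum_distrib_left mult_ac)
qed

text \<open>One integration by parts. The bound on \<open>\<Phi>\<close> is just good enough: against the weight of index \<open>l\<close> it leaves an
  integrable singularity \<open>x\<^bsup>-1/2\<^esup>\<close>, and against the weight of index \<open>l + 1\<close>, in the boundary terms, a factor
  \<open>x\<^bsup>1/2\<^esup>\<close>; at infinity, \<open>e\<^bsup>-2\<lambda>x\<^esup>\<close> beats \<open>e\<^bsup>\<lambda>x\<^esup>\<close>.\<close>

lemma laguerre_weight_step:
  assumes lam: "lam > 0" and step: "ac_step \<Phi> \<Psi>"
    and D: "D \<ge> 0" "\<And>x. x > 0 \<Longrightarrow> cmod (\<Phi> x) \<le> D * (exp (lam * x) * (1 + x powr - (real l + 1 / 2)))"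
    and int\<Psi>: "integrable half_line (\<lambda>x. laguerre_weight (2 * lam) (Suc l) n x *\<^sub>R \<Psi> x)"
    and meas: "\<Phi> \<in> borel_measurable half_line"
  shows "\<And>n. integrable half_line (\<lambda>x. laguerre_weight (2 * lam) l n x *\<^sub>R \<Phi> x)"
    and "(\<integral>x. laguerre_weight (2 * lam) (Suc l) n x *\<^sub>R \<Psi> x \<partial>half_line) =
      - (real n + 1) *\<^sub>R (\<integral>x. laguerre_weight (2 * lam) l (Suc n) x *\<^sub>R \<Phi> x \<partial>half_line)"
proof -
  let ?b = "2 * lam"
  have exp_split: "exp (- ?b * x) * exp (lam * x) = exp (- lam * x)" for x
    by (simp flip: exp_add)
  have wbound: "norm (laguerre_weight ?b j n x *\<^sub>R \<Phi> x) \<le>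
      D * ((x ^ j + x powr (real j - real l - 1 / 2)) * exp (- lam * x) * \<bar>poly (laguerre (real j) n) (?b * x)\<bar>)"
    if x: "x > 0" for x j n
  proof -
    let ?P = "\<bar>poly (laguerre (real j) n) (?b * x)\<bar>"
    have pw: "x ^ j * x powr - (real l + 1 / 2) = x powr (real j - real l - 1 / 2)"
      using x by (simp add: powr_realpow[symmetric] powr_add[symmetric] algebra_simps)
    have "norm (laguerre_weight ?b j n x *\<^sub>R \<Phi> x) = (x ^ j * exp (- ?b * x) * ?P) * cmod (\<Phi> x)"
      using x by (simp add: laguerre_weight_def abs_mult)
    also have "\<dots> \<le> (x ^ j * exp (- ?b * x) * ?P) * (D * (exp (lam * x) * (1 + x powr - (real l + 1 / 2))))"
      using x by (intro mult_left_mono D(2)) auto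
    also have "\<dots> = D * ((x ^ j + x ^ j * x powr - (real l + 1 / 2)) * (exp (- ?b * x) * exp (lam * x)) * ?P)"
      by (simp add: algebra_simps)
    finally show ?thesis unfolding pw exp_split .
  qed
  show int\<Phi>: "integrable half_line (\<lambda>x. laguerre_weight ?b l n x *\<^sub>R \<Phi> x)" for n
  proof (rule Bochner_Integration.integrable_bound)
    show "integrable half_line (\<lambda>x. D * (\<bar>x powr real l * exp (- lam * x) * poly (laguerre (real l) n) (?b * x)\<bar> +
      \<bar>x powr (- 1 / 2) * exp (- lam * x) * poly (laguerre (real l) n) (?b * x)\<bar>))"
      using lam by (intro integrable_mult_right Bochner_Integration.integrable_add integrable_abs
          integrable_powr_exp_poly) auto
    have "laguerre_weight ?b l n \<in> borel_measurable half_line"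
      unfolding laguerre_weight_def[abs_def] by (intro borel_measurable_lebesgue_onI) measurable
    thus "(\<lambda>x. laguerre_weight ?b l n x *\<^sub>R \<Phi> x) \<in> borel_measurable half_line" using meas by measurable
    show "AE x in half_line. norm (laguerre_weight ?b l n x *\<^sub>R \<Phi> x) \<le>
      norm (D * (\<bar>x powr real l * exp (- lam * x) * poly (laguerre (real l) n) (?b * x)\<bar> +
      \<bar>x powr (- 1 / 2) * exp (- lam * x) * poly (laguerre (real l) n) (?b * x)\<bar>))"
    proof (rule AE_half_lineI)
      fix x :: real assume x: "x > 0"
      have "D * (\<bar>x powr real l * exp (- lam * x) * poly (laguerre (real l) n) (?b * x)\<bar> +
        \<bar>x powr (- 1 / 2) * exp (- lam * x) * poly (laguerre (real l) n) (?b * x)\<bar>) =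
        D * ((x ^ l + x powr (real l - real l - 1 / 2)) * exp (- lam * x) * \<bar>poly (laguerre (real l) n) (?b * x)\<bar>)"
        using x by (simp add: abs_mult powr_realpow algebra_simps)
      with wbound[OF x, of l n] show "norm (laguerre_weight ?b l n x *\<^sub>R \<Phi> x) \<le>
        norm (D * (\<bar>x powr real l * exp (- lam * x) * poly (laguerre (real l) n) (?b * x)\<bar> +
        \<bar>x powr (- 1 / 2) * exp (- lam * x) * poly (laguerre (real l) n) (?b * x)\<bar>))"
        by (metis abs_ge_self order_trans real_norm_def)
    qed
  qed
  have wb1: "norm (laguerre_weight ?b (Suc l) n x *\<^sub>R \<Phi> x) \<le>
      D * ((x ^ Suc l + x powr (1 / 2)) * exp (- lam * x) * \<bar>poly (laguerre (real (Suc l)) n) (?b * x)\<bar>)"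
    if "x > 0" for x
    using wbound[OF that, of "Suc l" n] by simp
  have deriv: "(laguerre_weight ?b (Suc l) n has_real_derivative
      (real n + 1) * laguerre_weight ?b l (Suc n) x) (at x)" if "x > 0" for x
    unfolding laguerre_weight_def[abs_def] by (rule has_real_derivative_laguerre_weight[OF that])
  have "(\<integral>x. laguerre_weight ?b (Suc l) n x *\<^sub>R \<Psi> x \<partial>half_line) =
      - (\<integral>x. ((real n + 1) * laguerre_weight ?b l (Suc n) x) *\<^sub>R \<Phi> x \<partial>half_line)"
  proof (rule half_line_integration_by_parts[OF step deriv])
    show "continuous_on {0<..} (\<lambda>x. (real n + 1) * laguerre_weight ?b l (Suc n) x)"
      unfolding laguerre_weight_def by (intro continuous_intros)
    show "integrable half_line (\<lambda>x. laguerre_weight ?b (Suc l) n x *\<^sub>R \<Psi> x)" by (rule int\<Psi>)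
    show "integrable half_line (\<lambda>x. ((real n + 1) * laguerre_weight ?b l (Suc n) x) *\<^sub>R \<Phi> x)"
      unfolding scaleR_scaleR[symmetric] by (intro integrable_scaleR_right int\<Phi>)
    let ?q = "laguerre (real (Suc l)) n"
    show "((\<lambda>x. laguerre_weight ?b (Suc l) n x *\<^sub>R \<Phi> x) \<longlongrightarrow> 0) (at_right 0)"
    proof (rule tendsto_norm_zero_cancel, rule tendsto_sandwich[OF _ _ tendsto_const])
      show "\<forall>\<^sub>F x in at_right 0. norm (laguerre_weight ?b (Suc l) n x *\<^sub>R \<Phi> x) \<le>
        D * ((x ^ Suc l + x powr (1 / 2)) * exp (- lam * x) * \<bar>poly ?q (?b * x)\<bar>)"
        by (intro eventually_at_rightI[of 0 1] wb1) auto
      have "((\<lambda>x. D * ((x ^ Suc l + x powr (1 / 2)) * exp (- lam * x) * \<bar>poly ?q (?b * x)\<bar>)) \<longlongrightarrow>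
        D * ((0 ^ Suc l + 0 powr (1 / 2)) * exp (- lam * 0) * \<bar>poly ?q (?b * 0)\<bar>)) (at_right 0)"
        by (intro tendsto_intros tendsto_powr'[OF tendsto_ident_at])
           (auto simp: eventually_at_filter intro!: always_eventually)
      thus "((\<lambda>x. D * ((x ^ Suc l + x powr (1 / 2)) * exp (- lam * x) * \<bar>poly ?q (?b * x)\<bar>)) \<longlongrightarrow> 0) (at_right 0)"
        by simp
    qed (simp add: always_eventually)
    show "((\<lambda>x. laguerre_weight ?b (Suc l) n x *\<^sub>R \<Phi> x) \<longlongrightarrow> 0) at_top"
    proof (rule tendsto_norm_zero_cancel, rule tendsto_sandwich[OF _ _ tendsto_const])
      let ?r = "[:0, 1:] ^ Suc l * (?q \<circ>\<^sub>p [:0, ?b:])"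
      have r: "poly ?r x = x ^ Suc l * poly ?q (?b * x)" for x by (simp add: poly_pcompose mult_ac)
      show "\<forall>\<^sub>F x in at_top. norm (laguerre_weight ?b (Suc l) n x *\<^sub>R \<Phi> x) \<le>
        2 * D * \<bar>exp (- lam * x) * poly ?r x\<bar>"
      proof (rule eventually_at_top_linorderI[of 1])
        fix x :: real assume x: "x \<ge> 1"
        have "x powr (1 / 2) \<le> x powr real (Suc l)" using x by (intro powr_mono) auto
        also have "\<dots> = x ^ Suc l" using x by (intro powr_realpow) simp
        finally have "x ^ Suc l + x powr (1 / 2) \<le> 2 * x ^ Suc l" by simp
        hence "D * ((x ^ Suc l + x powr (1 / 2)) * exp (- lam * x) * \<bar>poly ?q (?b * x)\<bar>) \<le>
          D * ((2 * x ^ Suc l) * exp (- lam * x) * \<bar>poly ?q (?b * x)\<bar>)"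
          using D(1) by (intro mult_left_mono mult_right_mono) auto
        also have "\<dots> = 2 * D * \<bar>exp (- lam * x) * poly ?r x\<bar>"
          unfolding r using x by (simp add: abs_mult)
        finally show "norm (laguerre_weight ?b (Suc l) n x *\<^sub>R \<Phi> x) \<le> 2 * D * \<bar>exp (- lam * x) * poly ?r x\<bar>"
          using wb1[of x] x by linarith
      qed
      show "((\<lambda>x. 2 * D * \<bar>exp (- lam * x) * poly ?r x\<bar>) \<longlongrightarrow> 0) at_top"
        using tendsto_mult[OF tendsto_const[of "2 * D"] tendsto_rabs_zero[OF tendsto_exp_poly_at_top[OF lam, of ?r]]]
        by (simp only: mult_zero_right)
    qed (simp add: always_eventually)
  qed
  also have "\<dots> = - (real n + 1) *\<^sub>R (\<integral>x. laguerre_weight ?b l (Suc n) x *\<^sub>R \<Phi> x \<partial>half_line)"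
    by (simp only: scaleR_scaleR[symmetric] integral_scaleR_right scaleR_minus_left)
  finally show "(\<integral>x. laguerre_weight ?b (Suc l) n x *\<^sub>R \<Psi> x \<partial>half_line) =
      - (real n + 1) *\<^sub>R (\<integral>x. laguerre_weight ?b l (Suc n) x *\<^sub>R \<Phi> x \<partial>half_line)" .
qed

lemma laguerre_fun_weight:
  fixes g :: "real \<Rightarrow> complex"
  assumes x: "x > 0"
  shows "of_real (x powr (real l / 2)) * g x * of_real (laguerre_fun (real l) (2 * lam) n x) =
    sqrt (fact n * (2 * lam) powr (real l + 1) / Gamma (real l + real n + 1)) *\<^sub>R
      (laguerre_weight (2 * lam) l n x *\<^sub>R (exp (lam * x) *\<^sub>R g x))"
proof -
  have p: "x powr (real l / 2) * x powr (real l / 2) = x ^ l"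
    using x by (simp add: powr_realpow flip: powr_add)
  have e: "exp (- (2 * lam) * x) * exp (lam * x) = exp (- (2 * lam / 2) * x)"
    by (simp flip: exp_add)
  let ?c = "sqrt (fact n * (2 * lam) powr (real l + 1) / Gamma (real l + real n + 1))"
  have "x powr (real l / 2) * laguerre_fun (real l) (2 * lam) n x =
      ?c * ((x powr (real l / 2) * x powr (real l / 2)) * exp (- (2 * lam / 2) * x) * poly (laguerre (real l) n) (2 * lam * x))"
    unfolding laguerre_fun_def by (simp only: mult_ac)
  also have "\<dots> = ?c * (laguerre_weight (2 * lam) l n x * exp (lam * x))"
    unfolding p laguerre_weight_def e[symmetric] by (simp only: mult_ac)
  finally have "complex_of_real (x powr (real l / 2) * laguerre_fun (real l) (2 * lam) n x) =
      of_real (?c * (laguerre_weight (2 * lam) l n x * exp (lam * x)))" by (simp only:)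
  thus ?thesis by (simp add: scaleR_conv_of_real mult_ac)
qed

lemma powr_neg_nat_le:
  fixes y :: real
  assumes "y > 0"
  shows "y powr - real l \<le> 1 + y powr - (real l + 1 / 2)"
proof (cases "y \<ge> 1")
  case True
  have "y powr - real l \<le> y powr 0" using True by (intro powr_mono) auto
  also have "\<dots> = 1" using assms by simp
  also have "\<dots> \<le> 1 + y powr - (real l + 1 / 2)" by simp
  finally show ?thesis .
next
  case False
  have "y powr - real l \<le> y powr - (real l + 1 / 2)"
    using False assms by (intro powr_mono') auto
  thus ?thesis by simp
qed

text \<open>Repeated integration by parts, descending from the \<open>m\<close>-th derivative \<open>G\<close> to \<open>\<Phi>\<close>. The growth
  bound of each intermediate derivative, inherited from the next higher one, annihilates the
  boundary terms.\<close>

lemma laguerre_weight_ac_deriv: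
  assumes lam: "lam > 0" and G: "G = (\<lambda>x. exp (lam * x) *\<^sub>R g x)" and g: "g \<in> borel_measurable half_line"
    and "ac_deriv m \<Phi> G" "\<Phi> \<in> borel_measurable half_line"
    and "square_integrable half_line (\<lambda>x. of_real (x powr (real (l + m) / 2)) * g x)"
  shows "growth_bound lam (real l + 1 / 2) \<Phi> \<and>
    (\<forall>n. integrable half_line (\<lambda>x. laguerre_weight (2 * lam) l n x *\<^sub>R \<Phi> x)) \<and>
    (\<forall>n. (\<integral>x. laguerre_weight (2 * lam) (l + m) n x *\<^sub>R G x \<partial>half_line) =
      ((-1) ^ m * (fact (n + m) / fact n)) *\<^sub>R (\<integral>x. laguerre_weight (2 * lam) l (n + m) x *\<^sub>R \<Phi> x \<partial>half_line))"
  using assms(4-6)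
proof (induction m arbitrary: l \<Phi>)
  case 0
  let ?sg = "\<lambda>x. of_real (x powr (real l / 2)) * g x"
  have sq: "square_integrable half_line ?sg" using "0.prems"(3) by simp
  have eq: "AE x in half_line. \<Phi> x = G x" using "0.prems"(1) by simp
  have mw: "laguerre_weight (2 * lam) l n \<in> borel_measurable half_line" for n
    unfolding laguerre_weight_def[abs_def] by (intro borel_measurable_lebesgue_onI) measurable
  have mG: "G \<in> borel_measurable half_line"
    by (rule half_line_measurable_AE[OF "0.prems"(2) eq])
  have gb: "growth_bound lam (real l + 1 / 2) \<Phi>"
    unfolding growth_bound_def
  proof (intro exI conjI)
    show "integrable half_line (\<lambda>x. (cmod (?sg x))\<^sup>2)" using sq by (rule square_integrableD)
    show "AE y in half_line. cmod (\<Phi> y) \<le> exp (lam * y) * ((cmod (?sg y))\<^sup>2 + 1 * (1 + y powr - (real l + 1 / 2)))"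
      using eq AE_half_line_pos
    proof eventually_elim
      case (elim y)
      have y: "y > 0" using elim(2) by simp
      have "cmod (g y) = 1 * (cmod (?sg y) * y powr - (real l / 2))"
        using y by (simp add: norm_mult powr_minus)
      also have "\<dots> \<le> 2 * (cmod (?sg y) * y powr - (real l / 2))"
        by (intro mult_right_mono) auto
      also have "\<dots> \<le> (cmod (?sg y))\<^sup>2 + (y powr - (real l / 2))\<^sup>2"
        by (rule two_mult_le_sum_squares)
      also have "(y powr - (real l / 2))\<^sup>2 = y powr - real l"
        by (simp add: power2_eq_square flip: powr_add)
      also have "(cmod (?sg y))\<^sup>2 + y powr - real l \<le> (cmod (?sg y))\<^sup>2 + 1 * (1 + y powr - (real l + 1 / 2))"
        using powr_neg_nat_le[OF y, of l] by simp
      finally have "exp (lam * y) * cmod (g y) \<le>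
          exp (lam * y) * ((cmod (?sg y))\<^sup>2 + 1 * (1 + y powr - (real l + 1 / 2)))"
        by (rule mult_left_mono) simp
      thus ?case using elim(1) by (simp add: G)
    qed
  qed auto
  have int: "integrable half_line (\<lambda>x. laguerre_weight (2 * lam) l n x *\<^sub>R \<Phi> x)" for n
  proof -
    let ?c = "sqrt (fact n * (2 * lam) powr (real l + 1) / Gamma (real l + real n + 1))"
    have "Gamma (real l + real n + 1) > 0" by (intro Gamma_real_pos) simp
    hence "fact n * (2 * lam) powr (real l + 1) / Gamma (real l + real n + 1) > 0"
      by (rule divide_pos_pos[rotated]) (use lam in simp)
    hence c: "?c \<noteq> 0" using real_sqrt_gt_zero less_imp_neq by metis
    interpret L: orthonormal_sequence half_line "laguerre_fun (real l) (2 * lam)"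
      using lam by (intro orthonormal_laguerre_fun) auto
    have "integrable half_line (\<lambda>x. (1 / ?c) *\<^sub>R (?sg x * of_real (laguerre_fun (real l) (2 * lam) n x)))"
      by (intro integrable_scaleR_right L.integrable_coef sq)
    thus ?thesis
    proof (rule integrable_cong_AE_imp)
      show "(\<lambda>x. laguerre_weight (2 * lam) l n x *\<^sub>R \<Phi> x) \<in> borel_measurable half_line"
        using mw "0.prems"(2) by measurable
      show "AE x in half_line. (1 / ?c) *\<^sub>R (?sg x * of_real (laguerre_fun (real l) (2 * lam) n x)) =
          laguerre_weight (2 * lam) l n x *\<^sub>R \<Phi> x"
        using eq AE_half_line_pos
      proof eventually_elim
        case (elim x)
        have "x > 0" using elim(2) by simp
        show ?case unfolding laguerre_fun_weight[OF \<open>x > 0\<close>] elim(1) G using c by simp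
      qed
    qed
  qed
  have "(\<integral>x. laguerre_weight (2 * lam) l n x *\<^sub>R G x \<partial>half_line) =
      (\<integral>x. laguerre_weight (2 * lam) l n x *\<^sub>R \<Phi> x \<partial>half_line)" for n
  proof (rule integral_cong_AE)
    show "(\<lambda>x. laguerre_weight (2 * lam) l n x *\<^sub>R \<Phi> x) \<in> borel_measurable half_line"
      "(\<lambda>x. laguerre_weight (2 * lam) l n x *\<^sub>R G x) \<in> borel_measurable half_line"
      using mw "0.prems"(2) mG by measurable
    show "AE x in half_line. laguerre_weight (2 * lam) l n x *\<^sub>R G x = laguerre_weight (2 * lam) l n x *\<^sub>R \<Phi> x"
      using eq by eventually_elim simp
  qed
  thus ?case using gb int by simp
next
  case (Suc m)
  from ac_deriv_Suc[THEN iffD1, OF Suc.prems(1)]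
  obtain \<Psi> where \<Psi>_both: "ac_step \<Phi> \<Psi> \<and> ac_deriv m \<Psi> G" by (rule exE)
  note \<Psi> = conjunct1[OF \<Psi>_both] conjunct2[OF \<Psi>_both]
  have idx: "Suc l + m = l + Suc m" by simp
  have "square_integrable half_line (\<lambda>x. of_real (x powr (real (Suc l + m) / 2)) * g x)"
    using Suc.prems(3) unfolding idx .
  note IH = Suc.IH[OF \<Psi>(2) ac_step_measurable[OF \<Psi>(1)] this]
  have "real (Suc l) + 1 / 2 = (real l + 1 / 2) + 1" by simp
  with conjunct1[OF IH] have gb: "growth_bound lam ((real l + 1 / 2) + 1) \<Psi>" by (simp only:)
  have q: "real l + 1 / 2 > 0" by simp
  obtain D where D: "D \<ge> 0"
      "\<And>x. x > 0 \<Longrightarrow> cmod (\<Phi> x) \<le> D * (exp (lam * x) * (1 + x powr - (real l + 1 / 2)))"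
    by (rule growth_bound_integrate[OF lam q \<Psi>(1) gb]) blast
  note step = laguerre_weight_step[OF lam \<Psi>(1) D conjunct1[OF conjunct2[OF IH], rule_format] Suc.prems(2)]
  have "growth_bound lam (real l + 1 / 2) \<Phi>"
    unfolding growth_bound_def
    by (intro exI[of _ "\<lambda>_. 0"] exI[of _ D] conjI AE_half_lineI)
       (use D in \<open>simp_all add: mult_ac\<close>)
  moreover have "integrable half_line (\<lambda>x. laguerre_weight (2 * lam) l n x *\<^sub>R \<Phi> x)" for n
    by (rule step(1))
  moreover have "(\<integral>x. laguerre_weight (2 * lam) (l + Suc m) n x *\<^sub>R G x \<partial>half_line) =
      ((-1) ^ Suc m * (fact (n + Suc m) / fact n)) *\<^sub>R
      (\<integral>x. laguerre_weight (2 * lam) l (n + Suc m) x *\<^sub>R \<Phi> x \<partial>half_line)" for n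
  proof -
    have "(\<integral>x. laguerre_weight (2 * lam) (l + Suc m) n x *\<^sub>R G x \<partial>half_line) =
        ((-1) ^ m * (fact (n + m) / fact n)) *\<^sub>R
        (\<integral>x. laguerre_weight (2 * lam) (Suc l) (n + m) x *\<^sub>R \<Psi> x \<partial>half_line)"
      using conjunct2[OF conjunct2[OF IH], rule_format, of n] unfolding idx .
    also have "\<dots> = ((-1) ^ m * (fact (n + m) / fact n) * (- (real (n + m) + 1))) *\<^sub>R
        (\<integral>x. laguerre_weight (2 * lam) l (n + Suc m) x *\<^sub>R \<Phi> x \<partial>half_line)"
    proof -
      have "(\<integral>x. laguerre_weight (2 * lam) (Suc l) (n + m) x *\<^sub>R \<Psi> x \<partial>half_line) =
          - (real (n + m) + 1) *\<^sub>R (\<integral>x. laguerre_weight (2 * lam) l (Suc (n + m)) x *\<^sub>R \<Phi> x \<partial>half_line)"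
        by (rule step(2))
      thus ?thesis by (simp only: scaleR_scaleR add_Suc_right)
    qed
    also have "(-1) ^ m * (fact (n + m) / fact n) * (- (real (n + m) + 1)) =
        (-1) ^ Suc m * (fact (n + Suc m) / fact n)"
    proof -
      have "fact (n + Suc m) = (real (n + m) + 1) * fact (n + m)" by simp
      moreover have "x * (y / z) * (- w) = -1 * x * (w * y / z)" for x y z w :: real by simp
      ultimately show ?thesis by (simp only: power_Suc)
    qed
    finally show ?thesis .
  qed
  ultimately show ?case by blast
qed

section \<open>Weighted norms and Laguerre coefficients\<close>

lemma wL2_square_integrable:
  assumes "f \<in> wL2 a"
  shows "square_integrable half_line (\<lambda>x. of_real (x powr (a / 2)) * f x)"
    and "wnorm a f = sqrt (sqnorm half_line (\<lambda>x. of_real (x powr (a / 2)) * f x))"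
proof -
  have eq: "(cmod (f x))\<^sup>2 * x powr a = (cmod (of_real (x powr (a / 2)) * f x))\<^sup>2" for x
    by (simp add: norm_mult power_mult_distrib power2_eq_square[of "x powr (a / 2)"] mult.commute flip: powr_add)
  have "(\<lambda>x. complex_of_real (x powr (a / 2))) \<in> borel_measurable half_line"
    by (intro borel_measurable_lebesgue_onI) measurable
  thus "square_integrable half_line (\<lambda>x. of_real (x powr (a / 2)) * f x)"
    using assms by (auto simp: wL2_def square_integrable_def eq)
  show "wnorm a f = sqrt (sqnorm half_line (\<lambda>x. of_real (x powr (a / 2)) * f x))"
    by (simp add: wnorm_def sqnorm_def eq)
qed

lemma wL2_0_square_integrable:
  assumes "f \<in> wL2 0"
  shows "square_integrable half_line f"
proof (rule square_integrable_cong_AE[OF wL2_square_integrable(1)[OF assms]])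
  show "f \<in> borel_measurable half_line" using assms by (simp add: wL2_def)
  show "AE x in half_line. of_real (x powr (0 / 2)) * f x = f x" by (rule AE_half_lineI) simp
qed

text \<open>For integer order, the first of the \<open>m + 1\<close> differentiations in the Riemann--Liouville derivative merely undoes
  the integral \<open>I\<^sup>1\<close>; \<open>\<Phi>\<close> is the version of \<open>e\<^bsup>\<lambda>x\<^esup> f\<close> that is differentiated.\<close>

lemma has_tempered_deriv_nat:
  assumes "has_tempered_deriv (real m) lam f g"
  obtains \<Phi> where "loc_integrable (\<lambda>x. exp (lam * x) *\<^sub>R f x)"
    "AE x in half_line. \<Phi> x = exp (lam * x) *\<^sub>R f x" "\<Phi> \<in> borel_measurable half_line"
    "ac_deriv m \<Phi> (\<lambda>x. exp (lam * x) *\<^sub>R g x)"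
proof -
  obtain h where h: "has_rl_deriv (real m) (\<lambda>x. exp (lam * x) *\<^sub>R f x) h"
      "g = (\<lambda>x. exp (- lam * x) *\<^sub>R h x)"
    using assms unfolding has_tempered_deriv_def by blast
  have hG: "(\<lambda>x. exp (lam * x) *\<^sub>R g x) = h"
    unfolding h(2) by (simp add: fun_eq_iff flip: exp_add)
  have F: "loc_integrable (\<lambda>x. exp (lam * x) *\<^sub>R f x)"
    and ac: "ac_deriv (Suc m) (rl_integral 1 (\<lambda>x. exp (lam * x) *\<^sub>R f x)) h"
    using h(1) by (simp_all add: has_rl_deriv_def loc_integrable_def Let_def)
  from ac_deriv_Suc[THEN iffD1, OF ac]
  obtain \<Phi> where both: "ac_step (rl_integral 1 (\<lambda>x. exp (lam * x) *\<^sub>R f x)) \<Phi> \<and> ac_deriv m \<Phi> h" by (rule exE)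
  show ?thesis
  proof (rule that[OF F])
    show "AE x in half_line. \<Phi> x = exp (lam * x) *\<^sub>R f x"
      by (rule ac_step_unique[OF conjunct1[OF both] ac_step_rl_integral_one[OF F] refl])
    show "\<Phi> \<in> borel_measurable half_line" by (rule ac_step_measurable[OF conjunct1[OF both]])
    show "ac_deriv m \<Phi> (\<lambda>x. exp (lam * x) *\<^sub>R g x)" unfolding hG by (rule conjunct2[OF both])
  qed
qed

abbreviation laguerre_coef :: "real \<Rightarrow> real \<Rightarrow> (real \<Rightarrow> complex) \<Rightarrow> nat \<Rightarrow> complex" where
  "laguerre_coef a b \<equiv> orthonormal_sequence.coef half_line (laguerre_fun a b)"

lemma laguerre_coef_weight:
  assumes lam: "lam > 0"
  shows "laguerre_coef (real l) (2 * lam) (\<lambda>x. of_real (x powr (real l / 2)) * g x) n =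
    sqrt (fact n * (2 * lam) powr (real l + 1) / fact (l + n)) *\<^sub>R
      (\<integral>x. laguerre_weight (2 * lam) l n x *\<^sub>R (exp (lam * x) *\<^sub>R g x) \<partial>half_line)"
proof -
  interpret L: orthonormal_sequence half_line "laguerre_fun (real l) (2 * lam)"
    using lam by (intro orthonormal_laguerre_fun) auto
  let ?c = "sqrt (fact n * (2 * lam) powr (real l + 1) / Gamma (real l + real n + 1))"
  have G: "Gamma (real l + real n + 1) = fact (l + n)"
    using Gamma_fact[of "l + n", where 'a = real] by (simp add: add_ac)
  have "L.coef (\<lambda>x. of_real (x powr (real l / 2)) * g x) n =
      (\<integral>x. ?c *\<^sub>R (laguerre_weight (2 * lam) l n x *\<^sub>R (exp (lam * x) *\<^sub>R g x)) \<partial>half_line)"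
    unfolding L.coef_def by (intro Bochner_Integration.integral_cong refl laguerre_fun_weight) simp
  also have "\<dots> = ?c *\<^sub>R (\<integral>x. laguerre_weight (2 * lam) l n x *\<^sub>R (exp (lam * x) *\<^sub>R g x) \<partial>half_line)"
    by (rule integral_scaleR_right)
  finally show ?thesis unfolding G .
qed

text \<open>The tempered derivative of order \<open>m\<close> acts diagonally on Laguerre coefficients, shifting the index by \<open>m\<close>.\<close>

lemma laguerre_coef_tempered_deriv:
  assumes lam: "lam > 0" and f: "f \<in> wL2 0" and fg: "has_tempered_deriv (real m) lam f g"
    and g: "g \<in> wL2 (real m)"
  shows "(cmod (laguerre_coef (real m) (2 * lam) (\<lambda>x. of_real (x powr (real m / 2)) * g x) n))\<^sup>2 =
    (2 * lam) ^ m * (fact (n + m) / fact n) * (cmod (laguerre_coef 0 (2 * lam) f (n + m)))\<^sup>2"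
proof -
  let ?b = "2 * lam"
  interpret L: orthonormal_sequence half_line "laguerre_fun 0 ?b"
    using lam by (intro orthonormal_laguerre_fun) auto
  let ?F = "\<lambda>x. exp (lam * x) *\<^sub>R f x" and ?G = "\<lambda>x. exp (lam * x) *\<^sub>R g x"
  obtain \<Phi> where F: "loc_integrable ?F" and \<Phi>: "AE x in half_line. \<Phi> x = ?F x"
      "\<Phi> \<in> borel_measurable half_line" "ac_deriv m \<Phi> ?G"
    by (rule has_tempered_deriv_nat[OF fg])
  have gm: "g \<in> borel_measurable half_line" using g by (simp add: wL2_def)
  have "(\<integral>x. laguerre_weight ?b (0 + m) n x *\<^sub>R ?G x \<partial>half_line) =
      ((-1) ^ m * (fact (n + m) / fact n)) *\<^sub>R (\<integral>x. laguerre_weight ?b 0 (n + m) x *\<^sub>R \<Phi> x \<partial>half_line)"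
    using laguerre_weight_ac_deriv[OF lam refl gm \<Phi>(3,2), of 0] wL2_square_integrable(1)[OF g] by simp
  also have "(\<integral>x. laguerre_weight ?b 0 (n + m) x *\<^sub>R \<Phi> x \<partial>half_line) =
      (\<integral>x. laguerre_weight ?b 0 (n + m) x *\<^sub>R ?F x \<partial>half_line)"
  proof (rule integral_cong_AE)
    have "laguerre_weight ?b 0 (n + m) \<in> borel_measurable half_line"
      unfolding laguerre_weight_def[abs_def] by (intro borel_measurable_lebesgue_onI) measurable
    note scale = borel_measurable_scaleR[OF this]
    show "(\<lambda>x. laguerre_weight ?b 0 (n + m) x *\<^sub>R \<Phi> x) \<in> borel_measurable half_line"
      "(\<lambda>x. laguerre_weight ?b 0 (n + m) x *\<^sub>R ?F x) \<in> borel_measurable half_line"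
      by (rule scale[OF \<Phi>(2)], rule scale[OF loc_integrable_measurable[OF F]])
    show "AE x in half_line. laguerre_weight ?b 0 (n + m) x *\<^sub>R \<Phi> x = laguerre_weight ?b 0 (n + m) x *\<^sub>R ?F x"
      using \<Phi>(1) by eventually_elim simp
  qed
  finally have parts: "(\<integral>x. laguerre_weight ?b m n x *\<^sub>R ?G x \<partial>half_line) =
      ((-1) ^ m * (fact (n + m) / fact n)) *\<^sub>R (\<integral>x. laguerre_weight ?b 0 (n + m) x *\<^sub>R ?F x \<partial>half_line)"
    by simp
  let ?I = "\<integral>x. laguerre_weight ?b 0 (n + m) x *\<^sub>R ?F x \<partial>half_line"
  have "L.coef f (n + m) = L.coef (\<lambda>x. of_real (x powr (real 0 / 2)) * f x) (n + m)"
    unfolding L.coef_def by (intro Bochner_Integration.integral_cong refl) simp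
  also have "\<dots> = sqrt (fact (n + m) * ?b powr (real 0 + 1) / fact (0 + (n + m))) *\<^sub>R ?I"
    using laguerre_coef_weight[OF lam, of 0 f "n + m"] by simp
  finally have c0: "(cmod (L.coef f (n + m)))\<^sup>2 = ?b * (cmod ?I)\<^sup>2"
    using lam by (simp add: power_mult_distrib)
  have "(cmod (laguerre_coef (real m) ?b (\<lambda>x. of_real (x powr (real m / 2)) * g x) n))\<^sup>2 =
      (fact n * ?b powr (real m + 1) / fact (m + n)) * ((fact (n + m) / fact n)\<^sup>2 * (cmod ?I)\<^sup>2)"
  proof -
    let ?c = "sqrt (fact n * ?b powr (real m + 1) / fact (m + n))"
    let ?k = "(-1) ^ m * (fact (n + m) / fact n) :: real"
    have "(cmod (?c *\<^sub>R (?k *\<^sub>R ?I)))\<^sup>2 = ?c\<^sup>2 * (?k\<^sup>2 * (cmod ?I)\<^sup>2)"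
      by (simp only: norm_scaleR power_mult_distrib power2_abs)
    moreover have "?c\<^sup>2 = fact n * ?b powr (real m + 1) / fact (m + n)"
      by (intro real_sqrt_pow2 divide_nonneg_pos mult_nonneg_nonneg) auto
    moreover have "?k\<^sup>2 = (fact (n + m) / fact n)\<^sup>2"
      by (simp only: power_mult_distrib power_mult[symmetric] mult.commute[of m]) (simp add: power_mult)
    ultimately show ?thesis unfolding laguerre_coef_weight[OF lam] parts by (simp only:)
  qed
  also have "?b powr (real m + 1) = ?b ^ m * ?b" using lam by (simp add: powr_add powr_realpow)
  also have "(fact n * (?b ^ m * ?b) / fact (m + n)) * ((fact (n + m) / fact n)\<^sup>2 * (cmod ?I)\<^sup>2) =
      ?b ^ m * (fact (n + m) / fact n) * (?b * (cmod ?I)\<^sup>2)"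
    by (simp add: power2_eq_square add.commute)
  finally show ?thesis unfolding c0 .
qed

section \<open>The tempered fractional integral on Laguerre functions\<close>

lemma tempered_integral_cong_pos:
  assumes "\<And>t. t > 0 \<Longrightarrow> f t = g t" "x > 0"
  shows "tempered_integral s lam f x = tempered_integral s lam g x"
proof -
  have "rl_integral s (\<lambda>t. exp (lam * t) *\<^sub>R f t) x = rl_integral s (\<lambda>t. exp (lam * t) *\<^sub>R g t) x"
    by (rule rl_integral_cong_pos) (simp add: assms(1))
  thus ?thesis using assms by (simp add: tempered_integral_def)
qed

lemma tempered_integral_polynomial:
  fixes d :: "nat \<Rightarrow> complex"
  assumes s: "s \<ge> 0" and x: "x > 0"
  shows "tempered_integral s lam (\<lambda>t. exp (- lam * t) *\<^sub>R (\<Sum>k\<in>I. d k * of_real t ^ k)) x =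
    exp (- lam * x) *\<^sub>R (\<Sum>k\<in>I. d k * of_real (fact k / Gamma (s + real k + 1) * x powr (s + real k)))"
proof (cases "s = 0")
  case True
  have "fact k / Gamma (s + real k + 1) * x powr (s + real k) = x ^ k" for k
    using True x Gamma_fact[of k, where 'a = real] by (simp add: powr_realpow add_ac)
  thus ?thesis using True by (simp add: tempered_integral_def)
next
  case False
  have "exp (lam * t) *\<^sub>R (exp (- lam * t) *\<^sub>R (\<Sum>k\<in>I. d k * of_real t ^ k)) = (\<Sum>k\<in>I. d k * of_real t ^ k)"
    for t by (simp flip: exp_add)
  hence "tempered_integral s lam (\<lambda>t. exp (- lam * t) *\<^sub>R (\<Sum>k\<in>I. d k * of_real t ^ k)) x =
      exp (- lam * x) *\<^sub>R rl_integral s (\<lambda>t. \<Sum>k\<in>I. d k * of_real t ^ k) x"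
    using False by (simp add: tempered_integral_def)
  thus ?thesis using False s x by (simp only: rl_integral_polynomial)
qed

text \<open>The tempered fractional integral maps Laguerre functions of parameter \<open>0\<close> to multiples of those of
  parameter \<open>s\<close>, up to the weight \<open>x\<^bsup>s/2\<^esup>\<close>: on coefficients, \<open>t\<^bsup>k\<^esup>\<close> is multiplied by
  \<open>k! / \<Gamma>(s+k+1)\<close>.\<close>

lemma tempered_integral_laguerre:
  fixes a :: "nat \<Rightarrow> complex"
  assumes lam: "lam > 0" and s: "s \<ge> 0" and x: "x > 0"
  shows "of_real (x powr (- s / 2)) *
      tempered_integral s lam (\<lambda>t. \<Sum>n<K. a n * of_real (laguerre_fun 0 (2 * lam) n t)) x =
    (\<Sum>n<K. (a n * of_real (sqrt (fact n / (Gamma (s + real n + 1) * (2 * lam) powr s)))) *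
      of_real (laguerre_fun s (2 * lam) n x))"
proof -
  let ?b = "2 * lam"
  have b: "?b > 0" using lam by simp
  define d where "d k = (\<Sum>n<K. a n * of_real (sqrt ?b * (coeff (laguerre 0 n) k * ?b ^ k)))" for k
  have poly_ext: "poly (laguerre c n) y = (\<Sum>k<K. coeff (laguerre c n) k * y ^ k)" if "n < K" for n c y
    unfolding poly_laguerre
    by (rule sum.mono_neutral_left) (use that in \<open>auto simp: coeff_laguerre\<close>)
  have comb: "(\<Sum>n<K. a n * of_real (laguerre_fun 0 ?b n t)) =
      exp (- lam * t) *\<^sub>R (\<Sum>k<K. d k * of_real t ^ k)" if t: "t > 0" for t
  proof -
    have "(\<Sum>n<K. a n * of_real (laguerre_fun 0 ?b n t)) =
        (\<Sum>n<K. \<Sum>k<K. of_real (exp (- lam * t)) * ((a n * of_real (sqrt ?b * (coeff (laguerre 0 n) k * ?b ^ k))) * of_real t ^ k))"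
    proof (intro sum.cong refl)
      fix n assume "n \<in> {..<K}"
      hence n: "n < K" by simp
      have "laguerre_fun 0 ?b n t = (\<Sum>k<K. exp (- lam * t) * ((sqrt ?b * (coeff (laguerre 0 n) k * ?b ^ k)) * t ^ k))"
        unfolding laguerre_fun_0[OF b t] poly_ext[OF n] by (simp add: sum_distrib_left power_mult_distrib mult_ac)
      thus "a n * of_real (laguerre_fun 0 ?b n t) =
        (\<Sum>k<K. of_real (exp (- lam * t)) * ((a n * of_real (sqrt ?b * (coeff (laguerre 0 n) k * ?b ^ k))) * of_real t ^ k))"
        by (simp only: of_real_sum of_real_mult of_real_power sum_distrib_left mult_ac)
    qed
    also have "\<dots> = (\<Sum>k<K. \<Sum>n<K. of_real (exp (- lam * t)) * ((a n * of_real (sqrt ?b * (coeff (laguerre 0 n) k * ?b ^ k))) * of_real t ^ k))"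
      by (rule sum.swap)
    also have "\<dots> = exp (- lam * t) *\<^sub>R (\<Sum>k<K. d k * of_real t ^ k)"
      unfolding d_def scaleR_conv_of_real by (simp only: sum_distrib_left sum_distrib_right)
    finally show ?thesis .
  qed
  have G: "Gamma (s + real n + 1) > 0" for n using s by (intro Gamma_real_pos) simp
  have "of_real (x powr (- s / 2)) *
      tempered_integral s lam (\<lambda>t. \<Sum>n<K. a n * of_real (laguerre_fun 0 ?b n t)) x =
      of_real (x powr (- s / 2)) * (exp (- lam * x) *\<^sub>R
        (\<Sum>k<K. d k * of_real (fact k / Gamma (s + real k + 1) * x powr (s + real k))))"
  proof -
    have "tempered_integral s lam (\<lambda>t. \<Sum>n<K. a n * of_real (laguerre_fun 0 ?b n t)) x =
        tempered_integral s lam (\<lambda>t. exp (- lam * t) *\<^sub>R (\<Sum>k<K. d k * of_real t ^ k)) x"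
      by (rule tempered_integral_cong_pos[OF comb x])
    thus ?thesis by (simp only: tempered_integral_polynomial[OF s x])
  qed
  also have "\<dots> = (\<Sum>k<K. \<Sum>n<K. a n * of_real (x powr (- s / 2) * exp (- lam * x) *
      (sqrt ?b * (coeff (laguerre 0 n) k * ?b ^ k)) * (fact k / Gamma (s + real k + 1) * x powr (s + real k))))"
    unfolding d_def scaleR_conv_of_real of_real_mult sum_distrib_left sum_distrib_right by (simp only: mult_ac)
  also have "\<dots> = (\<Sum>n<K. \<Sum>k<K. a n * of_real (x powr (- s / 2) * exp (- lam * x) *
      (sqrt ?b * (coeff (laguerre 0 n) k * ?b ^ k)) * (fact k / Gamma (s + real k + 1) * x powr (s + real k))))"
    by (rule sum.swap)
  also have "\<dots> = (\<Sum>n<K. (a n * of_real (sqrt (fact n / (Gamma (s + real n + 1) * ?b powr s)))) *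
      of_real (laguerre_fun s ?b n x))"
  proof (intro sum.cong refl)
    fix n assume "n \<in> {..<K}"
    hence n: "n < K" by simp
    let ?\<gamma> = "fact n / Gamma (s + real n + 1)"
    have coeffs: "coeff (laguerre 0 n) k * (fact k / Gamma (s + real k + 1)) = ?\<gamma> * coeff (laguerre s n) k" for k
      using G[of k] G[of n] Gamma_fact[of k, where 'a = real] Gamma_fact[of n, where 'a = real]
      by (simp add: coeff_laguerre add_ac)
    have pw: "x powr (- s / 2) * x powr (s + real k) = x powr (s / 2) * x ^ k" for k
    proof -
      have "x powr (- s / 2) * x powr (s + real k) = x powr (s / 2 + real k)"
        by (simp flip: powr_add)
      thus ?thesis using x by (simp add: powr_add powr_realpow)
    qed
    have sq: "sqrt (?\<gamma> / ?b powr s) * sqrt (fact n * ?b powr (s + 1) / Gamma (s + real n + 1)) = sqrt ?b * ?\<gamma>"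
    proof -
      have "sqrt (?\<gamma> / ?b powr s) * sqrt (fact n * ?b powr (s + 1) / Gamma (s + real n + 1)) =
          sqrt (?b * ?\<gamma>\<^sup>2)"
        using b by (simp add: real_sqrt_mult[symmetric] powr_add power2_eq_square mult_ac)
      thus ?thesis using G[of n] by (simp add: real_sqrt_mult)
    qed
    have "(\<Sum>k<K. x powr (- s / 2) * exp (- lam * x) *
      (sqrt ?b * (coeff (laguerre 0 n) k * ?b ^ k)) * (fact k / Gamma (s + real k + 1) * x powr (s + real k))) =
      (\<Sum>k<K. (sqrt ?b * ?\<gamma>) * (x powr (s / 2) * exp (- lam * x) * (coeff (laguerre s n) k * (?b * x) ^ k)))"
    proof (intro sum.cong refl)
      fix k
      have "x powr (- s / 2) * exp (- lam * x) *
        (sqrt ?b * (coeff (laguerre 0 n) k * ?b ^ k)) * (fact k / Gamma (s + real k + 1) * x powr (s + real k)) =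
        sqrt ?b * exp (- lam * x) * ?b ^ k * (coeff (laguerre 0 n) k * (fact k / Gamma (s + real k + 1))) *
        (x powr (- s / 2) * x powr (s + real k))"
        by (simp only: mult_ac)
      also have "\<dots> = (sqrt ?b * ?\<gamma>) * (x powr (s / 2) * exp (- lam * x) * (coeff (laguerre s n) k * (?b * x) ^ k))"
        unfolding coeffs pw power_mult_distrib by (simp only: mult_ac)
      finally show "x powr (- s / 2) * exp (- lam * x) *
        (sqrt ?b * (coeff (laguerre 0 n) k * ?b ^ k)) * (fact k / Gamma (s + real k + 1) * x powr (s + real k)) =
        (sqrt ?b * ?\<gamma>) * (x powr (s / 2) * exp (- lam * x) * (coeff (laguerre s n) k * (?b * x) ^ k))" .
    qed
    also have "\<dots> = (sqrt ?b * ?\<gamma>) * (x powr (s / 2) * exp (- lam * x) * poly (laguerre s n) (?b * x))"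
      unfolding poly_ext[OF n] by (simp only: sum_distrib_left)
    also have "\<dots> = sqrt (?\<gamma> / ?b powr s) * laguerre_fun s ?b n x"
      unfolding sq[symmetric] laguerre_fun_def by (simp add: mult.assoc)
    finally have "(\<Sum>k<K. x powr (- s / 2) * exp (- lam * x) *
      (sqrt ?b * (coeff (laguerre 0 n) k * ?b ^ k)) * (fact k / Gamma (s + real k + 1) * x powr (s + real k))) =
      sqrt (?\<gamma> / ?b powr s) * laguerre_fun s ?b n x" .
    hence "a n * of_real (\<Sum>k<K. x powr (- s / 2) * exp (- lam * x) *
      (sqrt ?b * (coeff (laguerre 0 n) k * ?b ^ k)) * (fact k / Gamma (s + real k + 1) * x powr (s + real k))) =
      a n * of_real (sqrt (?\<gamma> / ?b powr s) * laguerre_fun s ?b n x)" by (simp only:)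
    thus "(\<Sum>k<K. a n * of_real (x powr (- s / 2) * exp (- lam * x) *
      (sqrt ?b * (coeff (laguerre 0 n) k * ?b ^ k)) * (fact k / Gamma (s + real k + 1) * x powr (s + real k)))) =
      (a n * of_real (sqrt (fact n / (Gamma (s + real n + 1) * ?b powr s)))) * of_real (laguerre_fun s ?b n x)"
      by (simp only: of_real_sum sum_distrib_left of_real_mult mult.assoc divide_divide_eq_left)
  qed
  finally show ?thesis .
qed

lemma loc_integrable_exp_square_integrable:
  assumes f: "square_integrable half_line f" and lam: "lam > 0"
  shows "loc_integrable (\<lambda>t. exp (lam * t) *\<^sub>R f t)"
  unfolding loc_integrable_half_line_iff
proof (intro allI impI)
  fix x :: real assume "x > 0"
  let ?e = "\<lambda>y. complex_of_real (indicator {..<x} y * exp (lam * y))"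
  have "square_integrable half_line ?e"
  proof (rule square_integrable_bound)
    show "integrable half_line (\<lambda>y. (exp (lam * x))\<^sup>2 * indicator {..x} y)"
      by (intro integrable_mult_right integrable_indicator_half_line)
    show "?e \<in> borel_measurable half_line" by (intro borel_measurable_lebesgue_onI) measurable
    show "AE y in half_line. (cmod (?e y))\<^sup>2 \<le> (exp (lam * x))\<^sup>2 * indicator {..x} y"
    proof (rule AE_I2)
      fix y
      show "(cmod (?e y))\<^sup>2 \<le> (exp (lam * x))\<^sup>2 * indicator {..x} y"
      proof (cases "y < x")
        case True
        have "(exp (lam * y))\<^sup>2 \<le> (exp (lam * x))\<^sup>2" using True lam by (intro power_mono) auto
        thus ?thesis using True by simp
      qed simp
    qed
  qed
  from integrable_mult_square_integrable[OF this f]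
  have "integrable half_line (\<lambda>y. ?e y * f y)" .
  also have "(\<lambda>y. ?e y * f y) = (\<lambda>y. indicator {..<x} y *\<^sub>R exp (lam * y) *\<^sub>R f y)"
    by (simp add: fun_eq_iff scaleR_conv_of_real)
  finally show "integrable half_line (\<lambda>y. indicator {..<x} y *\<^sub>R exp (lam * y) *\<^sub>R f y)" .
qed

lemma tempered_integral_diff_AE:
  assumes s: "s \<ge> 0" and lam: "lam > 0"
    and f: "square_integrable half_line f" and g: "square_integrable half_line g"
  shows "AE x in half_line. tempered_integral s lam (\<lambda>t. f t - g t) x =
    tempered_integral s lam f x - tempered_integral s lam g x"
proof (cases "s = 0")
  case True
  thus ?thesis by (simp add: tempered_integral_def)
next
  case False
  hence "s > 0" using s by simp
  from rl_integral_diff_AE[OF this loc_integrable_exp_square_integrable[OF f lam]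
      loc_integrable_exp_square_integrable[OF g lam]]
  show ?thesis
    by eventually_elim (use False in \<open>simp add: tempered_integral_def scaleR_diff_right\<close>)
qed

lemma tempered_integral_measurable:
  assumes s: "s \<ge> 0" and lam: "lam > 0" and f: "square_integrable half_line f"
  shows "tempered_integral s lam f \<in> borel_measurable half_line"
proof (cases "s = 0")
  case True
  have "tempered_integral s lam f = f" using True by (simp add: tempered_integral_def fun_eq_iff)
  thus ?thesis using square_integrableD(1)[OF f] by simp
next
  case False
  have "rl_integral s (\<lambda>t. exp (lam * t) *\<^sub>R f t) \<in> borel_measurable half_line"
    using False s by (intro loc_integrable_measurable loc_integrable_rl_integral
        loc_integrable_exp_square_integrable f lam) simp
  moreover have "(\<lambda>x. exp (- lam * x)) \<in> borel_measurable half_line"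
    by (intro borel_measurable_lebesgue_onI) measurable
  ultimately have "(\<lambda>x. exp (- lam * x) *\<^sub>R rl_integral s (\<lambda>t. exp (lam * t) *\<^sub>R f t) x) \<in> borel_measurable half_line"
    by (rule borel_measurable_scaleR[rotated])
  thus ?thesis using False by (simp add: tempered_integral_def[abs_def])
qed

text \<open>Continuity of the tempered fractional integral in a weighted \<open>L\<^sup>1\<close> norm.\<close>

lemma tempered_integral_L1:
  assumes s: "s \<ge> 0" and lam: "lam > 0" and d: "square_integrable half_line d"
  shows "(\<integral>\<^sup>+x. ennreal (exp (- lam * x) * cmod (tempered_integral s lam d x)) \<partial>half_line) \<le>
    ennreal (1 / (2 * lam) powr s) * (\<integral>\<^sup>+x. ennreal (exp (- lam * x) * cmod (d x)) \<partial>half_line)"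
proof (cases "s = 0")
  case True
  thus ?thesis using lam by (simp add: tempered_integral_def)
next
  case False
  hence s0: "s > 0" using s by simp
  let ?b = "2 * lam"
  have b: "?b > 0" using lam by simp
  let ?D = "\<lambda>t. exp (lam * t) *\<^sub>R d t"
  have locD: "loc_integrable ?D" by (rule loc_integrable_exp_square_integrable[OF d lam])
  obtain F where F[measurable]: "F \<in> borel_measurable borel" and DF: "AE y in half_line. ?D y = F y" and "loc_integrable F"
    using loc_integrable_representative[OF locD] by blast
  have rl: "rl_integral s ?D = rl_integral s F"
    by (intro ext rl_integral_cong_AE loc_integrable_measurable[OF locD] borel_measurable_lebesgue_onI F DF)
  have e: "exp (- lam * x) * exp (- lam * x) = exp (- ?b * x)" for x by (simp flip: exp_add)
  note mrl[measurable] = borel_measurable_rl_integral_borel[OF F, of s]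
  have "(\<integral>\<^sup>+x. ennreal (exp (- lam * x) * cmod (tempered_integral s lam d x)) \<partial>half_line) =
      (\<integral>\<^sup>+x. ennreal (exp (- ?b * x) * cmod (rl_integral s F x)) \<partial>half_line)"
    by (simp only: tempered_integral_def False if_False rl norm_scaleR abs_exp_cancel e[symmetric] mult.assoc)
  also have "\<dots> = (\<integral>\<^sup>+x. ennreal (exp (- ?b * x) * cmod (rl_integral s F x)) * indicator {0<..} x \<partial>lborel)"
    by (rule nn_integral_half_line_eq) measurable
  also have "\<dots> \<le> (\<integral>\<^sup>+x. ennreal (exp (- ?b * x)) *
      (\<integral>\<^sup>+y. ennreal (rl_kernel s x y) * ennreal (cmod (F y)) \<partial>lborel) \<partial>lborel)"
  proof (intro nn_integral_mono)
    fix x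
    have "ennreal (exp (- ?b * x) * cmod (rl_integral s F x)) * indicator {0<..} x \<le>
        ennreal (exp (- ?b * x) * cmod (rl_integral s F x))"
      by (simp add: indicator_def)
    also have "\<dots> = ennreal (exp (- ?b * x)) * ennreal (cmod (rl_integral s F x))"
      by (rule ennreal_mult) auto
    also have "\<dots> \<le> ennreal (exp (- ?b * x)) * (\<integral>\<^sup>+y. ennreal (rl_kernel s x y) * ennreal (cmod (F y)) \<partial>lborel)"
      by (intro mult_left_mono norm_rl_integral_le s0 F) simp
    finally show "ennreal (exp (- ?b * x) * cmod (rl_integral s F x)) * indicator {0<..} x \<le>
      ennreal (exp (- ?b * x)) * (\<integral>\<^sup>+y. ennreal (rl_kernel s x y) * ennreal (cmod (F y)) \<partial>lborel)" .
  qed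
  also have "\<dots> = (\<integral>\<^sup>+y. ennreal (exp (- ?b * y) / ?b powr s) * ennreal (cmod (F y)) * indicator {0<..} y \<partial>lborel)"
    by (rule nn_integral_rl_laplace[OF s0 b]) measurable
  also have "\<dots> = (\<integral>\<^sup>+y. ennreal (exp (- ?b * y) / ?b powr s) * ennreal (cmod (F y)) \<partial>half_line)"
    by (rule nn_integral_half_line_eq[symmetric]) measurable
  also have "\<dots> = (\<integral>\<^sup>+y. ennreal (1 / ?b powr s) * ennreal (exp (- lam * y) * cmod (d y)) \<partial>half_line)"
  proof (rule nn_integral_cong_AE)
    show "AE y in half_line. ennreal (exp (- ?b * y) / ?b powr s) * ennreal (cmod (F y)) =
        ennreal (1 / ?b powr s) * ennreal (exp (- lam * y) * cmod (d y))"
      using DF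
    proof eventually_elim
      case (elim y)
      have "cmod (F y) = exp (lam * y) * cmod (d y)" by (simp flip: elim)
      moreover have "exp (- ?b * y) * exp (lam * y) = exp (- lam * y)" by (simp flip: exp_add)
      ultimately have "exp (- ?b * y) / ?b powr s * cmod (F y) = 1 / ?b powr s * (exp (- lam * y) * cmod (d y))"
        by (simp add: mult.assoc[symmetric])
      thus ?case by (simp flip: ennreal_mult)
    qed
  qed
  also have "\<dots> = ennreal (1 / ?b powr s) * (\<integral>\<^sup>+y. ennreal (exp (- lam * y) * cmod (d y)) \<partial>half_line)"
  proof (rule nn_integral_cmult)
    have "(\<lambda>y. exp (- lam * y)) \<in> borel_measurable half_line"
      by (intro borel_measurable_lebesgue_onI) measurable
    thus "(\<lambda>y. ennreal (exp (- lam * y) * cmod (d y))) \<in> borel_measurable half_line"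
      using square_integrableD(1)[OF d] by measurable
  qed
  finally show ?thesis .
qed

lemma integrable_exp_sqrt:
  assumes lam: "lam > 0" and d: "square_integrable half_line d"
  shows "integrable half_line (\<lambda>x. exp (- lam * x) * cmod (d x))"
    and "(\<integral>x. exp (- lam * x) * cmod (d x) \<partial>half_line) \<le> sqrt (1 / (2 * lam)) * sqrt (sqnorm half_line d)"
proof -
  let ?e = "\<lambda>x. complex_of_real (exp (- lam * x))"
  have E: "has_bochner_integral half_line (\<lambda>x. (cmod (?e x))\<^sup>2) (1 / (2 * lam))"
  proof -
    have "has_bochner_integral half_line (\<lambda>x. x powr (1 - 1) * exp (- (2 * lam) * x)) (Gamma 1 / (2 * lam) powr 1)"
      using lam by (intro has_bochner_integral_gamma) auto
    also have "?this \<longleftrightarrow> ?thesis"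
      using lam by (intro has_bochner_integral_cong) (auto simp: power2_eq_square simp flip: exp_add)
    finally show ?thesis .
  qed
  have e: "square_integrable half_line ?e"
    using E by (auto simp: square_integrable_def has_bochner_integral_iff intro!: borel_measurable_lebesgue_onI)
  show "integrable half_line (\<lambda>x. exp (- lam * x) * cmod (d x))"
    using integrable_norm[OF integrable_mult_square_integrable[OF e d]] by (simp add: norm_mult)
  show "(\<integral>x. exp (- lam * x) * cmod (d x) \<partial>half_line) \<le> sqrt (1 / (2 * lam)) * sqrt (sqnorm half_line d)"
    using integral_mult_le_sqnorm[OF e d] E by (simp add: sqnorm_def has_bochner_integral_iff)
qed

text \<open>The norm of \<open>T r\<close> in terms of the Laguerre coefficients of \<open>r\<close>. The partial sums of the
  Laguerre series converge in \<open>L\<^sup>2\<close>, so their images converge in weighted \<open>L\<^sup>1\<close>, hence almost everywhere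
  along a subsequence, and Fatou's lemma carries over the bound.\<close>

lemma tempered_integral_sqnorm_le:
  assumes s: "s \<ge> 0" and lam: "lam > 0" and r: "square_integrable half_line r"
    and B: "\<And>K. (\<Sum>n<K. (cmod (laguerre_coef 0 (2 * lam) r n))\<^sup>2 *
      (fact n / (Gamma (s + real n + 1) * (2 * lam) powr s))) \<le> B"
  shows "square_integrable half_line (\<lambda>x. of_real (x powr (- s / 2)) * tempered_integral s lam r x) \<and>
    sqnorm half_line (\<lambda>x. of_real (x powr (- s / 2)) * tempered_integral s lam r x) \<le> B"
proof -
  let ?b = "2 * lam"
  have b: "?b > 0" using lam by simp
  interpret L: orthonormal_sequence half_line "laguerre_fun 0 ?b"
    using lam by (intro orthonormal_laguerre_fun) auto
  interpret Ls: orthonormal_sequence half_line "laguerre_fun s ?b"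
    using lam s by (intro orthonormal_laguerre_fun) auto
  define S where "S K = L.partial_sum r K" for K
  define d where "d K = (\<lambda>x. r x - S K x)" for K
  define T where "T = tempered_integral s lam"
  define W where "W g x = of_real (x powr (- s / 2)) * T g x" for g x
  have sqS: "square_integrable half_line (S K)" for K
    unfolding S_def by (rule L.square_integrable_partial_sum)
  have sqd: "square_integrable half_line (d K)" for K
    unfolding d_def by (rule square_integrable_diff[OF r sqS])
  have mT: "T g \<in> borel_measurable half_line" if "square_integrable half_line g" for g
    unfolding T_def by (rule tempered_integral_measurable[OF s lam that])
  have mp: "(\<lambda>x. complex_of_real (x powr (- s / 2))) \<in> borel_measurable half_line"
    by (intro borel_measurable_lebesgue_onI) measurable
  have mW: "W g \<in> borel_measurable half_line" if "square_integrable half_line g" for g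
    unfolding W_def[abs_def] using mp mT[OF that] by (rule borel_measurable_times)
  have lim_d: "(\<lambda>K. sqnorm half_line (d K)) \<longlonglongrightarrow> 0"
    using expandable_laguerre[OF b r] unfolding L.expandable_def d_def S_def by blast
  have B0: "B \<ge> 0" using B[of 0] by simp
  have WS: "(\<integral>\<^sup>+x. ennreal ((cmod (W (S K) x))\<^sup>2) \<partial>half_line) \<le> ennreal B" for K
  proof -
    let ?c = "\<lambda>n. L.coef r n * of_real (sqrt (fact n / (Gamma (s + real n + 1) * ?b powr s)))"
    let ?C = "\<lambda>x. \<Sum>n<K. ?c n * of_real (laguerre_fun s ?b n x)"
    have eq: "W (S K) x = ?C x" if "x > 0" for x
      unfolding W_def T_def S_def L.partial_sum_def[abs_def] by (rule tempered_integral_laguerre[OF lam s that])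
    have "(\<integral>\<^sup>+x. ennreal ((cmod (W (S K) x))\<^sup>2) \<partial>half_line) = (\<integral>\<^sup>+x. ennreal ((cmod (?C x))\<^sup>2) \<partial>half_line)"
      by (intro nn_integral_cong) (simp add: eq)
    also have "\<dots> = ennreal (sqnorm half_line ?C)"
      unfolding sqnorm_def using Ls.square_integrable_comb
      by (intro nn_integral_eq_integral) (auto simp: square_integrable_def)
    also have "sqnorm half_line ?C = (\<Sum>n<K. (cmod (?c n))\<^sup>2)" by (rule Ls.sqnorm_comb)
    also have "\<dots> = (\<Sum>n<K. (cmod (L.coef r n))\<^sup>2 * (fact n / (Gamma (s + real n + 1) * ?b powr s)))"
    proof (intro sum.cong refl)
      fix n
      have "Gamma (s + real n + 1) > 0" using s by (intro Gamma_real_pos) simp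
      hence "0 \<le> fact n / (Gamma (s + real n + 1) * ?b powr s)" by (intro divide_nonneg_nonneg mult_nonneg_nonneg) auto
      thus "(cmod (?c n))\<^sup>2 = (cmod (L.coef r n))\<^sup>2 * (fact n / (Gamma (s + real n + 1) * ?b powr s))"
        unfolding norm_mult power_mult_distrib norm_of_real power2_abs by simp
    qed
    also have "ennreal \<dots> \<le> ennreal B" by (intro ennreal_leI B)
    finally show ?thesis .
  qed
  \<comment> \<open>The error after \<open>K\<close> terms, weighted so that its \<open>L\<^sup>1\<close> norm is controlled by the \<open>L\<^sup>2\<close> norm of \<open>d K\<close>.\<close>
  define v where "v K x = exp (- lam * x) * cmod (T (d K) x)" for K x
  have mexp: "(\<lambda>x. exp (- lam * x)) \<in> borel_measurable half_line"
    by (intro borel_measurable_lebesgue_onI) measurable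
  have mv: "v K \<in> borel_measurable half_line" for K
    unfolding v_def[abs_def] using mexp mT[OF sqd] by measurable
  let ?A = "1 / ?b powr s * (sqrt (1 / (2 * lam)))"
  have vb: "(\<integral>\<^sup>+x. ennreal (v K x) \<partial>half_line) \<le> ennreal (?A * sqrt (sqnorm half_line (d K)))" for K
  proof -
    have "(\<integral>\<^sup>+x. ennreal (v K x) \<partial>half_line) \<le>
        ennreal (1 / ?b powr s) * (\<integral>\<^sup>+x. ennreal (exp (- lam * x) * cmod (d K x)) \<partial>half_line)"
      unfolding v_def T_def by (rule tempered_integral_L1[OF s lam sqd])
    also have "(\<integral>\<^sup>+x. ennreal (exp (- lam * x) * cmod (d K x)) \<partial>half_line) =
        ennreal (\<integral>x. exp (- lam * x) * cmod (d K x) \<partial>half_line)"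
      by (intro nn_integral_eq_integral integrable_exp_sqrt lam sqd) simp
    also have "ennreal (1 / ?b powr s) * \<dots> = ennreal (1 / ?b powr s * (\<integral>x. exp (- lam * x) * cmod (d K x) \<partial>half_line))"
      by (rule ennreal_mult[symmetric]) auto
    also have "\<dots> \<le> ennreal (1 / ?b powr s * (sqrt (1 / (2 * lam)) * sqrt (sqnorm half_line (d K))))"
      by (intro ennreal_leI mult_left_mono integrable_exp_sqrt lam sqd) simp
    finally show ?thesis by (simp only: mult.assoc)
  qed
  have iv: "integrable half_line (v K)" for K
  proof (rule integrableI_bounded[OF mv])
    have "(\<integral>\<^sup>+x. ennreal (norm (v K x)) \<partial>half_line) = (\<integral>\<^sup>+x. ennreal (v K x) \<partial>half_line)"
      by (simp add: v_def)
    also have "\<dots> < \<infinity>" by (rule le_less_trans[OF vb]) simp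
    finally show "(\<integral>\<^sup>+x. ennreal (norm (v K x)) \<partial>half_line) < \<infinity>" .
  qed
  have vle: "(\<integral>x. norm (v K x) \<partial>half_line) \<le> ?A * sqrt (sqnorm half_line (d K))" for K
  proof -
    have "ennreal (\<integral>x. norm (v K x) \<partial>half_line) = (\<integral>\<^sup>+x. ennreal (v K x) \<partial>half_line)"
    proof -
      have "norm (v K x) = v K x" for x by (simp add: v_def)
      moreover have "(\<integral>\<^sup>+x. ennreal (v K x) \<partial>half_line) = ennreal (\<integral>x. v K x \<partial>half_line)"
        by (rule nn_integral_eq_integral[OF iv]) (simp add: v_def)
      ultimately show ?thesis by (simp only:)
    qed
    hence "ennreal (\<integral>x. norm (v K x) \<partial>half_line) \<le> ennreal (?A * sqrt (sqnorm half_line (d K)))"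
      using vb[of K] by simp
    moreover have "0 \<le> ?A * sqrt (sqnorm half_line (d K))"
      using lam sqnorm_nonneg[of half_line "d K"] by (intro mult_nonneg_nonneg) auto
    ultimately show ?thesis by (simp only: ennreal_le_iff)
  qed
  have "(\<lambda>K. \<integral>x. norm (v K x) \<partial>half_line) \<longlonglongrightarrow> 0"
  proof (rule tendsto_sandwich[OF _ _ tendsto_const])
    show "\<forall>\<^sub>F K in sequentially. (\<integral>x. norm (v K x) \<partial>half_line) \<le> ?A * sqrt (sqnorm half_line (d K))"
      by (intro always_eventually allI vle)
    have "(\<lambda>K. ?A * sqrt (sqnorm half_line (d K))) \<longlonglongrightarrow> ?A * sqrt 0"
      by (intro tendsto_mult tendsto_const tendsto_real_sqrt lim_d)
    thus "(\<lambda>K. ?A * sqrt (sqnorm half_line (d K))) \<longlonglongrightarrow> 0" by simp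
  qed (simp add: always_eventually)
  from tendsto_L1_AE_subseq[OF iv this]
  obtain \<sigma> where "strict_mono \<sigma>" and v0: "AE x in half_line. (\<lambda>K. v (\<sigma> K) x) \<longlonglongrightarrow> 0" by blast
  have "AE x in half_line. \<forall>K. T (d K) x = T r x - T (S K) x"
    unfolding T_def d_def
    by (intro AE_all_countable[THEN iffD2] allI tempered_integral_diff_AE s lam r sqS)
  hence conv: "AE x in half_line. (\<lambda>K. W (S (\<sigma> K)) x) \<longlonglongrightarrow> W r x"
    using v0
  proof eventually_elim
    case (elim x)
    have "(\<lambda>K. exp (lam * x) * v (\<sigma> K) x) \<longlonglongrightarrow> exp (lam * x) * 0"
      by (intro tendsto_mult tendsto_const elim(2))
    moreover have "exp (lam * x) * v (\<sigma> K) x = cmod (T (d (\<sigma> K)) x)" for K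
      unfolding v_def mult.assoc[symmetric] by (simp flip: exp_add)
    ultimately have "(\<lambda>K. T (d (\<sigma> K)) x) \<longlonglongrightarrow> 0" by (simp add: tendsto_norm_zero_iff)
    hence "(\<lambda>K. T r x - T (d (\<sigma> K)) x) \<longlonglongrightarrow> T r x - 0" by (intro tendsto_diff tendsto_const)
    hence "(\<lambda>K. T (S (\<sigma> K)) x) \<longlonglongrightarrow> T r x" using elim(1) by simp
    thus ?case unfolding W_def by (intro tendsto_mult tendsto_const)
  qed
  have nn: "(\<integral>\<^sup>+x. ennreal ((cmod (W r x))\<^sup>2) \<partial>half_line) \<le> ennreal B"
  proof -
    have "(\<integral>\<^sup>+x. ennreal ((cmod (W r x))\<^sup>2) \<partial>half_line) =
        (\<integral>\<^sup>+x. liminf (\<lambda>K. ennreal ((cmod (W (S (\<sigma> K)) x))\<^sup>2)) \<partial>half_line)"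
    proof (rule nn_integral_cong_AE)
      show "AE x in half_line. ennreal ((cmod (W r x))\<^sup>2) = liminf (\<lambda>K. ennreal ((cmod (W (S (\<sigma> K)) x))\<^sup>2))"
        using conv
      proof eventually_elim
        case (elim x)
        have "(\<lambda>K. ennreal ((cmod (W (S (\<sigma> K)) x))\<^sup>2)) \<longlonglongrightarrow> ennreal ((cmod (W r x))\<^sup>2)"
          by (intro tendsto_ennrealI tendsto_power tendsto_norm elim)
        thus ?case by (intro lim_imp_Liminf[symmetric]) auto
      qed
    qed
    also have "\<dots> \<le> liminf (\<lambda>K. \<integral>\<^sup>+x. ennreal ((cmod (W (S (\<sigma> K)) x))\<^sup>2) \<partial>half_line)"
    proof (rule nn_integral_liminf)
      fix K
      have "W (S (\<sigma> K)) \<in> borel_measurable half_line" by (rule mW[OF sqS])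
      thus "(\<lambda>x. ennreal ((cmod (W (S (\<sigma> K)) x))\<^sup>2)) \<in> borel_measurable half_line" by measurable
    qed
    also have "\<dots> \<le> ennreal B"
      by (rule Liminf_le) (simp_all add: WS)
    finally show ?thesis .
  qed
  have iW: "integrable half_line (\<lambda>x. (cmod (W r x))\<^sup>2)"
  proof (rule integrableI_bounded)
    show "(\<lambda>x. (cmod (W r x))\<^sup>2) \<in> borel_measurable half_line" using mW[OF r] by measurable
    have "(\<integral>\<^sup>+x. ennreal (norm ((cmod (W r x))\<^sup>2)) \<partial>half_line) \<le> ennreal B" using nn by simp
    also have "\<dots> < \<infinity>" by simp
    finally show "(\<integral>\<^sup>+x. ennreal (norm ((cmod (W r x))\<^sup>2)) \<partial>half_line) < \<infinity>" .
  qed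
  have "square_integrable half_line (W r)" using mW[OF r] iW by (simp add: square_integrable_def)
  moreover have "sqnorm half_line (W r) \<le> B"
  proof -
    have "ennreal (sqnorm half_line (W r)) = (\<integral>\<^sup>+x. ennreal ((cmod (W r x))\<^sup>2) \<partial>half_line)"
      unfolding sqnorm_def by (rule nn_integral_eq_integral[OF iW, symmetric]) simp
    with nn have "ennreal (sqnorm half_line (W r)) \<le> ennreal B" by (simp only:)
    thus ?thesis by (rule ennreal_le_iff[OF B0, THEN iffD1])
  qed
  ultimately show ?thesis unfolding W_def[abs_def] T_def by blast
qed

section \<open>The Petrov--Galerkin solution\<close>

lemma square_integrable_exp_polynomial:
  fixes d :: "nat \<Rightarrow> complex"
  assumes lam: "lam > 0"
  shows "square_integrable half_line (\<lambda>t. exp (- lam * t) *\<^sub>R (\<Sum>k\<in>I. d k * of_real t ^ k))"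
proof -
  have mono: "square_integrable half_line (\<lambda>t. complex_of_real (exp (- lam * t) * t ^ k))" for k
    unfolding square_integrable_def
  proof
    show "(\<lambda>t. complex_of_real (exp (- lam * t) * t ^ k)) \<in> borel_measurable half_line"
      by (intro borel_measurable_lebesgue_onI) measurable
    have "integrable half_line (\<lambda>t. t powr 0 * exp (- (2 * lam) * t) * t ^ (2 * k))"
      using has_bochner_integral_gamma_power[of 0 "2 * lam" "2 * k"] lam
      by (simp add: has_bochner_integral_iff)
    also have "?this \<longleftrightarrow> integrable half_line (\<lambda>t. (cmod (complex_of_real (exp (- lam * t) * t ^ k)))\<^sup>2)"
    proof (intro Bochner_Integration.integrable_cong refl)
      fix t assume "t \<in> space half_line"
      hence t: "t > 0" by simp
      have "(exp (- lam * t))\<^sup>2 = exp (- (2 * lam) * t)"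
        by (simp add: power2_eq_square flip: exp_add)
      thus "t powr 0 * exp (- (2 * lam) * t) * t ^ (2 * k) = (cmod (complex_of_real (exp (- lam * t) * t ^ k)))\<^sup>2"
        unfolding norm_of_real power2_abs power_mult_distrib using t by (simp add: power_mult[symmetric] mult.commute)
    qed
    finally show "integrable half_line (\<lambda>t. (cmod (complex_of_real (exp (- lam * t) * t ^ k)))\<^sup>2)" .
  qed
  have "square_integrable half_line (\<lambda>t. \<Sum>k\<in>I. d k * complex_of_real (exp (- lam * t) * t ^ k))"
    by (intro square_integrable_sum square_integrable_mult_left mono)
  also have "(\<lambda>t. \<Sum>k\<in>I. d k * complex_of_real (exp (- lam * t) * t ^ k)) =
      (\<lambda>t. exp (- lam * t) *\<^sub>R (\<Sum>k\<in>I. d k * of_real t ^ k))"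
    by (simp add: scaleR_conv_of_real sum_distrib_left mult_ac)
  finally show ?thesis .
qed

lemma laguerre_coef_exp_polynomial:
  fixes d :: "nat \<Rightarrow> complex"
  assumes lam: "lam > 0" and n: "N < n"
  shows "laguerre_coef 0 (2 * lam) (\<lambda>t. exp (- lam * t) *\<^sub>R (\<Sum>k\<le>N. d k * of_real t ^ k)) n = 0"
proof -
  let ?b = "2 * lam"
  have b: "?b > 0" using lam by simp
  interpret L: orthonormal_sequence half_line "laguerre_fun 0 ?b"
    using lam by (intro orthonormal_laguerre_fun) auto
  let ?f = "\<lambda>k t. t powr 0 * exp (- ?b * t) * poly (laguerre 0 n) (?b * t) * t ^ k"
  have "has_bochner_integral half_line (?f k) 0" if "k \<le> N" for k
    using has_bochner_integral_laguerre_monomial[of 0 ?b k n] that n b by simp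
  hence "has_bochner_integral half_line (\<lambda>t. \<Sum>k\<le>N. (d k * of_real (sqrt ?b)) * complex_of_real (?f k t))
      (\<Sum>k\<le>N. (d k * of_real (sqrt ?b)) * complex_of_real 0)"
    by (intro has_bochner_integral_sum has_bochner_integral_mult_right has_bochner_integral_of_real) auto
  hence "(\<integral>t. (\<Sum>k\<le>N. (d k * of_real (sqrt ?b)) * complex_of_real (?f k t)) \<partial>half_line) = 0"
    by (simp add: has_bochner_integral_iff)
  also have "(\<integral>t. (\<Sum>k\<le>N. (d k * of_real (sqrt ?b)) * complex_of_real (?f k t)) \<partial>half_line) =
      L.coef (\<lambda>t. exp (- lam * t) *\<^sub>R (\<Sum>k\<le>N. d k * of_real t ^ k)) n"
    unfolding L.coef_def
  proof (intro Bochner_Integration.integral_cong refl)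
    fix t assume "t \<in> space half_line"
    hence t: "t > 0" by simp
    have e: "exp (- ?b * t) = exp (- lam * t) * exp (- (?b / 2) * t)" by (simp flip: exp_add)
    have "(d k * of_real (sqrt ?b)) * complex_of_real (?f k t) =
        of_real (exp (- lam * t)) * (d k * of_real t ^ k) * of_real (laguerre_fun 0 ?b n t)" for k
    proof -
      have p0: "t powr 0 = 1" using t by simp
      have "sqrt ?b * ?f k t = exp (- lam * t) * t ^ k * laguerre_fun 0 ?b n t"
        unfolding laguerre_fun_0[OF b t] e p0 by (simp only: mult_ac mult_1_left)
      hence "complex_of_real (sqrt ?b * ?f k t) = of_real (exp (- lam * t) * t ^ k * laguerre_fun 0 ?b n t)"
        by (simp only:)
      hence "complex_of_real (sqrt ?b) * of_real (?f k t) =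
          of_real (exp (- lam * t)) * of_real t ^ k * of_real (laguerre_fun 0 ?b n t)"
        by (simp only: of_real_mult of_real_power)
      thus ?thesis by (simp only: mult.assoc mult.left_commute[of _ "d k"])
    qed
    thus "(\<Sum>k\<le>N. (d k * of_real (sqrt ?b)) * complex_of_real (?f k t)) =
      (exp (- lam * t) *\<^sub>R (\<Sum>k\<le>N. d k * of_real t ^ k)) * of_real (laguerre_fun 0 ?b n t)"
      by (simp only: scaleR_conv_of_real sum_distrib_left sum_distrib_right)
  qed
  finally show ?thesis .
qed

lemma laguerre_fun_tempered_poly:
  assumes lam: "lam > 0" and n: "n \<le> N"
  shows "(\<lambda>x. complex_of_real (laguerre_fun 0 (2 * lam) n x)) \<in> tempered_polys 0 lam N"
proof -
  have b: "2 * lam > 0" using lam by simp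
  let ?p = "smult (sqrt (2 * lam)) (pcompose (laguerre 0 n) [:0, 2 * lam:])"
  let ?q = "map_poly complex_of_real ?p"
  have deg: "degree ?q \<le> N"
  proof -
    have "degree ?q \<le> degree ?p" by (intro degree_le) (simp add: coeff_map_poly coeff_eq_0)
    also have "\<dots> \<le> degree (pcompose (laguerre 0 n) [:0, 2 * lam:])" by (rule degree_smult_le)
    also have "\<dots> \<le> degree (laguerre 0 n) * degree [:0, 2 * lam:]" by (rule degree_pcompose_le)
    also have "\<dots> \<le> degree (laguerre 0 n) * 1" by (intro mult_left_mono) auto
    also have "\<dots> \<le> N" using degree_laguerre[of 0 n] n by simp
    finally show ?thesis .
  qed
  have "complex_of_real (laguerre_fun 0 (2 * lam) n x) = (x powr 0 * exp (- lam * x)) *\<^sub>R poly ?q (of_real x)"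
    if x: "x > 0" for x
  proof -
    have "poly ?q (of_real x) = of_real (poly ?p x)"
    proof -
      have "degree ?q = degree ?p" by (rule degree_map_poly) simp
      thus ?thesis unfolding poly_altdef by (simp add: coeff_map_poly)
    qed
    thus ?thesis
      unfolding laguerre_fun_0[OF b x] using x
      by (simp add: poly_pcompose scaleR_conv_of_real mult_ac)
  qed
  with deg show ?thesis unfolding tempered_polys_def by blast
qed

text \<open>Because \<open>I\<^bsup>k-s\<^esup> (e\<^bsup>\<lambda>x\<^esup> u) = I\<^sup>k (e\<^bsup>\<lambda>x\<^esup> f)\<close>, whose first \<open>k\<close> derivatives lead to \<open>e\<^bsup>\<lambda>x\<^esup> f\<close>, the
  remaining \<open>m\<close> derivatives are those of \<open>e\<^bsup>\<lambda>x\<^esup> f\<close>.\<close>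

lemma has_tempered_deriv_of_integral:
  assumes k: "1 \<le> k" "real k - 1 \<le> s" "s < real k"
    and u: "AE x in half_line. u x = tempered_integral s lam f x"
    and f: "has_tempered_deriv (real m) lam f g"
  shows "has_tempered_deriv (s + real m) lam u g"
proof -
  let ?F = "\<lambda>x. exp (lam * x) *\<^sub>R f x" and ?U = "\<lambda>x. exp (lam * x) *\<^sub>R u x"
  let ?G = "\<lambda>x. exp (lam * x) *\<^sub>R g x"
  obtain \<Phi> where F: "loc_integrable ?F" and \<Phi>: "AE x in half_line. \<Phi> x = ?F x"
      "\<Phi> \<in> borel_measurable half_line" "ac_deriv m \<Phi> ?G"
    by (rule has_tempered_deriv_nat[OF f])
  note U = tempered_integral_rl[OF k F u]
  obtain p where p: "k = Suc p" using k(1) by (cases k) auto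
  have "ac_deriv (Suc p) (rl_integral (real k) ?F) ?F"
    unfolding p by (rule ac_deriv_rl_integral[OF F])
  moreover have "AE x in half_line. ?F x = \<Phi> x" using \<Phi>(1) by eventually_elim simp
  ultimately have ac: "ac_deriv (Suc p + m) (rl_integral (real k) ?F) ?G"
    using \<Phi>(2,3) by (rule ac_deriv_concat)
  have idx: "Suc p + m = Suc (p + m)" by simp
  have "ac_deriv (Suc p + m) (rl_integral (real k - s) ?U) ?G"
  proof -
    from ac_deriv_Suc[THEN iffD1, OF ac[unfolded idx]]
    obtain h' where h': "ac_step (rl_integral (real k) ?F) h' \<and> ac_deriv (p + m) h' ?G" by (rule exE)
    have "ac_step (rl_integral (real k - s) ?U) h'"
      by (rule ac_step_cong_pos[OF conjunct1[OF h']]) (rule U(2)[symmetric])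
    thus ?thesis unfolding idx ac_deriv_Suc using h' by blast
  qed
  moreover have "nat \<lfloor>s + real m\<rfloor> + 1 = Suc p + m"
    using nat_floor_add[OF k, of m] by (simp add: p)
  moreover have "real (Suc p + m) - (s + real m) = real k - s" by (simp add: p)
  ultimately have "has_rl_deriv (s + real m) ?U ?G"
    using U(1) unfolding has_rl_deriv_def Let_def loc_integrable_def by (simp only:)
  moreover have "g = (\<lambda>x. exp (- lam * x) *\<^sub>R ?G x)" by (simp add: fun_eq_iff flip: exp_add)
  ultimately show ?thesis unfolding has_tempered_deriv_def by blast
qed

text \<open>The Petrov--Galerkin solution is the tempered fractional integral of the \<open>L\<^sup>2\<close> projection of \<open>f\<close>
  onto the first Laguerre functions: fractional differentiation turns \<open>x\<^sup>s p(x)\<close> into a polynomial of the same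
  degree, and the Galerkin equations fix its Laguerre coefficients.\<close>

lemma petrov_galerkin_projection:
  assumes k: "1 \<le> k" "real k - 1 \<le> s" "s < real k" and lam: "lam > 0" and f: "square_integrable half_line f"
    and sol: "petrov_galerkin_solution s lam N f uN"
  obtains w where "square_integrable half_line w" "\<And>x. x > 0 \<Longrightarrow> uN x = tempered_integral s lam w x"
    "\<And>n. laguerre_coef 0 (2 * lam) w n = (if n \<le> N then laguerre_coef 0 (2 * lam) f n else 0)"
proof -
  let ?b = "2 * lam"
  interpret L: orthonormal_sequence half_line "laguerre_fun 0 ?b"
    using lam by (intro orthonormal_laguerre_fun) auto
  have s: "s \<ge> 0" using k by simp
  from sol obtain p w where p: "degree p \<le> N"
      "\<And>x. x > 0 \<Longrightarrow> uN x = (x powr s * exp (- lam * x)) *\<^sub>R poly p (complex_of_real x)"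
    and w: "has_tempered_deriv s lam uN w" "\<And>v. v \<in> tempered_polys 0 lam N \<Longrightarrow> L2_inner w v = L2_inner f v"
    unfolding petrov_galerkin_solution_def tempered_polys_def[of s] by blast
  define d where "d j = coeff p j * of_real (Gamma (s + real j + 1) / fact j)" for j
  let ?Q = "\<lambda>t. \<Sum>j\<le>N. d j * complex_of_real t ^ j"
  define w0 where "w0 t = exp (- lam * t) *\<^sub>R ?Q t" for t
  have sq0: "square_integrable half_line w0"
    unfolding w0_def[abs_def] by (rule square_integrable_exp_polynomial[OF lam])
  have G: "Gamma (s + real j + 1) > 0" for j using s by (intro Gamma_real_pos) simp
  have uN: "uN x = tempered_integral s lam w0 x" if x: "x > 0" for x
  proof -
    have "poly p (complex_of_real x) = (\<Sum>j\<le>N. coeff p j * of_real x ^ j)"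
      unfolding poly_altdef
      by (rule sum.mono_neutral_left) (use p(1) in \<open>auto simp: coeff_eq_0\<close>)
    hence "uN x = exp (- lam * x) *\<^sub>R (\<Sum>j\<le>N. coeff p j * of_real (x powr s * x ^ j))"
      unfolding p(2)[OF x] by (simp add: scaleR_conv_of_real sum_distrib_left mult_ac)
    also have "(\<Sum>j\<le>N. coeff p j * of_real (x powr s * x ^ j)) =
        (\<Sum>j\<le>N. d j * of_real (fact j / Gamma (s + real j + 1) * x powr (s + real j)))"
    proof (intro sum.cong refl)
      fix j
      have "Gamma (s + real j + 1) / fact j * (fact j / Gamma (s + real j + 1) * x powr (s + real j)) = x powr s * x ^ j"
        using G[of j] x by (simp add: powr_add powr_realpow)
      hence "complex_of_real (Gamma (s + real j + 1) / fact j * (fact j / Gamma (s + real j + 1) * x powr (s + real j))) =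
          of_real (x powr s * x ^ j)" by (simp only:)
      thus "coeff p j * of_real (x powr s * x ^ j) =
          d j * of_real (fact j / Gamma (s + real j + 1) * x powr (s + real j))"
        unfolding d_def by (simp only: of_real_mult mult.assoc)
    qed
    also have "exp (- lam * x) *\<^sub>R \<dots> = tempered_integral s lam w0 x"
      unfolding w0_def[abs_def] by (rule tempered_integral_polynomial[OF s x, symmetric])
    finally show ?thesis .
  qed
  have ww0: "AE x in half_line. w x = w0 x"
  proof -
    have F: "loc_integrable (\<lambda>t. exp (lam * t) *\<^sub>R w0 t)"
      by (rule loc_integrable_exp_square_integrable[OF sq0 lam])
    have "AE x in half_line. uN x = tempered_integral s lam w0 x" by (rule AE_half_lineI[OF uN])
    note U = tempered_integral_rl[OF k F this]
    obtain h where h: "has_rl_deriv s (\<lambda>x. exp (lam * x) *\<^sub>R uN x) h" "w = (\<lambda>x. exp (- lam * x) *\<^sub>R h x)"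
      using w(1) unfolding has_tempered_deriv_def by blast
    obtain j where j: "k = Suc j" using k(1) by (cases k) auto
    have fl: "nat \<lfloor>s\<rfloor> + 1 = Suc j" using nat_floor_add[OF k, of 0] j by simp
    have 1: "ac_deriv (Suc j) (rl_integral (real k - s) (\<lambda>x. exp (lam * x) *\<^sub>R uN x)) h"
      using h(1) unfolding has_rl_deriv_def Let_def fl j by blast
    have 2: "ac_deriv (Suc j) (rl_integral (real k) (\<lambda>t. exp (lam * t) *\<^sub>R w0 t)) (\<lambda>t. exp (lam * t) *\<^sub>R w0 t)"
      unfolding j by (rule ac_deriv_rl_integral[OF F])
    have "AE x in half_line. h x = exp (lam * x) *\<^sub>R w0 x"
      by (rule ac_deriv_unique[OF 1 2]) (rule AE_half_lineI[OF U(2)])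
    thus ?thesis unfolding h(2) by eventually_elim (simp flip: exp_add)
  qed
  show ?thesis
  proof (rule that[OF sq0 uN])
    fix n
    show "L.coef w0 n = (if n \<le> N then L.coef f n else 0)"
    proof (cases "n \<le> N")
      case True
      let ?v = "\<lambda>x. complex_of_real (laguerre_fun 0 ?b n x)"
      have "L.coef g n = L2_inner g ?v" for g by (simp add: L.coef_def L2_inner_def)
      moreover have "L2_inner w ?v = L2_inner f ?v" by (rule w(2)[OF laguerre_fun_tempered_poly[OF lam True]])
      moreover have "L.coef w0 n = L.coef w n"
      proof (rule L.coef_cong_AE)
        show "w0 \<in> borel_measurable half_line" by (rule square_integrableD(1)[OF sq0])
        have ae: "AE x in half_line. w0 x = w x" using ww0 by eventually_elim simp
        show "w \<in> borel_measurable half_line"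
          by (rule half_line_measurable_AE[OF square_integrableD(1)[OF sq0] ae])
        show "AE x in half_line. w0 x = w x" by (rule ae)
      qed
      ultimately show ?thesis using True by simp
    next
      case False
      thus ?thesis unfolding w0_def[abs_def] using laguerre_coef_exp_polynomial[OF lam, of N n d] by simp
    qed
  qed
qed

section \<open>The error estimate\<close>

lemma fact_Gamma_ratio_antimono:
  fixes z :: real
  assumes z: "z \<ge> 0" and ij: "i \<le> j"
  shows "fact j / Gamma (z + real j + 1) \<le> fact i / Gamma (z + real i + 1)"
  using ij
proof (induction j rule: dec_induct)
  case base
  show ?case by simp
next
  case (step j)
  have G: "Gamma (z + real j + 1) > 0" using z by (intro Gamma_real_pos) simp
  have pos: "z + real j + 1 > 0" using z by simp
  have "Gamma (z + real (Suc j) + 1) = (z + real j + 1) * Gamma (z + real j + 1)"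
    using Gamma_plus1[of "z + real j + 1"] pos by (simp add: add_ac nonpos_Ints_def)
  hence "fact (Suc j) / Gamma (z + real (Suc j) + 1) =
      (real j + 1) / (z + real j + 1) * (fact j / Gamma (z + real j + 1))"
    by (simp add: add_ac)
  also have "\<dots> \<le> 1 * (fact j / Gamma (z + real j + 1))"
    using z G pos by (intro mult_right_mono) auto
  also have "\<dots> \<le> fact i / Gamma (z + real i + 1)" using step.IH by simp
  finally show ?case .
qed

text \<open>Gauss's product formula for the Gamma function.\<close>

lemma fact_Gamma_ratio_limit:
  fixes z :: real
  assumes z: "z \<ge> 0"
  shows "(\<lambda>n. fact n * real n powr z / Gamma (z + real n + 1)) \<longlonglongrightarrow> 1"
proof (cases "z = 0")
  case True
  have "\<forall>\<^sub>F n in sequentially. fact n * real n powr z / Gamma (z + real n + 1) = 1"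
  proof (intro eventually_sequentiallyI[of 1])
    fix n :: nat assume "1 \<le> n"
    thus "fact n * real n powr z / Gamma (z + real n + 1) = 1"
      using True Gamma_fact[of n, where 'a = real] by (simp add: add_ac)
  qed
  thus ?thesis by (rule tendsto_eventually)
next
  case False
  hence z0: "z > 0" using z by simp
  hence G: "Gamma z > 0" by (rule Gamma_real_pos)
  have "(\<lambda>n. Gamma_series z n / Gamma z) \<longlonglongrightarrow> Gamma z / Gamma z"
    using G by (intro tendsto_divide Gamma_series_LIMSEQ tendsto_const) simp
  moreover have "\<forall>\<^sub>F n in sequentially. Gamma_series z n / Gamma z = fact n * real n powr z / Gamma (z + real n + 1)"
  proof (intro eventually_sequentiallyI[of 1])
    fix n :: nat assume n: "1 \<le> n"
    have "pochhammer z (n + 1) = Gamma (z + real (n + 1)) / Gamma z"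
      using z0 by (intro pochhammer_Gamma) (auto simp: nonpos_Ints_def)
    hence "pochhammer z (n + 1) * Gamma z = Gamma (z + real n + 1)"
      using G by (simp add: add_ac)
    moreover have "exp (z * ln (real n)) = real n powr z" using n by (simp add: powr_def)
    ultimately show "Gamma_series z n / Gamma z = fact n * real n powr z / Gamma (z + real n + 1)"
      unfolding Gamma_series_def by (simp del: pochhammer_Suc)
  qed
  ultimately show ?thesis using G by (simp add: tendsto_cong)
qed

text \<open>The square root of the largest quotient of diagonal entries, at \<open>n = N + 1\<close>, with the power of \<open>N\<close> from
  the error bound divided out.\<close>

definition error_constant :: "real \<Rightarrow> nat \<Rightarrow> nat \<Rightarrow> real" where
  "error_constant s m N =
     sqrt (real N powr (s + real m) * (fact (N + 1 - m) / Gamma (s + real N + 2)))"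

lemma error_constant_limit:
  assumes s: "s \<ge> 0"
  shows "error_constant s m \<longlonglongrightarrow> 1"
proof (rule LIMSEQ_offset[where k = m])
  let ?z = "s + real m"
  have z: "?z \<ge> 0" using s by simp
  have "(\<lambda>N. sqrt ((fact (Suc N) * real (Suc N) powr ?z / Gamma (?z + real (Suc N) + 1)) *
      (real (N + m) / real (Suc N)) powr ?z)) \<longlonglongrightarrow> sqrt (1 * 1 powr ?z)"
  proof (intro tendsto_real_sqrt tendsto_mult)
    show "(\<lambda>N. fact (Suc N) * real (Suc N) powr ?z / Gamma (?z + real (Suc N) + 1)) \<longlonglongrightarrow> 1"
      using LIMSEQ_Suc[OF fact_Gamma_ratio_limit[OF z]] .
    have "(\<lambda>N. 1 + (real m - 1) * (1 / real (Suc N))) \<longlonglongrightarrow> 1 + (real m - 1) * 0"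
      by (intro tendsto_add tendsto_mult tendsto_const LIMSEQ_Suc[OF lim_1_over_n])
    moreover have "1 + (real m - 1) * (1 / real (Suc N)) = real (N + m) / real (Suc N)" for N
      by (simp add: field_simps)
    ultimately have "(\<lambda>N. real (N + m) / real (Suc N)) \<longlonglongrightarrow> 1" by simp
    thus "(\<lambda>N. (real (N + m) / real (Suc N)) powr ?z) \<longlonglongrightarrow> 1 powr ?z"
      by (intro tendsto_powr tendsto_const) simp_all
  qed
  moreover have "sqrt ((fact (Suc N) * real (Suc N) powr ?z / Gamma (?z + real (Suc N) + 1)) *
      (real (N + m) / real (Suc N)) powr ?z) = error_constant s m (N + m)" for N
  proof -
    have "real (Suc N) powr ?z * (real (N + m) / real (Suc N)) powr ?z = real (N + m) powr ?z"
      by (simp add: powr_divide del: of_nat_Suc of_nat_add)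
    moreover have "?z + real (Suc N) + 1 = s + real (N + m) + 2" "N + m + 1 - m = Suc N" by auto
    ultimately show ?thesis
      unfolding error_constant_def by (simp only: times_divide_eq_left mult.assoc) (simp only: times_divide_eq_right mult_ac)
  qed
  ultimately show "(\<lambda>N. error_constant s m (N + m)) \<longlonglongrightarrow> 1" by simp
qed

text \<open>Term by term, the coefficients of \<open>r\<close> are expressed by those of \<open>g\<close>; the quotient is largest at the
  first index \<open>N + 1\<close>, and Bessel's inequality sums up the coefficients of \<open>g\<close>.\<close>

lemma coefficient_sum_le:
  assumes s: "s \<ge> 0" and lam: "lam > 0" and f: "f \<in> wL2 0" and mN: "m \<le> N + 1"
    and fg: "has_tempered_deriv (real m) lam f g" and g: "g \<in> wL2 (real m)"
    and r: "\<And>n. laguerre_coef 0 (2 * lam) r n = (if n \<le> N then 0 else laguerre_coef 0 (2 * lam) f n)"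
  shows "(\<Sum>n<K. (cmod (laguerre_coef 0 (2 * lam) r n))\<^sup>2 *
      (fact n / (Gamma (s + real n + 1) * (2 * lam) powr s))) \<le>
    (fact (N + 1 - m) / Gamma (s + real N + 2)) / (2 * lam) powr (s + real m) * (wnorm (real m) g)\<^sup>2"
proof -
  let ?b = "2 * lam"
  have b: "?b > 0" using lam by simp
  interpret Lm: orthonormal_sequence half_line "laguerre_fun (real m) ?b"
    using lam by (intro orthonormal_laguerre_fun) auto
  let ?g = "\<lambda>x. of_real (x powr (real m / 2)) * g x"
  let ?A = "(fact (N + 1 - m) / Gamma (s + real N + 2)) / ?b powr (s + real m)"
  let ?c = "\<lambda>n. (cmod (laguerre_coef 0 ?b r n))\<^sup>2 * (fact n / (Gamma (s + real n + 1) * ?b powr s))"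
  let ?e = "\<lambda>j. (cmod (Lm.coef ?g j))\<^sup>2"
  have G: "Gamma (s + real n + 1) > 0" for n using s by (intro Gamma_real_pos) simp
  have A: "?A \<ge> 0"
    using G[of "N + 1"] by (intro divide_nonneg_nonneg) (auto simp: add_ac)
  have term_le: "?c n \<le> (if n \<le> N then 0 else ?A * ?e (n - m))" for n
  proof (cases "n \<le> N")
    case True
    thus ?thesis by (simp add: r)
  next
    case False
    \<comment> \<open>The truncated subtraction is exact, since \<open>n > N\<close> and \<open>m \<le> N + 1\<close>.\<close>
    define j where "j = n - m"
    have n: "n = j + m" "N + 1 - m \<le> j" using False mN by (auto simp: j_def)
    have e: "?e j = ?b ^ m * (fact n / fact j) * (cmod (laguerre_coef 0 ?b f n))\<^sup>2"
      using laguerre_coef_tempered_deriv[OF lam f fg g, of j] n(1) by simp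
    have "?c n = (fact j / Gamma ((s + real m) + real j + 1)) / (?b powr s * ?b ^ m) * ?e j"
      unfolding e using False b by (simp add: r n(1) add_ac)
    also have "?b powr s * ?b ^ m = ?b powr (s + real m)" using b by (simp add: powr_add powr_realpow)
    also have "(fact j / Gamma ((s + real m) + real j + 1)) / ?b powr (s + real m) * ?e j \<le> ?A * ?e j"
    proof (intro mult_right_mono divide_right_mono)
      have "fact j / Gamma ((s + real m) + real j + 1) \<le>
          fact (N + 1 - m) / Gamma ((s + real m) + real (N + 1 - m) + 1)"
        using s n(2) by (intro fact_Gamma_ratio_antimono) auto
      also have "(s + real m) + real (N + 1 - m) + 1 = s + real N + 2" using mN by (simp add: of_nat_diff)
      finally show "fact j / Gamma ((s + real m) + real j + 1) \<le> fact (N + 1 - m) / Gamma (s + real N + 2)" .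
    qed auto
    finally show ?thesis using False by (simp add: j_def)
  qed
  have "(\<Sum>n<K. ?c n) \<le> (\<Sum>n<K. if n \<le> N then 0 else ?A * ?e (n - m))"
    by (intro sum_mono term_le)
  also have "\<dots> = (\<Sum>n\<in>{N<..<K}. ?A * ?e (n - m))"
    by (rule sum.mono_neutral_cong_right) auto
  also have "\<dots> = (\<Sum>j\<in>(\<lambda>n. n - m) ` {N<..<K}. ?A * ?e j)"
    using mN by (subst sum.reindex) (auto simp: inj_on_def)
  also have "\<dots> \<le> (\<Sum>j<K. ?A * ?e j)"
  proof (rule sum_mono2)
    show "0 \<le> ?A * ?e j" for j using A by (rule mult_nonneg_nonneg) simp
  qed auto
  also have "\<dots> = ?A * (\<Sum>j<K. ?e j)" by (simp only: sum_distrib_left)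
  also have "\<dots> \<le> ?A * sqnorm half_line ?g"
    by (intro mult_left_mono Lm.bessel_inequality wL2_square_integrable(1)[OF g] A)
  also have "sqnorm half_line ?g = (wnorm (real m) g)\<^sup>2"
    unfolding wL2_square_integrable(2)[OF g] by (simp add: sqnorm_nonneg)
  finally show ?thesis .
qed

theorem theorem5:
  fixes s :: real and k m :: nat
  assumes "1 \<le> k" and "real k - 1 \<le> s" and "s < real k"
  shows "\<exists>c :: nat \<Rightarrow> real. c \<longlonglongrightarrow> 1 \<and>
    (\<forall>(lam :: real) f u uN g (N :: nat).
       0 < lam \<longrightarrow> 1 \<le> N \<longrightarrow> m \<le> N + 1 \<longrightarrow>
       f \<in> wL2 0 \<longrightarrow>
       tempered_ivp_solution k s lam f u \<longrightarrow>
       petrov_galerkin_solution s lam N f uN \<longrightarrow>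
       has_tempered_deriv (real m) lam f g \<longrightarrow> g \<in> wL2 (real m) \<longrightarrow>
       (\<lambda>x. u x - uN x) \<in> wL2 (- s) \<and>
       (\<exists>h. has_tempered_deriv (s + real m) lam u h \<and> h \<in> wL2 (real m) \<and>
          wnorm (- s) (\<lambda>x. u x - uN x)
            \<le> c N * (2 * lam * real N) powr (- (s + real m) / 2) * wnorm (real m) h \<and>
          wnorm (real m) h = wnorm (real m) g))"
proof -
  have s: "s \<ge> 0" using assms by simp
  have main: "(\<lambda>x. u x - uN x) \<in> wL2 (- s) \<and>
       (\<exists>h. has_tempered_deriv (s + real m) lam u h \<and> h \<in> wL2 (real m) \<and>
          wnorm (- s) (\<lambda>x. u x - uN x)
            \<le> error_constant s m N * (2 * lam * real N) powr (- (s + real m) / 2) * wnorm (real m) h \<and>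
          wnorm (real m) h = wnorm (real m) g)"
    if lam: "0 < lam" and N: "1 \<le> N" and mN: "m \<le> N + 1" and f: "f \<in> wL2 0"
      and sol: "tempered_ivp_solution k s lam f u" and pg: "petrov_galerkin_solution s lam N f uN"
      and fg: "has_tempered_deriv (real m) lam f g" and g: "g \<in> wL2 (real m)"
    for lam :: real and f u uN g and N :: nat
  proof -
    let ?b = "2 * lam"
    have sqf: "square_integrable half_line f" by (rule wL2_0_square_integrable[OF f])
    interpret L: orthonormal_sequence half_line "laguerre_fun 0 ?b"
      using lam by (intro orthonormal_laguerre_fun) auto
    have u: "AE x in half_line. u x = tempered_integral s lam f x"
      using sol unfolding tempered_ivp_solution_def
    proof
      assume "solves_tempered_ivp k s lam f u"
      thus ?thesis
        by (rule solves_tempered_ivp_integral_formula[OF assms lam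
              loc_integrable_exp_square_integrable[OF sqf lam]])
    qed
    obtain w where w: "square_integrable half_line w" "\<And>x. x > 0 \<Longrightarrow> uN x = tempered_integral s lam w x"
      "\<And>n. L.coef w n = (if n \<le> N then L.coef f n else 0)"
      by (rule petrov_galerkin_projection[OF assms lam sqf pg]) blast
    define r where "r x = f x - w x" for x
    have sqr: "square_integrable half_line r"
      unfolding r_def[abs_def] by (rule square_integrable_diff[OF sqf w(1)])
    have coef_r: "L.coef r n = (if n \<le> N then 0 else L.coef f n)" for n
      unfolding r_def[abs_def] L.coef_diff[OF sqf w(1)] w(3) by simp
    define B where "B = (fact (N + 1 - m) / Gamma (s + real N + 2)) / ?b powr (s + real m) * (wnorm (real m) g)\<^sup>2"
    let ?W = "\<lambda>x. of_real (x powr (- s / 2)) * tempered_integral s lam r x"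
    have W: "square_integrable half_line ?W \<and> sqnorm half_line ?W \<le> B"
      unfolding B_def
      by (intro tempered_integral_sqnorm_le s lam sqr)
         (rule coefficient_sum_le[OF s lam f mN fg g coef_r])
    have err: "AE x in half_line. tempered_integral s lam r x = u x - uN x"
      using u tempered_integral_diff_AE[OF s lam sqf w(1)] AE_half_line_pos
      by eventually_elim (simp add: r_def[abs_def] w(2))
    have meas: "(\<lambda>x. u x - uN x) \<in> borel_measurable half_line"
      by (rule half_line_measurable_AE[OF tempered_integral_measurable[OF s lam sqr] err])
    let ?E = "\<lambda>x. of_real (x powr (- s / 2)) * (u x - uN x)"
    have mE: "?E \<in> borel_measurable half_line"
    proof -
      have "(\<lambda>x. complex_of_real (x powr (- s / 2))) \<in> borel_measurable half_line"
        by (intro borel_measurable_lebesgue_onI) measurable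
      thus ?thesis using meas by (rule borel_measurable_times)
    qed
    have EW: "AE x in half_line. ?W x = ?E x" using err by eventually_elim simp
    have sqE: "square_integrable half_line ?E"
      by (rule square_integrable_cong_AE[OF conjunct1[OF W] mE EW])
    have sq_eq: "(cmod (?E x))\<^sup>2 = (cmod (u x - uN x))\<^sup>2 * x powr - s" for x
    proof -
      have "(x powr (- s / 2))\<^sup>2 = x powr - s" by (simp add: power2_eq_square flip: powr_add)
      thus ?thesis
        by (simp only: norm_mult power_mult_distrib norm_of_real power2_abs mult.commute)
    qed
    have mem: "(\<lambda>x. u x - uN x) \<in> wL2 (- s)"
      using meas square_integrableD(2)[OF sqE] unfolding wL2_def sq_eq by simp
    have "(wnorm (- s) (\<lambda>x. u x - uN x))\<^sup>2 = sqnorm half_line ?E"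
      unfolding wL2_square_integrable(2)[OF mem] by (simp add: sqnorm_nonneg)
    also have "\<dots> = sqnorm half_line ?W"
      by (rule sqnorm_cong_AE[OF square_integrableD(1)[OF conjunct1[OF W]] mE EW, symmetric])
    also have "\<dots> \<le> B" using W by blast
    also have "B = (error_constant s m N * (2 * lam * real N) powr (- (s + real m) / 2) * wnorm (real m) g)\<^sup>2"
    proof -
      have G: "Gamma (s + real N + 2) > 0" using s by (intro Gamma_real_pos) simp
      have "(error_constant s m N)\<^sup>2 = real N powr (s + real m) * (fact (N + 1 - m) / Gamma (s + real N + 2))"
        unfolding error_constant_def using G by (intro real_sqrt_pow2 mult_nonneg_nonneg divide_nonneg_nonneg) auto
      moreover have "((2 * lam * real N) powr (- (s + real m) / 2))\<^sup>2 = (2 * lam * real N) powr - (s + real m)"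
        by (simp add: power2_eq_square flip: powr_add)
      moreover have "(2 * lam * real N) powr - (s + real m) = 1 / (?b powr (s + real m) * real N powr (s + real m))"
        using lam by (simp only: powr_minus_divide powr_mult)
      moreover have "real N powr (s + real m) > 0" using N by simp
      ultimately show ?thesis
        unfolding B_def power_mult_distrib by (simp only:) (simp add: field_simps)
    qed
    finally have est: "wnorm (- s) (\<lambda>x. u x - uN x) \<le>
        error_constant s m N * (2 * lam * real N) powr (- (s + real m) / 2) * wnorm (real m) g"
    proof (rule power2_le_imp_le)
      show "0 \<le> error_constant s m N * (2 * lam * real N) powr (- (s + real m) / 2) * wnorm (real m) g"
        using s Gamma_real_pos[of "s + real N + 2"]
        by (intro mult_nonneg_nonneg) (auto simp: error_constant_def wnorm_def)
    qed
    show ?thesis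
      using mem has_tempered_deriv_of_integral[OF assms u fg] g est by blast
  qed
  show ?thesis
    by (intro exI[of _ "error_constant s m"] conjI error_constant_limit s allI impI main)
qed

end
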